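(* Let $C$ be a conjugation on a Hilbert space $\mathcal H$ and let $T$ be a closed $C$-symmetric dissipative operator on $\mathcal H$ with dense domain. With the notation of the context, the following are equivalent: (i) The operator $T$ admits a unique $C$-self-adjoint maximal dissipative extension. (ii) The operator $T$ admits a unique maximal dissipative extension $\widetilde T_0$ such that $\widetilde T_0^*$ is a maximal anti-dissipative extension of $S:=CTC$. (iii) For at least one $\lambda\in\mathbb C_+$ (and then for all such $\lambda$) the equality $\operatorname{ran}\mathcal D_{V_\lambda^*}\cap C\mathfrak N_\lambda=\{0\}$ holds. (iv) For at least one $\lambda\in\mathbb C_+$ (and then for all such $\lambda$) the equality $$\inf_{h\in\mathfrak M_{\bar\lambda}}\|\mathcal D_{V_\lambda^*}C\varphi_\lambda-\mathcal D_{V_\lambda^*}Ch\|^2=0$$ is satisfied for each $\varphi_\lambda\in\mathfrak N_\lambda\setminus\{0\}$. (v) For at least one $\lambda\in\mathbb C_+$ (and then for all such $\lambda$) the equality $$\sup_{f\in\mathcal H}\frac{|(Cf,\varphi_\lambda)|^2}{\|\mathcal D_{V_\lambda^*}f\|^2}=+\infty$$ holds for each $\varphi_\lambda\in\mathfrak N_\lambda\setminus\{0\}$. (vi) For at least one $\lambda\in\mathbb C_+$ (and then for all such $\lambda$) the equality $$\inf_{\psi\in\mathcal G_\lambda}\operatorname{Im}\left(-\widetilde T_\lambda^*(f-\psi),f-\psi\right)=0\qquad\forall f\in\operatorname{dom}\widetilde T_\lambda^*\setminus\{0\}$$ is valid. (vii) For at least one $\lambda\in\mathbb C_+$ (and then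 for all such $\lambda$) the equality $$\sup_{g\in\operatorname{dom}\widetilde T_\lambda^*}\frac{|(C(\widetilde T_\lambda^*-\lambda I)g,\varphi_\lambda)|^2}{-\operatorname{Im}(\widetilde T_\lambda^*g,g)}=+\infty$$ holds for each $\varphi_\lambda\in\mathfrak N_\lambda\setminus\{0\}$.
   Context: A conjugation on $\mathcal H$ is an anti-linear isometric operator $C$ on $\mathcal H$ with $C^2=I$. A densely defined operator $T$ is $C$-symmetric if $T\subseteq CT^*C$ and $C$-self-adjoint if $T=CT^*C$. $T$ is dissipative if $\operatorname{Im}(Tf,f)\ge0$ for all $f\in\operatorname{dom}T$, and maximal dissipative if it is dissipative and has no proper dissipative extension on $\mathcal H$; $T$ is (maximal) anti-dissipative, also called accumulative, if $-T$ is (maximal) dissipative. $S=CTC$ has domain $C\operatorname{dom}T$. $\mathbb C_+$ is the open upper half-plane. For $\lambda\in\mathbb C_+$: $\mathfrak M_{\bar\lambda}:=\operatorname{ran}(T-\bar\lambda I)$ (a closed subspace), $\mathfrak N_\lambda:=\mathcal H\ominus\mathfrak M_{\bar\lambda}=\ker(T^*-\lambda I)$. The Cayley transform $V_\lambda:\mathfrak M_{\bar\lambda}\to\mathcal H$, $V_\lambda(T-\bar\lambda I)f=(T-\lambda I)f$ for $f\in\operatorname{dom}T$, is a contraction with domain $\mathfrak M_{\bar\lambda}$; $V_\lambda^*:\mathcal H\to\mathfrak M_{\bar\lambda}$ is its adjoint and $\mathcal D_{V_\lambda^*}:=(I-V_\lambda V_\lambda^* )^{1/2}$. The operator $\widetilde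 T_\lambda$ with $\operatorname{dom}\widetilde T_\lambda=\operatorname{dom}T\dotplus\mathfrak N_\lambda$ (direct sum), $\widetilde T_\lambda(f_T+\varphi_\lambda)=Tf_T+\lambda\varphi_\lambda$ for $f_T\in\operatorname{dom}T$, $\varphi_\lambda\in\mathfrak N_\lambda$, is a maximal dissipative extension of $T$. Put $\mathcal G_\lambda:=(\widetilde T_\lambda^*-\lambda I)^{-1}C\mathfrak M_{\bar\lambda}$. In quotients the convention $0/0=0$ is used (and $a/0=+\infty$ for $a>0$). *)

theory Defs
  imports "HOL-Analysis.Analysis"
begin

section \<open>Complex Hilbert spaces\<close>

class complex_vector = real_vector +
  fixes scaleC :: "complex \<Rightarrow> 'a \<Rightarrow> 'a"  (infixr "*\<^sub>C" 75)
  assumes scaleC_add_right: "c *\<^sub>C (x + y) = c *\<^sub>C x + c *\<^sub>C y"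
    and scaleC_add_left: "(c + d) *\<^sub>C x = c *\<^sub>C x + d *\<^sub>C x"
    and scaleC_scaleC: "c *\<^sub>C d *\<^sub>C x = (c * d) *\<^sub>C x"
    and scaleC_one: "1 *\<^sub>C x = x"
    and scaleR_scaleC: "scaleR r x = complex_of_real r *\<^sub>C x"

text \<open>The inner product is linear in the first and anti-linear in the second argument.
  Its real part is the inner product of the underlying real space, so norm, topology and
  completeness are those of the library, and \<open>norm x = sqrt (Re (cinner x x))\<close>.\<close>

class complex_inner = complex_vector + real_inner +
  fixes cinner :: "'a \<Rightarrow> 'a \<Rightarrow> complex"
  assumes cinner_commute: "cinner x y = cnj (cinner y x)"
    and cinner_add_left: "cinner (x + y) z = cinner x z + cinner y z"
    and cinner_scaleC_left: "cinner (c *\<^sub>C x) y = c * cinner x y"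
    and inner_eq_Re_cinner: "inner x y = Re (cinner x y)"

class complex_hilbert_space = complex_inner + complete_space

instantiation complex :: complex_hilbert_space
begin

definition scaleC_complex :: "complex \<Rightarrow> complex \<Rightarrow> complex"
  where "scaleC_complex c x = c * x"

definition cinner_complex :: "complex \<Rightarrow> complex \<Rightarrow> complex"
  where "cinner_complex x y = x * cnj y"

instance
  by standard
    (simp_all add: scaleC_complex_def cinner_complex_def algebra_simps scaleR_conv_of_real
      inner_complex_def)

end

definition csubspace :: "'a::complex_vector set \<Rightarrow> bool"
  where "csubspace U \<longleftrightarrow>
    0 \<in> U \<and> (\<forall>x\<in>U. \<forall>y\<in>U. x + y \<in> U) \<and> (\<forall>c. \<forall>x\<in>U. c *\<^sub>C x \<in> U)"

definition ortho_compl :: "'a::complex_inner set \<Rightarrow> 'a set"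
  where "ortho_compl U = {x. \<forall>u\<in>U. cinner x u = 0}"


section \<open>Unbounded operators\<close>

text \<open>An operator with a domain is a partial function, so that \<open>A = B\<close> is equality of operators
  including their domains, \<open>A \<subseteq>\<^sub>m B\<close> says that \<open>B\<close> extends \<open>A\<close>, and domain and range are
  \<open>dom A\<close> and \<open>ran A\<close>.\<close>

type_synonym 'a operator = "'a \<rightharpoonup> 'a"

abbreviation app :: "'a operator \<Rightarrow> 'a \<Rightarrow> 'a"
  where "app A f \<equiv> the (A f)"

definition linear_op :: "'a::complex_vector operator \<Rightarrow> bool"
  where "linear_op A \<longleftrightarrow> csubspace (dom A) \<and>
    (\<forall>f\<in>dom A. \<forall>g\<in>dom A. app A (f + g) = app A f + app A g) \<and>
    (\<forall>c. \<forall>f\<in>dom A. app A (c *\<^sub>C f) = c *\<^sub>C app A f)"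

definition densely_defined :: "'a::topological_space operator \<Rightarrow> bool"
  where "densely_defined A \<longleftrightarrow> closure (dom A) = UNIV"

definition closed_op :: "'a::topological_space operator \<Rightarrow> bool"
  where "closed_op A \<longleftrightarrow> closed (Map.graph A)"

text \<open>\<open>A - z I\<close>\<close>
definition shift_op :: "'a::complex_vector operator \<Rightarrow> complex \<Rightarrow> 'a operator"
  where "shift_op A z = (\<lambda>f. map_option (\<lambda>g. g - z *\<^sub>C f) (A f))"

definition neg_op :: "'a::complex_vector operator \<Rightarrow> 'a operator"
  where "neg_op A = (\<lambda>f. map_option uminus (A f))"

text \<open>The inverse of an injective operator, with domain \<open>ran A\<close>.\<close>
definition inv_op :: "'a operator \<Rightarrow> 'a operator"
  where "inv_op A = (\<lambda>h. if h \<in> ran A then Some (THE f. A f = Some h) else None)"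

text \<open>The adjoint of an operator \<open>A\<close> acting from the Hilbert space \<open>K\<close> (a closed subspace in
  which \<open>dom A\<close> is dense) to the whole space; its values lie in \<open>K\<close>.\<close>
definition adjoint_from :: "'a::complex_inner set \<Rightarrow> 'a operator \<Rightarrow> 'a operator"
  where "adjoint_from K A = (\<lambda>g.
    if \<exists>h\<in>K. \<forall>f\<in>dom A. cinner (app A f) g = cinner f h
    then Some (THE h. h \<in> K \<and> (\<forall>f\<in>dom A. cinner (app A f) g = cinner f h))
    else None)"

abbreviation adj :: "'a::complex_inner operator \<Rightarrow> 'a operator"
  where "adj A \<equiv> adjoint_from UNIV A"


section \<open>Conjugations and dissipative operators\<close>

definition conjugation :: "('a::complex_inner \<Rightarrow> 'a) \<Rightarrow> bool"
  where "conjugation C \<longleftrightarrow>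
    (\<forall>x y. C (x + y) = C x + C y) \<and> (\<forall>c x. C (c *\<^sub>C x) = cnj c *\<^sub>C C x) \<and>
    (\<forall>x. norm (C x) = norm x) \<and> (\<forall>x. C (C x) = x)"

text \<open>\<open>C A C\<close>, with domain \<open>C ` dom A\<close>.\<close>
definition conj_op :: "('a \<Rightarrow> 'a) \<Rightarrow> 'a operator \<Rightarrow> 'a operator"
  where "conj_op C A = (\<lambda>f. map_option C (A (C f)))"

definition C_symmetric :: "('a::complex_inner \<Rightarrow> 'a) \<Rightarrow> 'a operator \<Rightarrow> bool"
  where "C_symmetric C A \<longleftrightarrow>
    linear_op A \<and> densely_defined A \<and> A \<subseteq>\<^sub>m conj_op C (adj A)"

definition C_selfadjoint :: "('a::complex_inner \<Rightarrow> 'a) \<Rightarrow> 'a operator \<Rightarrow> bool"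
  where "C_selfadjoint C A \<longleftrightarrow>
    linear_op A \<and> densely_defined A \<and> A = conj_op C (adj A)"

definition dissipative :: "'a::complex_inner operator \<Rightarrow> bool"
  where "dissipative A \<longleftrightarrow> linear_op A \<and> (\<forall>f\<in>dom A. 0 \<le> Im (cinner (app A f) f))"

definition max_dissipative :: "'a::complex_inner operator \<Rightarrow> bool"
  where "max_dissipative A \<longleftrightarrow>
    dissipative A \<and> (\<forall>B. dissipative B \<and> A \<subseteq>\<^sub>m B \<longrightarrow> B = A)"

definition max_antidissipative :: "'a::complex_inner operator \<Rightarrow> bool"
  where "max_antidissipative A \<longleftrightarrow> max_dissipative (neg_op A)"


section \<open>The Cayley transform and its defect operator\<close>

definition bounded_positive :: "('a::complex_inner \<Rightarrow> 'a) \<Rightarrow> bool"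
  where "bounded_positive R \<longleftrightarrow>
    bounded_linear R \<and> (\<forall>c x. R (c *\<^sub>C x) = c *\<^sub>C R x) \<and>
    (\<forall>x. Im (cinner (R x) x) = 0 \<and> 0 \<le> Re (cinner (R x) x))"

text \<open>The unique bounded positive square root of a bounded positive operator.\<close>
definition sqrt_op :: "('a::complex_inner \<Rightarrow> 'a) \<Rightarrow> 'a \<Rightarrow> 'a"
  where "sqrt_op A = (THE R. bounded_positive R \<and> R \<circ> R = A)"

text \<open>The point \<open>\<lambda>\<close> of the upper half-plane is called \<open>z\<close>.
  \<open>ran_space T z\<close> and \<open>defect_space T z\<close> are the spaces \<open>\<MM>\<close> (with index the conjugate
  of \<open>z\<close>) and \<open>\<NN>\<close> (with index \<open>z\<close>).\<close>

definition ran_space :: "'a::complex_inner operator \<Rightarrow> complex \<Rightarrow> 'a set"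
  where "ran_space T z = ran (shift_op T (cnj z))"

definition defect_space :: "'a::complex_inner operator \<Rightarrow> complex \<Rightarrow> 'a set"
  where "defect_space T z = ortho_compl (ran_space T z)"

lemma defect_space_eq_kernel:
  assumes "densely_defined T"
  shows "defect_space T z = {\<phi>. adj T \<phi> = Some (z *\<^sub>C \<phi>)}"
proof -
  have minus: "- x = (- 1) *\<^sub>C x" for x :: 'a
    using scaleR_scaleC[of "-1" x] by simp
  have diff: "cinner (x - y) u = cinner x u - cinner y u" for x y u :: 'a
    by (metis cinner_add_left cinner_scaleC_left minus diff_conv_add_uminus mult_minus1)
  have scale_right: "cinner x (c *\<^sub>C y) = cnj c * cinner x y" for c and x y :: 'a
    by (metis cinner_commute cinner_scaleC_left complex_cnj_mult)
  have uniq: "h = h'" if "\<forall>f\<in>dom T. cinner f h = cinner f h'" for h h'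
  proof -
    have "dom T \<subseteq> {f. inner f (h - h') = 0}"
    proof
      fix f assume "f \<in> dom T"
      with that have "inner f h = inner f h'" by (simp only: inner_eq_Re_cinner)
      then show "f \<in> {f. inner f (h - h') = 0}" by (simp add: inner_diff_right)
    qed
    moreover have "closed {f. inner f (h - h') = 0}"
      by (intro closed_Collect_eq continuous_intros)
    ultimately have "closure (dom T) \<subseteq> {f. inner f (h - h') = 0}"
      by (rule closure_minimal)
    with assms have "inner (h - h') (h - h') = 0"
      unfolding densely_defined_def by blast
    then show ?thesis by simp
  qed
  have adj: "adj T \<phi> = Some h \<longleftrightarrow> (\<forall>f\<in>dom T. cinner (app T f) \<phi> = cinner f h)" for \<phi> h
  proof -
    define P where "P k \<longleftrightarrow> (\<forall>f\<in>dom T. cinner (app T f) \<phi> = cinner f k)" for k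
    have eq: "adj T \<phi> = (if \<exists>k. P k then Some (THE k. P k) else None)"
      unfolding adjoint_from_def P_def by simp
    have "k = k'" if "P k" "P k'" for k k'
      using that uniq[of k k'] unfolding P_def by simp
    then have the: "(THE k. P k) = k" if "P k" for k
      using that by (intro the_equality) blast+
    have "adj T \<phi> = Some h \<longleftrightarrow> P h"
    proof (cases "\<exists>k. P k")
      case True
      then obtain k where "P k" by blast
      with the[of k] the[of h] eq show ?thesis by auto
    qed (simp add: eq)
    then show ?thesis by (simp only: P_def)
  qed
  have "ran_space T z = {app T f - cnj z *\<^sub>C f | f. f \<in> dom T}"
    unfolding ran_space_def ran_def shift_op_def by force
  then have "\<phi> \<in> defect_space T z \<longleftrightarrow>
      (\<forall>f\<in>dom T. cinner \<phi> (app T f - cnj z *\<^sub>C f) = 0)" for \<phi>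
    unfolding defect_space_def ortho_compl_def by (simp, blast)
  moreover have "cinner \<phi> (app T f - cnj z *\<^sub>C f) = 0 \<longleftrightarrow> cinner (app T f) \<phi> = cinner f (z *\<^sub>C \<phi>)"
    for \<phi> f
  proof -
    have "cinner \<phi> (app T f - cnj z *\<^sub>C f) = cnj (cinner (app T f) \<phi> - cnj z * cinner f \<phi>)"
      by (subst cinner_commute) (simp only: diff cinner_scaleC_left)
    then show ?thesis by (simp add: scale_right del: complex_cnj_diff complex_cnj_mult)
  qed
  ultimately show ?thesis by (auto simp: adj)
qed

definition cayley :: "'a::complex_inner operator \<Rightarrow> complex \<Rightarrow> 'a operator"
  where "cayley T z = shift_op T z \<circ>\<^sub>m inv_op (shift_op T (cnj z))"

definition cayley_adj :: "'a::complex_inner operator \<Rightarrow> complex \<Rightarrow> 'a operator"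
  where "cayley_adj T z = adjoint_from (ran_space T z) (cayley T z)"

text \<open>\<open>(I - V V\<^sup>*)\<^sup>1\<^sup>/\<^sup>2\<close> for the Cayley transform \<open>V\<close>.\<close>
definition defect_op :: "'a::complex_inner operator \<Rightarrow> complex \<Rightarrow> 'a \<Rightarrow> 'a"
  where "defect_op T z = sqrt_op (\<lambda>f. f - app (cayley T z) (app (cayley_adj T z) f))"

text \<open>The extension of \<open>T\<close> to the direct sum of \<open>dom T\<close> and the defect space that multiplies the
  latter by \<open>z\<close>; the decomposition \<open>f\<^sub>T + \<phi>\<close> is unique for closed dissipative \<open>T\<close>
  with dense domain.\<close>
definition T_tilde :: "'a::complex_inner operator \<Rightarrow> complex \<Rightarrow> 'a operator"
  where "T_tilde T z = (\<lambda>f.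
    if \<exists>f\<^sub>T\<in>dom T. \<exists>\<phi>\<in>defect_space T z. f = f\<^sub>T + \<phi>
    then Some (THE g. \<exists>f\<^sub>T\<in>dom T. \<exists>\<phi>\<in>defect_space T z.
      f = f\<^sub>T + \<phi> \<and> g = app T f\<^sub>T + z *\<^sub>C \<phi>)
    else None)"

definition G_space :: "('a::complex_inner \<Rightarrow> 'a) \<Rightarrow> 'a operator \<Rightarrow> complex \<Rightarrow> 'a set"
  where "G_space C T z =
    {g. \<exists>h\<in>C ` ran_space T z. inv_op (shift_op (adj (T_tilde T z)) z) h = Some g}"


section \<open>The conditions at a point of the upper half-plane\<close>

definition cond_iii :: "('a::complex_inner \<Rightarrow> 'a) \<Rightarrow> 'a operator \<Rightarrow> complex \<Rightarrow> bool"
  where "cond_iii C T z \<longleftrightarrow> range (defect_op T z) \<inter> C ` defect_space T z = {0}"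

definition cond_iv :: "('a::complex_inner \<Rightarrow> 'a) \<Rightarrow> 'a operator \<Rightarrow> complex \<Rightarrow> bool"
  where "cond_iv C T z \<longleftrightarrow> (\<forall>\<phi>\<in>defect_space T z - {0}.
    (INF h\<in>ran_space T z. (norm (defect_op T z (C \<phi>) - defect_op T z (C h)))\<^sup>2) = 0)"

text \<open>Quotients in the suprema are taken in \<^typ>\<open>ennreal\<close>, whose division has \<open>0 / 0 = 0\<close> and
  \<open>a / 0 = \<infinity>\<close> for \<open>a > 0\<close>.\<close>

lemma "(0::ennreal) / 0 = 0" and "0 < a \<Longrightarrow> (a::ennreal) / 0 = \<infinity>"
  by (simp_all add: ennreal_divide_zero)

definition cond_v :: "('a::complex_inner \<Rightarrow> 'a) \<Rightarrow> 'a operator \<Rightarrow> complex \<Rightarrow> bool"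
  where "cond_v C T z \<longleftrightarrow> (\<forall>\<phi>\<in>defect_space T z - {0}.
    (SUP f. ennreal ((cmod (cinner (C f) \<phi>))\<^sup>2) / ennreal ((norm (defect_op T z f))\<^sup>2)) = \<infinity>)"

definition cond_vi :: "('a::complex_inner \<Rightarrow> 'a) \<Rightarrow> 'a operator \<Rightarrow> complex \<Rightarrow> bool"
  where "cond_vi C T z \<longleftrightarrow> (let A = adj (T_tilde T z) in \<forall>f\<in>dom A - {0}.
    (INF \<psi>\<in>G_space C T z. Im (cinner (- app A (f - \<psi>)) (f - \<psi>))) = 0)"

definition cond_vii :: "('a::complex_inner \<Rightarrow> 'a) \<Rightarrow> 'a operator \<Rightarrow> complex \<Rightarrow> bool"
  where "cond_vii C T z \<longleftrightarrow> (let A = adj (T_tilde T z) in \<forall>\<phi>\<in>defect_space T z - {0}.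
    (SUP g\<in>dom A. ennreal ((cmod (cinner (C (app (shift_op A z) g)) \<phi>))\<^sup>2)
                    / ennreal (- Im (cinner (app A g) g))) = \<infinity>)"

definition all_equivalent :: "bool list \<Rightarrow> bool"
  where "all_equivalent ps \<longleftrightarrow> (\<forall>p\<in>set ps. \<forall>q\<in>set ps. p \<longleftrightarrow> q)"

end

theory Submission
  imports Defs
begin

text \<open>Fix \<open>z\<close> in the upper half-plane and write \<open>M\<close> for the range of \<open>T - cnj z\<close>, \<open>N\<close> for its
  orthogonal complement and \<open>V\<close> for the Cayley transform of \<open>T\<close>, continued by \<open>0\<close> to \<open>N\<close>. The
  Cayley transform turns maximal dissipative extensions of \<open>T\<close> into contractions \<open>W\<close> of the whole
  space that extend \<open>V\<close> (\<open>max_dissipative_inv_cayley\<close>, \<open>inv_cayley_max_dissipative\<close>). Adjoints and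
  conjugation are respected: \<open>C (adj B) C\<close> has the Cayley transform \<open>C W\<^sup>* C\<close>, the transpose of \<open>W\<close>
  for the bilinear form \<open>(x, C y)\<close>. Hence the extensions in (ii) correspond to those \<open>W\<close> for which
  both \<open>W\<close> and its transpose extend \<open>V\<close>, here called completions of \<open>V\<close>, and the extensions in (i)
  to the completions that equal their transpose.

  The completion problem is governed by \<open>D = (I - V V\<^sup>*)\<^sup>1\<^sup>/\<^sup>2\<close>. An extension \<open>W\<close> of \<open>V\<close> is
  contractive if and only if its restriction to \<open>N\<close> is \<open>D K\<close> with a contraction \<open>K\<close>, and the
  transpose condition prescribes the component of \<open>K\<close> in the closure of \<open>D (C M)\<close>. The component
  in the orthogonal complement is free, and \<open>y\<close> is orthogonal to \<open>D (C M)\<close> if and only if \<open>D y\<close>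
  lies in \<open>C N\<close>. So two completions differ on \<open>N\<close> by a map into the intersection of \<open>ran D\<close> and
  \<open>C N\<close>, which vanishes under (iii) (\<open>completion_unique\<close>). Putting \<open>0\<close> in the free component
  yields a completion (\<open>minimal_completion\<close>), and averaging it with its transpose a symmetric one.
  If on the other hand \<open>D y = C \<phi>\<close> is nonzero with \<open>\<phi>\<close> in \<open>N\<close>, then the defect of the averaged
  completion still dominates the direction \<open>C \<phi>\<close>, and adding a small multiple of
  \<open>(\<cdot>, \<phi>) C \<phi>\<close>, which is symmetric and vanishes on \<open>M\<close>, gives a second symmetric completion
  (\<open>rank_one_perturbation\<close>, \<open>two_symmetric_completions\<close>). Therefore (i), (ii) and (iii) are
  equivalent.

  The other conditions rephrase (iii). Condition (iv) says that \<open>D (C M)\<close> is dense in \<open>ran D\<close>;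
  condition (v) says, by the Riesz theorem, that \<open>C \<phi>\<close> is not in \<open>ran D\<close>. The operator
  \<open>T_tilde T z\<close> belongs to the contraction \<open>V\<close> itself (\<open>T_tilde_eq\<close>), so its
  adjoint \<open>A\<close> is parametrised by \<open>g = u - V\<^sup>* u\<close> with \<open>(A - z) g = - (z - cnj z) u\<close> and
  \<open>- Im (A g, g) = Im z \<parallel>D u\<parallel>\<^sup>2\<close>; this substitution turns (vi) and (vii) into (iv) and (v).

  Existence and uniqueness of \<open>D\<close> come from the binomial series of the square root, and all
  projections, adjoints and factorisations from a single representation lemma
  (\<open>Riesz_through_map\<close>).\<close>

section \<open>Complex inner products\<close>

instance complex_hilbert_space \<subseteq> banach ..

lemma scaleC_minus1: "(-1) *\<^sub>C x = - (x::'a::complex_vector)"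
  using scaleR_scaleC[of "-1" x] by simp

lemma scaleC_zero_left [simp]: "0 *\<^sub>C x = (0::'a::complex_vector)"
  using scaleR_scaleC[of 0 x] by simp

lemma scaleC_zero_right [simp]: "c *\<^sub>C 0 = (0::'a::complex_vector)"
  using scaleC_add_right[of c 0 0] by simp

lemma scaleC_minus_right [simp]: "c *\<^sub>C (- x) = - (c *\<^sub>C (x::'a::complex_vector))"
  using scaleC_add_right[of c x "- x"] by (simp add: eq_neg_iff_add_eq_0 add.commute)

lemma scaleC_minus_left [simp]: "(- c) *\<^sub>C x = - (c *\<^sub>C (x::'a::complex_vector))"
  using scaleC_add_left[of c "- c" x] by (simp add: eq_neg_iff_add_eq_0 add.commute)

lemma scaleC_diff_right: "c *\<^sub>C (x - y) = c *\<^sub>C x - c *\<^sub>C (y::'a::complex_vector)"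
  by (simp only: diff_conv_add_uminus scaleC_add_right scaleC_minus_right)

lemma scaleC_diff_left: "(c - d) *\<^sub>C x = c *\<^sub>C x - d *\<^sub>C (x::'a::complex_vector)"
  by (simp only: diff_conv_add_uminus scaleC_add_left scaleC_minus_left)

lemma scaleC_scaleR: "c *\<^sub>C (r *\<^sub>R x) = r *\<^sub>R (c *\<^sub>C (x::'a::complex_vector))"
  by (simp add: scaleR_scaleC scaleC_scaleC mult.commute)

lemmas scaleC_simps = scaleC_add_right scaleC_add_left scaleC_diff_right scaleC_diff_left
  scaleC_scaleC scaleC_one

lemma cinner_minus_left [simp]: "cinner (- x) y = - cinner (x::'a::complex_inner) y"
  using cinner_scaleC_left[of "-1" x y] by (simp add: scaleC_one)

lemma cinner_diff_left: "cinner (x - y) z = cinner (x::'a::complex_inner) z - cinner y z"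
  using cinner_add_left[of x "- y" z] by simp

lemma cinner_add_right: "cinner x (y + z) = cinner (x::'a::complex_inner) y + cinner x z"
  by (metis cinner_add_left cinner_commute complex_cnj_add)

lemma cinner_minus_right [simp]: "cinner x (- y) = - cinner (x::'a::complex_inner) y"
  by (metis cinner_minus_left cinner_commute complex_cnj_minus)

lemma cinner_diff_right: "cinner x (y - z) = cinner (x::'a::complex_inner) y - cinner x z"
  using cinner_add_right[of x y "- z"] by simp

lemma cinner_scaleC_right [simp]: "cinner x (c *\<^sub>C y) = cnj c * cinner (x::'a::complex_inner) y"
  by (metis cinner_commute cinner_scaleC_left complex_cnj_mult)

declare cinner_scaleC_left [simp]

lemma cinner_scaleR_left [simp]: "cinner (r *\<^sub>R x) y = of_real r * cinner (x::'a::complex_inner) y"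
  by (simp add: scaleR_scaleC)

lemma cinner_scaleR_right [simp]: "cinner x (r *\<^sub>R y) = of_real r * cinner (x::'a::complex_inner) y"
  by (simp add: scaleR_scaleC)

lemma cinner_zero_left [simp]: "cinner 0 y = 0"
  using cinner_diff_left[of 0 0 y] by simp

lemma cinner_zero_right [simp]: "cinner y 0 = 0"
  using cinner_diff_right[of y 0 0] by simp

lemmas cinner_simps = cinner_add_left cinner_add_right cinner_diff_left cinner_diff_right

lemma cinner_eq_zero_commute: "cinner x y = 0 \<longleftrightarrow> cinner y x = 0"
  by (metis cinner_commute complex_cnj_zero_iff)

lemma cinner_self: "cinner x x = of_real ((norm (x::'a::complex_inner))\<^sup>2)"
proof -
  have "Im (cinner x x) = 0"
    using arg_cong[OF cinner_commute[of x x], of Im] by simp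
  moreover have "Re (cinner x x) = (norm x)\<^sup>2"
    by (simp add: inner_eq_Re_cinner[symmetric] power2_norm_eq_inner)
  ultimately show ?thesis by (simp add: complex_eq_iff)
qed

lemma cinner_self_eq_zero [simp]: "cinner x x = 0 \<longleftrightarrow> x = (0::'a::complex_inner)"
  by (simp add: cinner_self)

lemma cmod_cinner_commute: "cmod (cinner x y) = cmod (cinner y (x::'a::complex_inner))"
  by (metis cinner_commute complex_mod_cnj)

lemma norm_scaleC [simp]: "norm (c *\<^sub>C x) = cmod c * norm (x::'a::complex_inner)"
proof -
  have "of_real ((norm (c *\<^sub>C x))\<^sup>2) = c * cnj c * of_real ((norm x)\<^sup>2)"
    unfolding cinner_self[symmetric] by (simp add: mult.assoc)
  also have "\<dots> = of_real ((cmod c * norm x)\<^sup>2)"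
    unfolding complex_norm_square[symmetric] by (simp add: power_mult_distrib)
  finally have "of_real ((norm (c *\<^sub>C x))\<^sup>2) = (of_real ((cmod c * norm x)\<^sup>2) :: complex)" .
  then have "(norm (c *\<^sub>C x))\<^sup>2 = (cmod c * norm x)\<^sup>2"
    by (simp only: of_real_eq_iff)
  then show ?thesis by (simp add: power2_eq_iff_nonneg)
qed

text \<open>Rotating \<open>x\<close> by a unimodular factor makes \<open>cinner x y\<close> real without changing norms; this
  lifts real estimates to complex ones.\<close>

lemma cmod_cinner_eq_inner_rotated:
  obtains c where "cmod c = 1" and "cmod (cinner x y) = inner (c *\<^sub>C x) (y::'a::complex_inner)"
proof (cases "cinner x y = 0")
  case True
  show ?thesis by (rule that[of 1]) (simp_all add: True inner_eq_Re_cinner scaleC_one)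
next
  case False
  show ?thesis
  proof (rule that[of "cnj (cinner x y) / of_real (cmod (cinner x y))"])
    show "cmod (cnj (cinner x y) / of_real (cmod (cinner x y))) = 1"
      using False by (simp add: norm_divide)
    have "cnj (cinner x y) / of_real (cmod (cinner x y)) * cinner x y
        = of_real (cmod (cinner x y))"
      using False complex_norm_square[of "cinner x y"]
      by (simp add: field_simps power2_eq_square)
    then show "cmod (cinner x y)
        = inner ((cnj (cinner x y) / of_real (cmod (cinner x y))) *\<^sub>C x) y"
      by (simp add: inner_eq_Re_cinner del: times_divide_eq_left)
  qed
qed

lemma cinner_Cauchy_Schwarz: "cmod (cinner x y) \<le> norm x * norm (y::'a::complex_inner)"
proof -
  obtain c where c: "cmod c = 1" "cmod (cinner x y) = inner (c *\<^sub>C x) y"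
    by (rule cmod_cinner_eq_inner_rotated)
  have "inner (c *\<^sub>C x) y \<le> norm (c *\<^sub>C x) * norm y"
    by (rule norm_cauchy_schwarz)
  with c show ?thesis by simp
qed

text \<open>The imaginary part of the complex product is again a real product, which reduces its
  continuity to that of \<open>inner\<close>.\<close>

lemma cinner_eq_Complex_inner: "cinner x y = Complex (inner x y) (inner x (\<i> *\<^sub>C y))"
  by (simp add: complex_eq_iff inner_eq_Re_cinner)

lemma continuous_on_cinner_left: "continuous_on A (\<lambda>x. cinner x (y::'a::complex_inner))"
  unfolding cinner_eq_Complex_inner Complex_eq by (intro continuous_intros)

lemma norm_add_squared: "(norm (x + y))\<^sup>2 = (norm x)\<^sup>2 + (norm y)\<^sup>2 + 2 * Re (cinner x (y::'a::complex_inner))"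
  by (simp add: power2_norm_eq_inner inner_add inner_commute inner_eq_Re_cinner[symmetric])

lemma norm_add_squared_orthogonal:
  assumes "cinner x (y::'a::complex_inner) = 0"
  shows "(norm (x + y))\<^sup>2 = (norm x)\<^sup>2 + (norm y)\<^sup>2"
  using assms by (simp add: norm_add_squared)

lemma norm_diff_squared: "(norm (x - y))\<^sup>2 = (norm x)\<^sup>2 + (norm y)\<^sup>2 - 2 * Re (cinner x (y::'a::complex_inner))"
  using norm_add_squared[of x "- y"] by simp

lemma eq_zero_if_cinner_zero: "(\<And>x. cinner x y = 0) \<Longrightarrow> y = (0::'a::complex_inner)"
  using cinner_self_eq_zero by blast

lemma eqI_cinner_right: "(\<And>x. cinner x y = cinner x y') \<Longrightarrow> y = (y'::'a::complex_inner)"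
  using eq_zero_if_cinner_zero[of "y - y'"] by (simp add: cinner_simps)

lemma eqI_cinner_left: "(\<And>x. cinner y x = cinner y' x) \<Longrightarrow> y = (y'::'a::complex_inner)"
  by (rule eqI_cinner_right) (metis cinner_commute)

lemma norm_le_if_cinner_le:
  assumes "cmod (cinner y y) \<le> c * norm (y::'a::complex_inner)" and "0 \<le> c"
  shows "norm y \<le> c"
proof (cases "y = 0")
  case False
  have "norm y * norm y \<le> c * norm y"
    using assms(1) by (simp add: cinner_self power2_eq_square norm_mult)
  with False show ?thesis by simp
qed (use assms in simp)


section \<open>Subspaces and the Riesz representation\<close>

lemma csubspace_UNIV: "csubspace UNIV"
  by (simp add: csubspace_def)

lemma csubspace_diff: "csubspace U \<Longrightarrow> x \<in> U \<Longrightarrow> y \<in> U \<Longrightarrow> x - y \<in> U"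
  unfolding csubspace_def
  by (metis diff_conv_add_uminus scaleC_minus1)

lemma csubspace_add: "csubspace U \<Longrightarrow> x \<in> U \<Longrightarrow> y \<in> U \<Longrightarrow> x + y \<in> U"
  and csubspace_scaleC: "csubspace U \<Longrightarrow> x \<in> U \<Longrightarrow> c *\<^sub>C x \<in> U"
  and csubspace_0: "csubspace U \<Longrightarrow> 0 \<in> U"
  by (simp_all add: csubspace_def)

lemma csubspace_scaleR: "csubspace U \<Longrightarrow> x \<in> U \<Longrightarrow> r *\<^sub>R x \<in> U"
  by (simp add: scaleR_scaleC csubspace_scaleC)

lemma csubspace_ortho_compl: "csubspace (ortho_compl U)"
  by (auto simp: csubspace_def ortho_compl_def cinner_simps)

definition clinear_on :: "'a::complex_vector set \<Rightarrow> ('a \<Rightarrow> 'b::complex_vector) \<Rightarrow> bool"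
  where "clinear_on S L \<longleftrightarrow>
    (\<forall>x\<in>S. \<forall>y\<in>S. L (x + y) = L x + L y) \<and> (\<forall>c. \<forall>x\<in>S. L (c *\<^sub>C x) = c *\<^sub>C L x)"

lemma clinear_on_add: "clinear_on S L \<Longrightarrow> x \<in> S \<Longrightarrow> y \<in> S \<Longrightarrow> L (x + y) = L x + L y"
  and clinear_on_scaleC: "clinear_on S L \<Longrightarrow> x \<in> S \<Longrightarrow> L (c *\<^sub>C x) = c *\<^sub>C L x"
  by (simp_all add: clinear_on_def)

lemma clinear_on_scaleR: "clinear_on S L \<Longrightarrow> x \<in> S \<Longrightarrow> L (r *\<^sub>R x) = r *\<^sub>R L x"
  by (simp add: scaleR_scaleC clinear_on_scaleC)

lemma clinear_on_diff:
  assumes "clinear_on S L" "csubspace S" "x \<in> S" "y \<in> S"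
  shows "L (x - y) = L x - L y"
proof -
  have "(- 1) *\<^sub>C y \<in> S" using assms by (simp only: csubspace_scaleC)
  then have "L (x + (- 1) *\<^sub>C y) = L x + (- 1) *\<^sub>C L y"
    using assms by (simp only: clinear_on_add clinear_on_scaleC)
  then show ?thesis by (simp add: scaleC_one)
qed

lemma clinear_on_0: "clinear_on S L \<Longrightarrow> csubspace S \<Longrightarrow> L 0 = 0"
  using clinear_on_diff[of S L 0 0] csubspace_0[of S] by simp

lemma csubspace_image:
  assumes L: "clinear_on S L" and S: "csubspace S"
  shows "csubspace (L ` S)"
  unfolding csubspace_def
proof (intro conjI ballI allI)
  show "0 \<in> L ` S" using clinear_on_0[OF assms] csubspace_0[OF S] by (metis imageI)
next
  fix x y assume "x \<in> L ` S" "y \<in> L ` S"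
  then show "x + y \<in> L ` S"
    using clinear_on_add[OF L] csubspace_add[OF S] by (auto simp: image_iff) metis
next
  fix c x assume "x \<in> L ` S"
  then show "c *\<^sub>C x \<in> L ` S"
    using clinear_on_scaleC[OF L] csubspace_scaleC[OF S] by (auto simp: image_iff) metis
qed

lemma cinner_closure_eq_zero:
  assumes "\<And>x. x \<in> S \<Longrightarrow> cinner x y = 0" and "v \<in> closure S"
  shows "cinner v (y::'a::complex_inner) = 0"
proof -
  have "closed {x. cinner x y = 0}"
    by (intro closed_Collect_eq continuous_on_cinner_left continuous_intros)
  moreover have "S \<subseteq> {x. cinner x y = 0}" using assms(1) by blast
  ultimately show ?thesis using assms(2) closure_minimal by blast
qed

lemma closure_diff:
  fixes S :: "'a::real_normed_vector set"
  assumes "x \<in> closure S" "y \<in> closure S" "\<And>u v. u \<in> S \<Longrightarrow> v \<in> S \<Longrightarrow> u - v \<in> S"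
  shows "x - y \<in> closure S"
proof -
  obtain f g where "\<And>n. f n \<in> S" "f \<longlonglongrightarrow> x" "\<And>n. g n \<in> S" "g \<longlonglongrightarrow> y"
    using assms(1,2) unfolding closure_sequential by blast
  then show ?thesis
    unfolding closure_sequential
    by (intro exI[of _ "\<lambda>n. f n - g n"]) (auto intro: assms(3) tendsto_diff)
qed

text \<open>The representing vector is the limit of \<open>L\<close> along a minimising sequence of
  \<open>\<parallel>L x\<parallel>\<^sup>2 - 2 g x\<close>: the parallelogram law makes that image sequence Cauchy, and the
  first variation at the infimum vanishes. Since \<open>L\<close> need be neither injective nor of closed range,
  the lemma covers the Riesz theorem, orthogonal projections, adjoints and the
  range inclusion theorem of Douglas at once.\<close>

lemma Riesz_through_map_real:
  fixes L :: "'b::real_vector \<Rightarrow> 'a::{real_inner,complete_space}" and g :: "'b \<Rightarrow> real"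
  assumes add: "\<And>x y. x \<in> S \<Longrightarrow> y \<in> S \<Longrightarrow> x + y \<in> S \<and> L (x + y) = L x + L y \<and> g (x + y) = g x + g y"
    and scale: "\<And>r x. x \<in> S \<Longrightarrow> r *\<^sub>R x \<in> S \<and> L (r *\<^sub>R x) = r *\<^sub>R L x \<and> g (r *\<^sub>R x) = r * g x"
    and "S \<noteq> {}"
    and bound: "\<And>x. x \<in> S \<Longrightarrow> \<bar>g x\<bar> \<le> c * norm (L x)"
  obtains y where "y \<in> closure (L ` S)" and "\<And>x. x \<in> S \<Longrightarrow> g x = inner (L x) y"
proof -
  define J where "J x = (norm (L x))\<^sup>2 - 2 * g x" for x
  define m where "m = Inf (J ` S)"
  have "- c\<^sup>2 \<le> J x" if "x \<in> S" for x
  proof -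
    have "g x \<le> c * norm (L x)" using bound[OF that] by linarith
    moreover have "0 \<le> (norm (L x) - c)\<^sup>2" by simp
    ultimately show ?thesis unfolding J_def by (simp add: power2_diff algebra_simps)
  qed
  then have bdd: "bdd_below (J ` S)" by (intro bdd_belowI2)
  have m_le: "m \<le> J x" if "x \<in> S" for x
    unfolding m_def using that bdd by (intro cINF_lower)
  define \<delta> :: "nat \<Rightarrow> real" where "\<delta> n = inverse (real (Suc n))" for n
  have ex: "\<exists>x\<in>S. J x < m + \<delta> n" for n
  proof -
    have "Inf (J ` S) < m + \<delta> n" by (simp add: m_def \<delta>_def)
    then show ?thesis using cINF_less_iff[OF \<open>S \<noteq> {}\<close> bdd] by blast
  qed
  define \<xi> where "\<xi> n = (SOME x. x \<in> S \<and> J x < m + \<delta> n)" for n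
  have \<xi>: "\<xi> n \<in> S" "J (\<xi> n) < m + \<delta> n" for n
    using someI_ex[of "\<lambda>x. x \<in> S \<and> J x < m + \<delta> n"] ex[of n]
    unfolding \<xi>_def by blast+
  have par: "(norm (L a - L b))\<^sup>2 \<le> 2 * (J a - m) + 2 * (J b - m)" if "a \<in> S" "b \<in> S" for a b
  proof -
    have mid: "(1/2) *\<^sub>R (a + b) \<in> S" "L ((1/2) *\<^sub>R (a + b)) = (1/2) *\<^sub>R (L a + L b)"
      "g ((1/2) *\<^sub>R (a + b)) = (g a + g b) / 2"
      using add[OF that] scale[of "a + b" "1/2"] by auto
    have "(norm (L a - L b))\<^sup>2 + (norm (L a + L b))\<^sup>2 = 2 * (norm (L a))\<^sup>2 + 2 * (norm (L b))\<^sup>2"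
      by (simp add: power2_norm_eq_inner inner_add inner_diff inner_commute)
    moreover have "(norm ((1/2) *\<^sub>R (L a + L b)))\<^sup>2 = (norm (L a + L b))\<^sup>2 / 4"
      unfolding norm_scaleR by (simp add: power_mult_distrib power2_eq_square)
    then have "4 * m \<le> (norm (L a + L b))\<^sup>2 - 4 * (g a + g b)"
      using m_le[OF mid(1)] unfolding J_def mid by (simp add: field_simps)
    ultimately show ?thesis unfolding J_def by (simp add: algebra_simps)
  qed
  have "Cauchy (\<lambda>n. L (\<xi> n))"
  proof (rule metric_CauchyI)
    fix e :: real assume "0 < e"
    then obtain N where N: "\<delta> N < e\<^sup>2 / 4"
      using reals_Archimedean[of "e\<^sup>2 / 4"] unfolding \<delta>_def by auto
    show "\<exists>M. \<forall>m\<ge>M. \<forall>n\<ge>M. dist (L (\<xi> m)) (L (\<xi> n)) < e"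
    proof (intro exI allI impI)
      fix i j assume "N \<le> i" "N \<le> j"
      then have "\<delta> i \<le> \<delta> N"
        "\<delta> j \<le> \<delta> N" by (simp_all add: \<delta>_def le_imp_inverse_le)
      with N have "\<delta> i < e\<^sup>2 / 4" "\<delta> j < e\<^sup>2 / 4" by simp_all
      then have "J (\<xi> i) < m + e\<^sup>2 / 4" "J (\<xi> j) < m + e\<^sup>2 / 4"
        using \<xi>(2)[of i] \<xi>(2)[of j] by simp_all
      then have "2 * (J (\<xi> i) - m) + 2 * (J (\<xi> j) - m) < e\<^sup>2" by argo
      with par[OF \<xi>(1) \<xi>(1)] have "(norm (L (\<xi> i) - L (\<xi> j)))\<^sup>2 < e\<^sup>2"
        by (rule le_less_trans)
      then show "dist (L (\<xi> i)) (L (\<xi> j)) < e"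
        using \<open>0 < e\<close> by (simp add: dist_norm power2_less_imp_less)
    qed
  qed
  then obtain y where y: "(\<lambda>n. L (\<xi> n)) \<longlonglongrightarrow> y" using Cauchy_convergent convergent_def by blast
  have variation: "0 \<le> 2 * t * (inner y (L x) - g x) + t\<^sup>2 * (norm (L x))\<^sup>2" if "x \<in> S" for x t
  proof (rule LIMSEQ_le[of "\<lambda>n. - \<delta> n"])
    show "(\<lambda>n. - \<delta> n) \<longlonglongrightarrow> 0"
      using tendsto_minus[OF LIMSEQ_inverse_real_of_nat] by (simp add: \<delta>_def)
    show "(\<lambda>n. 2 * t * (inner (L (\<xi> n)) (L x) - g x) + t\<^sup>2 * (norm (L x))\<^sup>2)
        \<longlonglongrightarrow> 2 * t * (inner y (L x) - g x) + t\<^sup>2 * (norm (L x))\<^sup>2"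
      by (intro tendsto_intros y)
    have "- \<delta> n \<le> 2 * t * (inner (L (\<xi> n)) (L x) - g x) + t\<^sup>2 * (norm (L x))\<^sup>2" for n
    proof -
      have "J (\<xi> n + t *\<^sub>R x) = J (\<xi> n) + 2 * t * (inner (L (\<xi> n)) (L x) - g x) + t\<^sup>2 * (norm (L x))\<^sup>2"
      proof -
        have "(norm (u + t *\<^sub>R v))\<^sup>2 = (norm u)\<^sup>2 + 2 * t * inner u v + t\<^sup>2 * (norm v)\<^sup>2" for u v :: 'a
          unfolding power2_norm_eq_inner
          by (simp add: inner_add inner_commute algebra_simps power2_eq_square)
        then show ?thesis
          using add[OF \<xi>(1)[of n], of "t *\<^sub>R x"] scale[OF that, of t] unfolding J_def
          by (simp add: algebra_simps)
      qed
      moreover have "m \<le> J (\<xi> n + t *\<^sub>R x)"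
        using add[OF \<xi>(1)[of n], of "t *\<^sub>R x"] scale[OF that, of t] m_le by blast
      ultimately show ?thesis using \<xi>(2)[of n] by linarith
    qed
    then show "\<exists>N. \<forall>n\<ge>N. - \<delta> n
        \<le> 2 * t * (inner (L (\<xi> n)) (L x) - g x) + t\<^sup>2 * (norm (L x))\<^sup>2" by blast
  qed
  show ?thesis
  proof (rule that)
    show "y \<in> closure (L ` S)"
      unfolding closure_sequential using y \<xi>(1) by (intro exI[of _ "\<lambda>n. L (\<xi> n)"]) auto
    fix x assume x: "x \<in> S"
    define d where "d = inner y (L x) - g x"
    define q where "q = (norm (L x))\<^sup>2 + 1"
    \<comment> \<open>The quadratic in \<open>t\<close> is tested near its minimum \<open>- d / \<parallel>L x\<parallel>\<^sup>2\<close>, with \<open>1\<close> added to the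
      denominator to cover \<open>L x = 0\<close>.\<close>
    have "0 \<le> 2 * (- d / q) * d + (- d / q)\<^sup>2 * q"
      using variation[OF x, of "- d / q"] unfolding d_def[symmetric] q_def
      by (simp add: distrib_left) (smt (verit) zero_le_power2)
    also have "0 < q" unfolding q_def by (simp add: add_nonneg_pos)
    then have "2 * (- d / q) * d + (- d / q)\<^sup>2 * q = - (d\<^sup>2 / q)"
      by (simp add: power2_eq_square field_simps)
    finally have "d\<^sup>2 \<le> 0" using \<open>0 < q\<close> by (simp add: divide_le_0_iff)
    then show "g x = inner (L x) y" by (simp add: d_def inner_commute)
  qed
qed

lemma Riesz_through_map:
  fixes L :: "'b::complex_vector \<Rightarrow> 'a::complex_hilbert_space" and g :: "'b \<Rightarrow> complex"
  assumes S: "csubspace S" and L: "clinear_on S L" and g: "clinear_on S g"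
    and bound: "\<And>x. x \<in> S \<Longrightarrow> cmod (g x) \<le> c * norm (L x)"
  obtains y where "y \<in> closure (L ` S)" and "\<And>x. x \<in> S \<Longrightarrow> g x = cinner (L x) y"
proof -
  obtain y where y: "y \<in> closure (L ` S)" "\<And>x. x \<in> S \<Longrightarrow> Re (g x) = inner (L x) y"
  proof (rule Riesz_through_map_real[of S L "\<lambda>x. Re (g x)" c])
    show "x + y \<in> S \<and> L (x + y) = L x + L y \<and> Re (g (x + y)) = Re (g x) + Re (g y)"
      if "x \<in> S" "y \<in> S" for x y
      using that S L g by (simp add: csubspace_add clinear_on_add)
    show "r *\<^sub>R x \<in> S \<and> L (r *\<^sub>R x) = r *\<^sub>R L x \<and> Re (g (r *\<^sub>R x)) = r * Re (g x)"
      if "x \<in> S" for r x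
      using that S L g by (simp add: csubspace_scaleR clinear_on_scaleR)
    show "S \<noteq> {}" using csubspace_0[OF S] by blast
    show "\<bar>Re (g x)\<bar> \<le> c * norm (L x)" if "x \<in> S" for x
      using bound[OF that] abs_Re_le_cmod[of "g x"] by linarith
  qed auto
  have "g x = cinner (L x) y" if x: "x \<in> S" for x
  proof (rule complex_eqI)
    show "Re (g x) = Re (cinner (L x) y)" using y(2)[OF x] by (simp add: inner_eq_Re_cinner)
    have "Re (g (\<i> *\<^sub>C x)) = inner (L (\<i> *\<^sub>C x)) y"
      by (rule y(2)[OF csubspace_scaleC[OF S x]])
    then show "Im (g x) = Im (cinner (L x) y)"
      using x L g by (simp add: clinear_on_scaleC inner_eq_Re_cinner scaleC_complex_def)
  qed
  with y(1) show ?thesis by (rule that)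
qed

text \<open>The difference of two representing vectors from the closure of the range is orthogonal to that
  closure, hence to itself.\<close>

lemma Riesz_unique:
  assumes S: "csubspace S" and L: "clinear_on S L"
    and "y \<in> closure (L ` S)" "y' \<in> closure (L ` S)"
    and eq: "\<And>x. x \<in> S \<Longrightarrow> cinner (L x) y = cinner (L x) (y'::'a::complex_inner)"
  shows "y = y'"
proof -
  have "y - y' \<in> closure (L ` S)"
    using assms(3,4) csubspace_diff[OF csubspace_image[OF L S]] by (rule closure_diff)
  moreover have "cinner v (y - y') = 0" if "v \<in> L ` S" for v
    using that eq by (auto simp: cinner_simps)
  ultimately have "cinner (y - y') (y - y') = 0" by (rule cinner_closure_eq_zero[rotated])
  then show ?thesis by simp
qed

lemma Riesz_norm_le:
  assumes "y \<in> closure (L ` S)" and "\<And>x. x \<in> S \<Longrightarrow> cmod (cinner (L x) y) \<le> c * norm (L x)"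
    and "0 \<le> c"
  shows "norm (y::'a::complex_inner) \<le> c"
proof (rule norm_le_if_cinner_le)
  have "closed {v. cmod (cinner v y) \<le> c * norm v}"
    by (intro closed_Collect_le continuous_intros continuous_on_cinner_left)
  moreover have "L ` S \<subseteq> {v. cmod (cinner v y) \<le> c * norm v}" using assms(2) by blast
  ultimately show "cmod (cinner y y) \<le> c * norm y" using assms(1) closure_minimal by blast
qed fact

lemma clinear_on_id: "clinear_on S (\<lambda>x. x)"
  by (simp add: clinear_on_def)

lemma orthogonal_projection:
  fixes S :: "'a::complex_hilbert_space set"
  assumes "csubspace S"
  obtains q where "q \<in> closure S" and "\<And>x. x \<in> S \<Longrightarrow> cinner x (p - q) = 0"
proof (rule Riesz_through_map[of S "\<lambda>x. x" "\<lambda>x. cinner x p" "norm p"])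
  show "clinear_on S (\<lambda>x. cinner x p)" by (simp add: clinear_on_def cinner_simps scaleC_complex_def)
  show "cmod (cinner x p) \<le> norm p * norm x" for x
    using cinner_Cauchy_Schwarz[of x p] by (simp add: mult.commute)
next
  fix y assume "y \<in> closure ((\<lambda>x. x) ` S)" "\<And>x. x \<in> S \<Longrightarrow> cinner x p = cinner x y"
  then show thesis by (intro that[of y]) (auto simp: cinner_simps)
qed (use assms clinear_on_id in auto)

text \<open>The closure is the double orthogonal complement.\<close>

lemma csubspace_closure:
  fixes S :: "'a::complex_hilbert_space set"
  assumes S: "csubspace S"
  shows "csubspace (closure S)"
proof -
  have "closure S = {x. \<forall>v\<in>ortho_compl S. cinner x v = 0}"
  proof (intro equalityI subsetI)
    fix x assume "x \<in> closure S"
    moreover have "cinner s v = 0" if "s \<in> S" "v \<in> ortho_compl S" for s v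
      using that cinner_eq_zero_commute[of v s] by (simp add: ortho_compl_def)
    ultimately show "x \<in> {x. \<forall>v\<in>ortho_compl S. cinner x v = 0}"
      using cinner_closure_eq_zero[of S _ x] by blast
  next
    fix x assume x: "x \<in> {x. \<forall>v\<in>ortho_compl S. cinner x v = 0}"
    obtain q where q: "q \<in> closure S" "\<And>s. s \<in> S \<Longrightarrow> cinner s (x - q) = 0"
      using orthogonal_projection[OF S] by blast
    have "cinner q (x - q) = 0" by (rule cinner_closure_eq_zero[OF q(2) q(1)])
    moreover have "x - q \<in> ortho_compl S"
      using q(2) cinner_eq_zero_commute[of "x - q"] by (simp add: ortho_compl_def)
    then have "cinner x (x - q) = 0" using x by blast
    ultimately have "cinner (x - q) (x - q) = 0" by (simp add: cinner_simps)
    then show "x \<in> closure S" using q(1) by simp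
  qed
  then show ?thesis by (auto simp: csubspace_def cinner_simps)
qed

section \<open>The square root of a positive operator\<close>

lemma bounded_linear_scaleC: "bounded_linear (\<lambda>x. c *\<^sub>C (x::'a::complex_inner))"
  by (rule bounded_linear_intro[of _ "cmod c"]) (simp_all add: scaleC_add_right scaleC_scaleR mult.commute)

text \<open>Over the complex numbers real diagonal values suffice, by polarisation with \<open>1\<close> and \<open>\<i>\<close>.\<close>

lemma bounded_positive_selfadjoint:
  assumes "bounded_positive R"
  shows "cinner (R x) y = cinner x (R y)"
proof -
  have add: "R (x + y) = R x + R y" and scale: "R (c *\<^sub>C x) = c *\<^sub>C R x"
    and im: "Im (cinner (R x) x) = 0" for c x y
    using assms unfolding bounded_positive_def by (auto simp: linear_simps)
  define s where "s x y = cinner (R x) y - cinner x (R y)" for x y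
  have diag: "s x x = 0" for x
    using im[of x] cinner_commute[of x "R x"] by (simp add: s_def complex_eq_iff)
  have anti: "s x y + s y x = 0" for x y
    using diag[of "x + y"] diag[of x] diag[of y] unfolding s_def
    by (simp add: add cinner_simps algebra_simps)
  have "s (\<i> *\<^sub>C x) y = \<i> * s x y" "s y (\<i> *\<^sub>C x) = - \<i> * s y x"
    by (simp_all add: s_def scale algebra_simps)
  with anti[of "\<i> *\<^sub>C x" y] have "\<i> * (s x y - s y x) = 0" by (simp add: algebra_simps)
  with anti[of x y] have "s x y = 0" by simp
  then show ?thesis by (simp add: s_def)
qed

text \<open>Otherwise moving from \<open>y\<close> a little in the direction \<open>- R y\<close> would make the quadratic form of
  \<open>R\<close> negative.\<close>

lemma bounded_positive_eq_zero:
  assumes R: "bounded_positive R" and zero: "cinner (R y) y = 0"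
  shows "R y = 0"
proof -
  define n where "n = (norm (R y))\<^sup>2"
  define b where "b = Re (cinner (R (R y)) (R y))"
  have b: "0 \<le> b" using R by (simp add: b_def bounded_positive_def)
  define t where "t = n / (b + 1)"
  have lin: "R (x - r *\<^sub>R z) = R x - r *\<^sub>R R z" for x z r
    using R by (simp add: bounded_positive_def linear_simps)
  have "0 \<le> Re (cinner (R (y - t *\<^sub>R R y)) (y - t *\<^sub>R R y))"
    using R by (simp add: bounded_positive_def)
  also have "\<dots> = t\<^sup>2 * b - 2 * t * n"
    using zero bounded_positive_selfadjoint[OF R, of "R y" y]
    by (simp add: lin cinner_simps cinner_self n_def b_def power2_eq_square algebra_simps)
  also have "\<dots> = - t\<^sup>2 - t * n"
  proof -
    have "t * b = n - t" using b by (simp add: t_def field_simps)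
    then have "t\<^sup>2 * b = t * (n - t)" by (simp add: power2_eq_square mult.assoc)
    then show ?thesis by (simp add: power2_eq_square algebra_simps)
  qed
  finally have "t\<^sup>2 + t * n \<le> 0" by simp
  moreover have "0 \<le> t * n" using b by (simp add: t_def n_def)
  ultimately have "t\<^sup>2 \<le> 0" by linarith
  then have "n = 0" using b by (simp add: t_def add_nonneg_eq_0_iff)
  then show ?thesis by (simp add: n_def)
qed

text \<open>The Taylor coefficients of \<open>(1 - x)\<^sup>1\<^sup>/\<^sup>2\<close>.\<close>
definition sqrt_coeff :: "nat \<Rightarrow> real"
  where "sqrt_coeff n = ((1/2) gchoose n) * (- 1) ^ n"

lemma sqrt_coeff_0 [simp]: "sqrt_coeff 0 = 1"
  by (simp add: sqrt_coeff_def)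

lemma sqrt_coeff_eq_pochhammer: "sqrt_coeff n = pochhammer (- 1/2) n / fact n"
  unfolding sqrt_coeff_def gbinomial_pochhammer by (simp flip: power_add)

lemma sqrt_coeff_Suc_nonpos: "sqrt_coeff (Suc n) \<le> 0"
  unfolding sqrt_coeff_eq_pochhammer pochhammer_rec
  by (simp add: pochhammer_nonneg divide_le_0_iff)

text \<open>The partial sums telescope to \<open>pochhammer (1/2) m / fact m\<close>; their nonnegativity yields both
  the absolute convergence at \<open>1\<close> and the positivity of the square root.\<close>

lemma sum_sqrt_coeff_nonneg: "0 \<le> (\<Sum>n\<le>m. sqrt_coeff n)"
proof -
  have "(\<Sum>n\<le>m. sqrt_coeff n) = (- 1) ^ m * ((1/2 - 1 :: real) gchoose m)"
    unfolding sqrt_coeff_def by (rule gbinomial_sum_lower_neg)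
  also have "\<dots> = pochhammer (1/2) m / fact m"
    unfolding gbinomial_pochhammer by (simp flip: power_add)
  finally show ?thesis by (simp add: pochhammer_nonneg)
qed

lemma summable_abs_sqrt_coeff: "summable (\<lambda>n. \<bar>sqrt_coeff n\<bar>)"
proof (rule bounded_imp_summable)
  fix m
  have "(\<Sum>n\<le>m. \<bar>sqrt_coeff n\<bar>) = 2 - (\<Sum>n\<le>m. sqrt_coeff n)"
    by (induction m) (simp_all add: abs_of_nonpos[OF sqrt_coeff_Suc_nonpos])
  then show "(\<Sum>n\<le>m. \<bar>sqrt_coeff n\<bar>) \<le> 2" using sum_sqrt_coeff_nonneg[of m] by simp
qed simp

text \<open>The Cauchy square of the binomial series with exponent \<open>1/2\<close> is the one with exponent \<open>1\<close>, by the
  Vandermonde identity.\<close>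

lemma sqrt_coeff_convolution:
  "(\<Sum>k\<le>n. sqrt_coeff k * sqrt_coeff (n - k)) = (if n = 0 then 1 else if n = 1 then - 1 else 0)"
proof -
  have "(\<Sum>k\<le>n. sqrt_coeff k * sqrt_coeff (n - k))
      = (\<Sum>k\<le>n. ((1/2) gchoose k) * ((1/2) gchoose (n - k)) * (- 1) ^ n)"
    by (rule sum.cong) (auto simp: sqrt_coeff_def simp flip: power_add)
  also have "\<dots> = ((1::real) gchoose n) * (- 1) ^ n"
    using gbinomial_Vandermonde[of "1/2::real" "1/2" n]
    by (simp add: atMost_atLeast0 flip: sum_distrib_right)
  also have "(1::real) gchoose n = of_nat (1 choose n)"
    by (metis binomial_gbinomial of_nat_1)
  finally show ?thesis by (cases n) (auto simp: binomial_eq_0)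
qed

definition sqrt_series :: "('a \<Rightarrow> 'a) \<Rightarrow> 'a \<Rightarrow> 'a::real_normed_vector"
  where "sqrt_series B x = (\<Sum>n. sqrt_coeff n *\<^sub>R (B ^^ n) x)"

locale positive_contraction =
  fixes B :: "'a::complex_hilbert_space \<Rightarrow> 'a"
  assumes positive: "bounded_positive B" and norm_le: "norm (B x) \<le> norm x"
begin

lemma norm_funpow_le: "norm ((B ^^ n) x) \<le> norm x"
  by (induction n) (auto intro: order_trans[OF norm_le])

lemma bounded_linear_funpow: "bounded_linear (B ^^ n)"
proof (induction n)
  case (Suc n)
  have "bounded_linear B" using positive by (simp add: bounded_positive_def)
  from bounded_linear_compose[OF this Suc] show ?case by (simp add: o_def)
qed (simp add: bounded_linear_ident id_def)

lemma summable_norm_terms: "summable (\<lambda>n. norm (sqrt_coeff n *\<^sub>R (B ^^ n) x))"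
proof (rule summable_comparison_test')
  show "summable (\<lambda>n. \<bar>sqrt_coeff n\<bar> * norm x)"
    by (intro summable_mult2 summable_abs_sqrt_coeff)
  show "norm (norm (sqrt_coeff n *\<^sub>R (B ^^ n) x)) \<le> \<bar>sqrt_coeff n\<bar> * norm x" for n
    using norm_funpow_le by (simp add: mult_left_mono)
qed

lemma summable_terms: "summable (\<lambda>n. sqrt_coeff n *\<^sub>R (B ^^ n) x)"
  using summable_norm_terms by (rule summable_norm_cancel)

lemma sqrt_series_commute:
  assumes S: "bounded_linear S" and comm: "\<And>x. S (B x) = B (S x)"
  shows "S (sqrt_series B x) = sqrt_series B (S x)"
proof -
  have "S ((B ^^ n) x) = (B ^^ n) (S x)" for n
    by (induction n) (auto simp: comm)
  then show ?thesis
    unfolding sqrt_series_def bounded_linear.suminf[OF S summable_terms]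
    using S by (simp add: linear_simps)
qed

lemma bounded_linear_sqrt_series: "bounded_linear (sqrt_series B)"
proof (rule bounded_linear_intro)
  show "sqrt_series B (x + y) = sqrt_series B x + sqrt_series B y" for x y
    unfolding sqrt_series_def suminf_add[OF summable_terms summable_terms]
    using bounded_linear_funpow by (simp add: linear_simps scaleR_add_right)
  show "sqrt_series B (r *\<^sub>R x) = r *\<^sub>R sqrt_series B x" for r x
  proof -
    have "(\<lambda>n. sqrt_coeff n *\<^sub>R (B ^^ n) (r *\<^sub>R x)) = (\<lambda>n. r *\<^sub>R sqrt_coeff n *\<^sub>R (B ^^ n) x)"
      using bounded_linear_funpow by (simp add: linear_simps mult.commute)
    then show ?thesis unfolding sqrt_series_def by (simp add: suminf_scaleR_right[OF summable_terms])
  qed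
  show "norm (sqrt_series B x) \<le> norm x * (\<Sum>n. \<bar>sqrt_coeff n\<bar>)" for x
  proof -
    have "norm (sqrt_series B x) \<le> (\<Sum>n. norm (sqrt_coeff n *\<^sub>R (B ^^ n) x))"
      unfolding sqrt_series_def by (rule summable_norm[OF summable_norm_terms])
    also have "\<dots> \<le> (\<Sum>n. norm x * \<bar>sqrt_coeff n\<bar>)"
      using norm_funpow_le[of _ x]
      by (intro suminf_le summable_norm_terms summable_mult summable_abs_sqrt_coeff)
         (simp add: mult.commute[of "norm x"] mult_left_mono)
    finally show ?thesis by (simp add: suminf_mult[OF summable_abs_sqrt_coeff])
  qed
qed

lemma sqrt_series_scaleC: "sqrt_series B (c *\<^sub>C x) = c *\<^sub>C sqrt_series B x"
  by (rule sqrt_series_commute[OF bounded_linear_scaleC, symmetric])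
     (use positive in \<open>simp add: bounded_positive_def\<close>)

lemma cinner_funpow_real: "Im (cinner ((B ^^ n) x) x) = 0"
proof -
  have "cinner ((B ^^ n) x) y = cinner x ((B ^^ n) y)" for y
    by (induction n arbitrary: x y)
       (simp_all add: bounded_positive_selfadjoint[OF positive] funpow_swap1)
  then have "cinner ((B ^^ n) x) x = cnj (cinner ((B ^^ n) x) x)"
    by (metis cinner_commute)
  then show ?thesis by (simp add: complex_eq_iff)
qed

lemma bounded_positive_sqrt_series: "bounded_positive (sqrt_series B)"
  unfolding bounded_positive_def
proof (intro conjI allI)
  fix x :: 'a
  have "bounded_linear (\<lambda>y. inner y x)" "bounded_linear (\<lambda>y. inner y (\<i> *\<^sub>C x))"
    by (rule bounded_linear_inner_left)+
  note sums = this[THEN bounded_linear.suminf, OF summable_terms[of x]]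
    this[THEN bounded_linear.summable, OF summable_terms[of x]]
  have "inner (sqrt_series B x) (\<i> *\<^sub>C x) = 0"
    unfolding sqrt_series_def sums using cinner_funpow_real[of _ x]
    by (simp add: inner_eq_Re_cinner)
  then show "Im (cinner (sqrt_series B x) x) = 0" by (simp add: inner_eq_Re_cinner)
  have part: "0 \<le> (\<Sum>n\<le>m. inner (sqrt_coeff n *\<^sub>R (B ^^ n) x) x)" for m
  proof -
    have "sqrt_coeff n * (norm x)\<^sup>2 \<le> inner (sqrt_coeff n *\<^sub>R (B ^^ n) x) x" for n
    proof (cases n)
      case (Suc k)
      have "inner ((B ^^ n) x) x \<le> norm ((B ^^ n) x) * norm x" by (rule norm_cauchy_schwarz)
      also have "\<dots> \<le> (norm x)\<^sup>2"
        using norm_funpow_le[of n x] by (simp add: power2_eq_square mult_right_mono)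
      finally show ?thesis
        using sqrt_coeff_Suc_nonpos[of k] by (simp add: Suc mult_left_mono_neg)
    qed (simp add: power2_norm_eq_inner)
    then have "(\<Sum>n\<le>m. sqrt_coeff n) * (norm x)\<^sup>2 \<le> (\<Sum>n\<le>m. inner (sqrt_coeff n *\<^sub>R (B ^^ n) x) x)"
      unfolding sum_distrib_right by (rule sum_mono)
    then show ?thesis
      using sum_sqrt_coeff_nonneg[of m] by (smt (verit) mult_nonneg_nonneg zero_le_power2)
  qed
  have "0 \<le> (\<Sum>n. inner (sqrt_coeff n *\<^sub>R (B ^^ n) x) x)"
    by (rule LIMSEQ_le_const[OF summable_LIMSEQ'[OF sums(3)]]) (use part in blast)
  then show "0 \<le> Re (cinner (sqrt_series B x) x)"
    unfolding inner_eq_Re_cinner[symmetric] sqrt_series_def sums .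
qed (use bounded_linear_sqrt_series sqrt_series_scaleC in auto)

text \<open>Absolute convergence permits summing the double series for the square along the diagonals
  \<open>m + n = k\<close>, where the convolution of the coefficients leaves only \<open>1 - x\<close>.\<close>

lemma sqrt_series_square: "sqrt_series B (sqrt_series B x) = x - B x"
proof -
  define f where "f = (\<lambda>(m, n). (sqrt_coeff m * sqrt_coeff n) *\<^sub>R (B ^^ (m + n)) x)"
  have inner_norm: "(\<lambda>n. norm (f (m, n))) summable_on UNIV" for m
  proof -
    have "summable (\<lambda>n. \<bar>sqrt_coeff m\<bar> * norm (sqrt_coeff n *\<^sub>R (B ^^ n) ((B ^^ m) x)))"
      by (intro summable_mult summable_norm_terms)
    moreover have "norm (f (m, n)) = \<bar>sqrt_coeff m\<bar> * norm (sqrt_coeff n *\<^sub>R (B ^^ n) ((B ^^ m) x))" for n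
      using funpow_add[of n m B] by (simp add: f_def abs_mult add.commute[of m n])
    ultimately show ?thesis by (simp add: summable_on_UNIV_nonneg_real_iff)
  qed
  define s where "s = (\<Sum>n. \<bar>sqrt_coeff n\<bar>)"
  have bound: "infsum (\<lambda>n. norm (f (m, n))) UNIV \<le> \<bar>sqrt_coeff m\<bar> * (s * norm x)" for m
  proof -
    have "((\<lambda>n. \<bar>sqrt_coeff n\<bar>) has_sum s) UNIV"
      using norm_summable_imp_has_sum[of "\<lambda>n. \<bar>sqrt_coeff n\<bar>"] summable_abs_sqrt_coeff
      unfolding s_def by (simp add: summable_sums)
    then have *: "((\<lambda>n. \<bar>sqrt_coeff m\<bar> * norm x * \<bar>sqrt_coeff n\<bar>) has_sum \<bar>sqrt_coeff m\<bar> * norm x * s) UNIV"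
      by (rule has_sum_cmult_right)
    have "infsum (\<lambda>n. norm (f (m, n))) UNIV \<le> infsum (\<lambda>n. \<bar>sqrt_coeff m\<bar> * norm x * \<bar>sqrt_coeff n\<bar>) UNIV"
    proof (rule infsum_mono[OF inner_norm])
      show "(\<lambda>n. \<bar>sqrt_coeff m\<bar> * norm x * \<bar>sqrt_coeff n\<bar>) summable_on UNIV"
        using * summable_on_def by blast
      show "norm (f (m, n)) \<le> \<bar>sqrt_coeff m\<bar> * norm x * \<bar>sqrt_coeff n\<bar>" for n
        using norm_funpow_le[of "m + n" x]
        by (simp add: f_def abs_mult mult_left_mono mult.assoc mult.commute[of "norm x"])
    qed
    also have "\<dots> = \<bar>sqrt_coeff m\<bar> * (s * norm x)"
      using infsumI[OF *] by simp
    finally show ?thesis .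
  qed
  have f_abs: "(\<lambda>p. norm (f p)) summable_on (UNIV \<times> UNIV)"
  proof (rule Infinite_Sum.abs_summable_on_Sigma_iff[THEN iffD2], intro conjI ballI)
    show "(\<lambda>n. norm (f (m, n))) summable_on UNIV" for m by (rule inner_norm)
    have "summable (\<lambda>m. \<bar>sqrt_coeff m\<bar> * (s * norm x))"
      by (intro summable_mult2 summable_abs_sqrt_coeff)
    then have "(\<lambda>m. \<bar>sqrt_coeff m\<bar> * (s * norm x)) summable_on UNIV"
      using suminf_nonneg[OF summable_abs_sqrt_coeff]
      by (subst summable_on_UNIV_nonneg_real_iff) (auto simp: s_def)
    then show "(\<lambda>m. norm (infsum (\<lambda>n. norm (f (m, n))) UNIV)) summable_on UNIV"
      by (rule summable_on_comparison_test) (use bound in \<open>auto simp: infsum_nonneg\<close>)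
  qed
  then have f_sum: "f summable_on (UNIV \<times> UNIV)" by (rule abs_summable_summable)
  have series: "((\<lambda>n. sqrt_coeff n *\<^sub>R (B ^^ n) y) has_sum sqrt_series B y) UNIV" for y
    unfolding sqrt_series_def
    by (intro norm_summable_imp_has_sum[OF summable_norm_terms] summable_sums summable_terms)
  have "sqrt_series B (sqrt_series B x) = infsum (\<lambda>m. infsum (\<lambda>n. f (m, n)) UNIV) UNIV"
  proof -
    have "infsum (\<lambda>n. f (m, n)) UNIV = sqrt_coeff m *\<^sub>R (B ^^ m) (sqrt_series B x)" for m
    proof -
      have "bounded_linear (\<lambda>y. sqrt_coeff m *\<^sub>R (B ^^ m) y)"
        using bounded_linear_compose[OF bounded_linear_scaleR_right bounded_linear_funpow]
        by (simp add: o_def)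
      from has_sum_bounded_linear[OF this series[of x]] show ?thesis
        using bounded_linear_funpow by (intro infsumI) (simp add: f_def linear_simps funpow_add)
    qed
    then show ?thesis using infsumI[OF series] by simp
  qed
  also have "\<dots> = infsum f (UNIV \<times> UNIV)"
    using infsum_Sigma_banach[OF f_sum] .
  also have "\<dots> = infsum (\<lambda>(k, m). f (m, k - m)) (Sigma UNIV (\<lambda>k. {..k}))"
    by (rule infsum_reindex_bij_witness[where j = "\<lambda>(m, n). (m + n, m)" and i = "\<lambda>(k, m). (m, k - m)"]) auto
  also have "\<dots> = infsum (\<lambda>k. infsum (\<lambda>m. f (m, k - m)) {..k}) UNIV"
  proof -
    have "(\<lambda>(k, m). f (m, k - m)) summable_on (Sigma UNIV (\<lambda>k. {..k}))"
      using f_sum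
      by (subst summable_on_reindex_bij_witness[where j = "\<lambda>(k, m). (m, k - m)" and i = "\<lambda>(m, n). (m + n, m)" and T = "UNIV \<times> UNIV" and h = f]) auto
    from infsum_Sigma_banach[OF this] show ?thesis by simp
  qed
  also have "\<dots> = infsum (\<lambda>k. (if k = 0 then 1 else if k = 1 then - 1 else 0) *\<^sub>R (B ^^ k) x) UNIV"
  proof (rule infsum_cong)
    fix k
    have "infsum (\<lambda>m. f (m, k - m)) {..k} = (\<Sum>m\<le>k. sqrt_coeff m * sqrt_coeff (k - m)) *\<^sub>R (B ^^ k) x"
      by (simp add: f_def scaleR_sum_left)
    then show "infsum (\<lambda>m. f (m, k - m)) {..k}
        = (if k = 0 then 1 else if k = 1 then - 1 else 0) *\<^sub>R (B ^^ k) x"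
      by (simp only: sqrt_coeff_convolution)
  qed
  also have "\<dots> = infsum (\<lambda>k. (if k = 0 then 1 else if k = 1 then - 1 else 0) *\<^sub>R (B ^^ k) x) {0, 1}"
    by (rule infsum_cong_neutral) auto
  finally show ?thesis by simp
qed

text \<open>Any other positive root \<open>S\<close> commutes with \<open>B = I - S\<^sup>2\<close>, hence with the series \<open>R\<close>. For
  \<open>y = (R - S) x\<close> the nonnegative numbers \<open>(R y, y)\<close> and \<open>(S y, y)\<close> add up to
  \<open>((R\<^sup>2 - S\<^sup>2) x, y) = 0\<close>, so \<open>R y = S y = 0\<close> and \<open>\<parallel>y\<parallel>\<^sup>2 = ((R - S) y, x) = 0\<close>.\<close>

lemma sqrt_op_eq: "sqrt_op (\<lambda>x. x - B x) = sqrt_series B"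
  unfolding sqrt_op_def
proof (rule the_equality)
  show "bounded_positive (sqrt_series B) \<and> sqrt_series B \<circ> sqrt_series B = (\<lambda>x. x - B x)"
    using bounded_positive_sqrt_series sqrt_series_square by (auto simp: o_def)
next
  fix S assume "bounded_positive S \<and> S \<circ> S = (\<lambda>x. x - B x)"
  then have S: "bounded_positive S" and SS: "S (S x) = x - B x" for x
    by (auto simp: o_def fun_eq_iff)
  let ?R = "sqrt_series B"
  have linS: "bounded_linear S" using S by (simp add: bounded_positive_def)
  have "B x = x - S (S x)" for x by (simp add: SS)
  then have "S (B x) = B (S x)" for x using linS by (simp add: linear_simps)
  then have comm: "S (?R x) = ?R (S x)" for x by (rule sqrt_series_commute[OF linS])
  show "S = ?R"
  proof
    fix x
    define y where "y = ?R x - S x"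
    have "?R y + S y = 0"
      unfolding y_def using linS bounded_linear_sqrt_series
      by (simp add: linear_simps comm SS sqrt_series_square)
    then have "cinner (?R y) y + cinner (S y) y = 0" by (simp flip: cinner_add_left)
    moreover have "Im (cinner (?R y) y) = 0" "0 \<le> Re (cinner (?R y) y)"
      "Im (cinner (S y) y) = 0" "0 \<le> Re (cinner (S y) y)"
      using S bounded_positive_sqrt_series by (simp_all add: bounded_positive_def)
    ultimately have "cinner (?R y) y = 0" "cinner (S y) y = 0"
      by (simp_all add: complex_eq_iff)
    then have "?R y = 0" "S y = 0"
      using S bounded_positive_sqrt_series by (simp_all add: bounded_positive_eq_zero)
    moreover have "cinner y y = cinner x (?R y - S y)"
      using bounded_positive_selfadjoint[OF S, of x y]
        bounded_positive_selfadjoint[OF bounded_positive_sqrt_series, of x y]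
      by (subst y_def) (simp add: cinner_simps)
    ultimately show "S x = ?R x" by (simp add: y_def)
  qed
qed

end

section \<open>Contractions, their adjoints and conjugations\<close>

text \<open>An operator is carried together with its adjoint; the adjointness relation makes both of them
  linear.\<close>
definition contraction_pair :: "('a::complex_inner \<Rightarrow> 'a) \<Rightarrow> ('a \<Rightarrow> 'a) \<Rightarrow> bool"
  where "contraction_pair W W' \<longleftrightarrow>
    (\<forall>x y. cinner (W x) y = cinner x (W' y)) \<and> (\<forall>x. norm (W x) \<le> norm x)"

lemma contraction_pair_adjoint: "contraction_pair W W' \<Longrightarrow> cinner (W x) y = cinner x (W' y)"
  and contraction_pair_norm: "contraction_pair W W' \<Longrightarrow> norm (W x) \<le> norm x"
  by (simp_all add: contraction_pair_def)

lemma contraction_pair_swap: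
  assumes "contraction_pair W W'"
  shows "contraction_pair W' W"
  unfolding contraction_pair_def
proof (intro conjI allI)
  show adjoint: "cinner (W' x) y = cinner x (W y)" for x y
    using contraction_pair_adjoint[OF assms, of y x] cinner_commute[of "W' x" y] cinner_commute[of x "W y"]
    by simp
  have "cmod (cinner (W' y) (W' y)) \<le> norm y * norm (W' y)" for y
  proof -
    have "cmod (cinner (W' y) (W' y)) \<le> norm y * norm (W (W' y))"
      unfolding adjoint by (rule cinner_Cauchy_Schwarz)
    also have "\<dots> \<le> norm y * norm (W' y)"
      by (intro mult_left_mono contraction_pair_norm[OF assms] norm_ge_zero)
    finally show ?thesis .
  qed
  then show "norm (W' y) \<le> norm y" for y by (rule norm_le_if_cinner_le) simp
qed

lemma contraction_pair_clinear:
  assumes "contraction_pair W W'"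
  shows "clinear_on S W"
  unfolding clinear_on_def
  by (intro conjI ballI allI; rule eqI_cinner_left)
     (simp_all add: contraction_pair_adjoint[OF assms] cinner_simps)

lemma
  assumes "contraction_pair W W'"
  shows contraction_pair_add: "W (x + y) = W x + W y"
    and contraction_pair_scaleC: "W (c *\<^sub>C x) = c *\<^sub>C W x"
    and contraction_pair_diff: "W (x - y) = W x - W y"
proof -
  note clinear = contraction_pair_clinear[OF assms, of UNIV]
  show "W (x + y) = W x + W y" by (rule clinear_on_add[OF clinear UNIV_I UNIV_I])
  show "W (c *\<^sub>C x) = c *\<^sub>C W x" by (rule clinear_on_scaleC[OF clinear UNIV_I])
  show "W (x - y) = W x - W y" by (rule clinear_on_diff[OF clinear csubspace_UNIV UNIV_I UNIV_I])
qed

text \<open>The adjoint \<open>U\<close> of \<open>V : S \<rightarrow> H\<close> takes its values in the closure of \<open>S\<close>; its own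
  adjoint is the extension of \<open>V\<close> that vanishes on the orthogonal complement of \<open>S\<close>.\<close>

lemma contraction_pair_extending:
  fixes V :: "'a::complex_hilbert_space \<Rightarrow> 'a"
  assumes S: "csubspace S" and V: "clinear_on S V" and norm: "\<And>h. h \<in> S \<Longrightarrow> norm (V h) \<le> norm h"
  obtains W W' where "contraction_pair W W'" and "\<And>h. h \<in> S \<Longrightarrow> W h = V h"
    and "\<And>y. W' y \<in> closure S"
proof -
  note id = clinear_on_id[of S]
  have bound: "cmod (cinner (V h) y) \<le> norm y * norm h" if "h \<in> S" for h y
    using cinner_Cauchy_Schwarz[of "V h" y] mult_right_mono[OF norm[OF that], of "norm y"]
    by (simp add: mult.commute)
  have "\<exists>u. u \<in> closure S \<and> (\<forall>h\<in>S. cinner (V h) y = cinner h u)" for y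
  proof -
    have "clinear_on S (\<lambda>h. cinner (V h) y)"
      using V by (simp add: clinear_on_def cinner_simps scaleC_complex_def)
    then obtain u where "u \<in> closure ((\<lambda>h. h) ` S)" "\<And>h. h \<in> S \<Longrightarrow> cinner (V h) y = cinner h u"
      using bound by (rule Riesz_through_map[OF S id]) auto
    then show ?thesis by auto
  qed
  then have "\<exists>U. \<forall>y. U y \<in> closure S \<and> (\<forall>h\<in>S. cinner (V h) y = cinner h (U y))"
    by (intro choice allI)
  then obtain U where U: "\<And>y. U y \<in> closure S" "\<And>y h. h \<in> S \<Longrightarrow> cinner (V h) y = cinner h (U y)"
    by blast
  note closure = csubspace_closure[OF S]
  have unique: "u = u'" if "u \<in> closure S" "u' \<in> closure S" "\<And>h. h \<in> S \<Longrightarrow> cinner h u = cinner h u'" for u u'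
    using Riesz_unique[OF S id, of u u'] that by simp
  have U_lin: "clinear_on UNIV U"
    unfolding clinear_on_def
    by (intro conjI ballI allI; rule unique)
       (simp_all add: U(1) csubspace_add[OF closure] csubspace_scaleC[OF closure] cinner_simps
         U(2)[symmetric])
  have U_norm: "norm (U y) \<le> norm y" for y
    by (rule Riesz_norm_le[of _ "\<lambda>h. h" S]) (use U bound in \<open>auto simp flip: U(2)\<close>)
  have "\<exists>w. \<forall>y. cinner (U y) x = cinner y w" for x
  proof -
    have "clinear_on UNIV (\<lambda>y. cinner (U y) x)"
      using U_lin by (simp add: clinear_on_def cinner_simps scaleC_complex_def)
    moreover have "cmod (cinner (U y) x) \<le> norm x * norm y" for y
      using cinner_Cauchy_Schwarz[of "U y" x] mult_right_mono[OF U_norm, of "norm x" y]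
      by (simp add: mult.commute)
    ultimately obtain w where "\<And>y. y \<in> UNIV \<Longrightarrow> cinner (U y) x = cinner y w"
      by (rule Riesz_through_map[OF csubspace_UNIV clinear_on_id]) auto
    then show ?thesis by auto
  qed
  then have "\<exists>W. \<forall>x y. cinner (U y) x = cinner y (W x)" by (intro choice allI)
  then obtain W where "\<And>x y. cinner (U y) x = cinner y (W x)" by blast
  then have "contraction_pair U W" using U_norm by (simp add: contraction_pair_def)
  then have WU: "contraction_pair W U" by (rule contraction_pair_swap)
  show ?thesis
  proof (rule that[OF WU])
    show "W h = V h" if "h \<in> S" for h
      by (rule eqI_cinner_left) (simp add: contraction_pair_adjoint[OF WU] U(2)[OF that])
  qed (rule U(1))
qed

lemma contraction_pair_exists:
  fixes W :: "'a::complex_hilbert_space \<Rightarrow> 'a"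
  assumes "clinear_on UNIV W" and "\<And>x. norm (W x) \<le> norm x"
  shows "\<exists>W'. contraction_pair W W'"
proof (rule contraction_pair_extending[OF csubspace_UNIV assms])
  fix W0 W' assume "contraction_pair W0 W'" and "\<And>x. x \<in> UNIV \<Longrightarrow> W0 x = W x"
  moreover from this(2) have "W0 = W" by auto
  ultimately show ?thesis by auto
qed

lemma conjugation_add: "conjugation C \<Longrightarrow> C (x + y) = C x + C y"
  and conjugation_scaleC: "conjugation C \<Longrightarrow> C (c *\<^sub>C x) = cnj c *\<^sub>C C x"
  and conjugation_norm: "conjugation C \<Longrightarrow> norm (C x) = norm x"
  and conjugation_involutive: "conjugation C \<Longrightarrow> C (C x) = x"
  by (simp_all add: conjugation_def)

lemma conjugation_diff:
  assumes "conjugation C"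
  shows "C (x - y) = C x - C y"
  using conjugation_add[OF assms, of x "(-1) *\<^sub>C y"] conjugation_scaleC[OF assms, of "-1" y]
  by (simp add: scaleC_one)

lemma conjugation_0: "conjugation C \<Longrightarrow> C 0 = 0"
  using conjugation_diff[of C 0 0] by simp

lemma conjugation_eq_0_iff: "conjugation C \<Longrightarrow> C x = 0 \<longleftrightarrow> x = 0"
  using conjugation_involutive[of C x] conjugation_0[of C] by auto

lemma cinner_conjugation_both:
  assumes C: "conjugation C"
  shows "cinner (C x) (C y) = cinner y x"
proof -
  have inner: "inner (C x) (C y) = inner x y" for x y
  proof -
    have "(norm (C (x + y)))\<^sup>2 = (norm (x + y))\<^sup>2" by (simp add: conjugation_norm[OF C])
    then show ?thesis
      by (simp add: conjugation_add[OF C] norm_add_squared conjugation_norm[OF C] inner_eq_Re_cinner)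
  qed
  have "\<i> *\<^sub>C C y = C ((- \<i>) *\<^sub>C y)" by (simp only: conjugation_scaleC[OF C]) simp
  then have "cinner (C x) (C y) = Complex (inner x y) (inner x ((- \<i>) *\<^sub>C y))"
    unfolding cinner_eq_Complex_inner[of "C x"] by (simp only: inner)
  also have "\<dots> = cnj (cinner x y)" by (simp add: cinner_eq_Complex_inner[of x] complex_eq_iff)
  finally show ?thesis by (metis cinner_commute)
qed

lemma cinner_conjugation_left: "conjugation C \<Longrightarrow> cinner (C x) y = cinner (C y) x"
  and cinner_conjugation_right: "conjugation C \<Longrightarrow> cinner x (C y) = cinner y (C x)"
  using cinner_conjugation_both[of C x "C y"] cinner_conjugation_both[of C "C x" y]
  by (simp_all add: conjugation_involutive)

lemma contraction_pair_conjugate: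
  assumes C: "conjugation C" and W: "contraction_pair W W'"
  shows "contraction_pair (\<lambda>x. C (W (C x))) (\<lambda>x. C (W' (C x)))"
  unfolding contraction_pair_def
proof (intro conjI allI)
  fix x y
  have "cinner (C (W (C x))) y = cinner (C y) (W (C x))" by (rule cinner_conjugation_left[OF C])
  also have "\<dots> = cinner (W' (C y)) (C x)"
    using contraction_pair_swap[OF W] by (simp add: contraction_pair_adjoint)
  also have "\<dots> = cinner x (C (W' (C y)))" by (rule cinner_conjugation_right[OF C])
  finally show "cinner (C (W (C x))) y = cinner x (C (W' (C y)))" .
  show "norm (C (W (C x))) \<le> norm x"
    using contraction_pair_norm[OF W, of "C x"] by (simp add: conjugation_norm[OF C])
qed

lemma csubspace_conjugation_image:
  assumes C: "conjugation C" and S: "csubspace S"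
  shows "csubspace (C ` S)"
  unfolding csubspace_def
proof (intro conjI ballI allI)
  show "0 \<in> C ` S" using conjugation_0[OF C] csubspace_0[OF S] by (metis imageI)
next
  fix x y assume "x \<in> C ` S" "y \<in> C ` S"
  then show "x + y \<in> C ` S"
    using csubspace_add[OF S] by (auto simp flip: conjugation_add[OF C])
next
  fix c x assume "x \<in> C ` S"
  then obtain s where "s \<in> S" "x = C s" by blast
  then have "c *\<^sub>C x = C (cnj c *\<^sub>C s)" "cnj c *\<^sub>C s \<in> S"
    using S by (simp_all add: conjugation_scaleC[OF C] csubspace_scaleC)
  then show "c *\<^sub>C x \<in> C ` S" by blast
qed

text \<open>This is \<open>2 \<parallel>W x\<parallel>\<^sup>2 = 2 Re (x, W' W x) \<le> \<parallel>x\<parallel>\<^sup>2 + \<parallel>W' W x\<parallel>\<^sup>2\<close>, read as a comparison of the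
  defect of the adjoint at \<open>W x\<close> with the defect of \<open>W\<close> at \<open>x\<close>.\<close>

lemma contraction_pair_defect_le:
  assumes "contraction_pair W W'"
  shows "(norm (W x))\<^sup>2 - (norm (W' (W x)))\<^sup>2 \<le> (norm x)\<^sup>2 - (norm (W x))\<^sup>2"
proof -
  have "Re (cinner x (W' (W x))) = (norm (W x))\<^sup>2"
    unfolding contraction_pair_adjoint[OF assms, symmetric] by (simp add: cinner_self)
  moreover have "0 \<le> (norm (x - W' (W x)))\<^sup>2" by simp
  ultimately show ?thesis by (simp add: norm_diff_squared)
qed

text \<open>A symmetric contraction leaves room for a symmetric rank-one perturbation in every direction
  \<open>e\<close> that is dominated by the defect of its adjoint. By symmetry \<open>C e\<close> is dominated by the
  defect of \<open>W\<close>, so both factors of the cross term \<open>2 t Re (W x, (x, C e) e)\<close> are controlled.\<close>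

lemma rank_one_perturbation:
  assumes C: "conjugation C" and W: "contraction_pair W W'" and symm: "\<And>x. C (W' (C x)) = W x"
    and e: "\<And>x. (cmod (cinner x e))\<^sup>2 \<le> \<kappa> * ((norm x)\<^sup>2 - (norm (W' x))\<^sup>2)" and \<kappa>: "0 \<le> \<kappa>"
  obtains t :: real where "0 < t"
    and "contraction_pair (\<lambda>x. W x + (of_real t * cinner x (C e)) *\<^sub>C e)
           (\<lambda>y. W' y + (of_real t * cinner y e) *\<^sub>C C e)"
proof -
  \<comment> \<open>The perturbation is contractive as soon as \<open>2 t \<kappa> + t\<^sup>2 \<kappa> \<parallel>e\<parallel>\<^sup>2 \<le> 1\<close>; for \<open>t \<le> 1\<close> the square may be
    replaced by \<open>t\<close>.\<close>
  define t where "t = 1 / (2 * \<kappa> + \<kappa> * (norm e)\<^sup>2 + 1)"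
  have denom: "1 \<le> 2 * \<kappa> + \<kappa> * (norm e)\<^sup>2 + 1" using \<kappa> by simp
  then have t: "0 < t" "t \<le> 1" by (simp_all add: t_def)
  have "2 * t * \<kappa> + t\<^sup>2 * \<kappa> * (norm e)\<^sup>2 \<le> 2 * t * \<kappa> + t * \<kappa> * (norm e)\<^sup>2"
    using t \<kappa> by (intro add_left_mono mult_right_mono) (auto simp: power2_eq_square mult_left_le_one_le)
  also have "\<dots> = t * (2 * \<kappa> + \<kappa> * (norm e)\<^sup>2)" by (simp add: algebra_simps)
  also have "\<dots> \<le> 1" using denom by (simp add: t_def)
  finally have t_le: "2 * t * \<kappa> + t\<^sup>2 * \<kappa> * (norm e)\<^sup>2 \<le> 1" .
  have W'C: "W' (C x) = C (W x)" for x
    using symm[of x] conjugation_involutive[OF C, of "W' (C x)"] by simp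
  show ?thesis
  proof (rule that[OF t(1)], unfold contraction_pair_def, intro conjI allI)
    show "cinner (W x + (of_real t * cinner x (C e)) *\<^sub>C e) y
        = cinner x (W' y + (of_real t * cinner y e) *\<^sub>C C e)" for x y
      using cinner_commute[of e y]
      by (simp add: cinner_simps contraction_pair_adjoint[OF W])
    fix x
    define a where "a = cinner x (C e)"
    define \<delta> where "\<delta> = (norm x)\<^sup>2 - (norm (W x))\<^sup>2"
    have \<delta>: "0 \<le> \<delta>" unfolding \<delta>_def using contraction_pair_norm[OF W, of x] by (simp add: power_mono)
    have a: "(cmod a)\<^sup>2 \<le> \<kappa> * \<delta>"
    proof -
      have "cmod a = cmod (cinner (C x) e)"
        unfolding a_def cinner_conjugation_right[OF C, of x] by (rule cmod_cinner_commute)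
      then show ?thesis using e[of "C x"] by (simp add: \<delta>_def W'C conjugation_norm[OF C])
    qed
    have b: "(cmod (cinner (W x) e))\<^sup>2 \<le> \<kappa> * \<delta>"
      using e[of "W x"] mult_left_mono[OF contraction_pair_defect_le[OF W, of x] \<kappa>]
      unfolding \<delta>_def by linarith
    define v where "v = (of_real t * a) *\<^sub>C e"
    have "2 * Re (cinner (W x) v) \<le> 2 * cmod (cinner (W x) v)"
      using complex_Re_le_cmod[of "cinner (W x) v"] by linarith
    also have "\<dots> = t * (2 * cmod a * cmod (cinner (W x) e))"
      using t by (simp add: v_def norm_mult)
    also have "\<dots> \<le> t * ((cmod a)\<^sup>2 + (cmod (cinner (W x) e))\<^sup>2)"
      using t sum_squares_bound[of "cmod a"] by (intro mult_left_mono) auto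
    also have "\<dots> \<le> t * (\<kappa> * \<delta> + \<kappa> * \<delta>)"
      using t a b by (intro mult_left_mono add_mono) auto
    finally have cross: "2 * Re (cinner (W x) v) \<le> 2 * t * \<kappa> * \<delta>"
      by (simp add: algebra_simps)
    have "(norm v)\<^sup>2 = t\<^sup>2 * (norm e)\<^sup>2 * (cmod a)\<^sup>2"
      by (simp add: v_def norm_mult power_mult_distrib)
    also have "\<dots> \<le> t\<^sup>2 * (norm e)\<^sup>2 * (\<kappa> * \<delta>)" using a by (intro mult_left_mono) auto
    finally have "(norm (W x + v))\<^sup>2
        \<le> (norm (W x))\<^sup>2 + (2 * t * \<kappa> + t\<^sup>2 * \<kappa> * (norm e)\<^sup>2) * \<delta>"
      using cross unfolding norm_add_squared by (simp add: algebra_simps)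
    also have "\<dots> \<le> (norm (W x))\<^sup>2 + 1 * \<delta>"
      using t_le \<delta> by (intro add_left_mono mult_right_mono) auto
    finally have "(norm (W x + v))\<^sup>2 \<le> (norm x)\<^sup>2" by (simp add: \<delta>_def)
    then show "norm (W x + (of_real t * cinner x (C e)) *\<^sub>C e) \<le> norm x"
      unfolding v_def a_def by (rule power2_le_imp_le) simp
  qed
qed

section \<open>Symmetric completions of a symmetric contraction\<close>

text \<open>\<open>V\<close> is a contraction on \<open>M\<close>, continued by \<open>0\<close> to the orthogonal complement \<open>N\<close> (this is
  the meaning of \<open>U_in\<close>), and symmetric for the bilinear form \<open>cinner x (C y)\<close>; \<open>D\<close> is the defect
  operator of the adjoint.\<close>

locale symmetric_partial_contraction =
  fixes C :: "'a::complex_hilbert_space \<Rightarrow> 'a" and M :: "'a set" and V U D :: "'a \<Rightarrow> 'a"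
  assumes C: "conjugation C" and M: "csubspace M" "closed M"
    and VU: "contraction_pair V U" and U_in: "\<And>y. U y \<in> M"
    and symm: "\<And>h k. h \<in> M \<Longrightarrow> k \<in> M \<Longrightarrow> cinner (V h) (C k) = cinner h (C (V k))"
    and D: "bounded_positive D" and D_square: "\<And>x. D (D x) = x - V (U x)"
begin

abbreviation N :: "'a set" where "N \<equiv> ortho_compl M"
abbreviation CM :: "'a set" where "CM \<equiv> C ` M"
abbreviation CN :: "'a set" where "CN \<equiv> C ` N"

definition P :: "'a \<Rightarrow> 'a"
  where "P x = (SOME m. m \<in> M \<and> x - m \<in> N)"

lemma P_in: "P x \<in> M" and P_compl: "x - P x \<in> N"
proof -
  obtain q where q: "q \<in> closure M" "\<And>s. s \<in> M \<Longrightarrow> cinner s (x - q) = 0"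
    using orthogonal_projection[OF M(1)] by blast
  have "x - q \<in> N" using q(2) cinner_eq_zero_commute[of "x - q"] by (simp add: ortho_compl_def)
  moreover have "q \<in> M" using q(1) M(2) by simp
  ultimately have "\<exists>m. m \<in> M \<and> x - m \<in> N" by blast
  then have "P x \<in> M \<and> x - P x \<in> N" unfolding P_def by (rule someI_ex)
  then show "P x \<in> M" "x - P x \<in> N" by simp_all
qed

lemma cinner_M_N: "m \<in> M \<Longrightarrow> n \<in> N \<Longrightarrow> cinner m n = 0"
  and cinner_N_M: "m \<in> M \<Longrightarrow> n \<in> N \<Longrightarrow> cinner n m = 0"
  using cinner_eq_zero_commute[of n m] by (simp_all add: ortho_compl_def)

lemma norm_M_N: "m \<in> M \<Longrightarrow> n \<in> N \<Longrightarrow> (norm (m + n))\<^sup>2 = (norm m)\<^sup>2 + (norm n)\<^sup>2"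
  by (rule norm_add_squared_orthogonal) (rule cinner_M_N)

lemma norm_P: "(norm x)\<^sup>2 = (norm (P x))\<^sup>2 + (norm (x - P x))\<^sup>2"
  using norm_M_N[OF P_in P_compl, of x x] by simp

lemma P_id:
  assumes "m \<in> M"
  shows "P m = m"
proof -
  have "cinner (m - P m) (m - P m) = 0"
    by (rule cinner_M_N[OF csubspace_diff[OF M(1) assms P_in] P_compl])
  then show ?thesis by simp
qed

lemma CM: "csubspace CM"
  by (rule csubspace_conjugation_image[OF C M(1)])

lemma CN: "csubspace CN"
  by (rule csubspace_conjugation_image[OF C csubspace_ortho_compl])

lemma in_CN:
  assumes "\<And>k. k \<in> M \<Longrightarrow> cinner v (C k) = 0"
  shows "v \<in> CN"
proof -
  have "cinner (C v) k = 0" if "k \<in> M" for k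
    using assms[OF that] cinner_conjugation_left[OF C, of v k] cinner_eq_zero_commute[of v "C k"] by simp
  then have "C v \<in> N" by (simp add: ortho_compl_def)
  then show ?thesis by (rule image_eqI[rotated]) (simp add: conjugation_involutive[OF C])
qed

lemma cinner_CM_CN: "s \<in> CM \<Longrightarrow> v \<in> CN \<Longrightarrow> cinner s v = 0"
  by (auto simp: cinner_conjugation_both[OF C] cinner_N_M)

lemma D_adjoint: "cinner (D x) y = cinner x (D y)"
  by (rule bounded_positive_selfadjoint[OF D])

lemma D_clinear: "clinear_on S D"
  using D by (auto simp: clinear_on_def bounded_positive_def linear_simps)

lemma norm_D: "(norm (D x))\<^sup>2 = (norm x)\<^sup>2 - (norm (U x))\<^sup>2"
proof -
  have "cinner (D x) (D x) = cinner x x - cinner x (V (U x))"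
    by (simp add: D_adjoint D_square cinner_diff_right)
  also have "cinner x (V (U x)) = cinner (U x) (U x)"
    by (rule contraction_pair_adjoint[OF contraction_pair_swap[OF VU], symmetric])
  finally have "complex_of_real ((norm (D x))\<^sup>2) = of_real ((norm x)\<^sup>2 - (norm (U x))\<^sup>2)"
    by (simp add: cinner_self)
  then show ?thesis by (simp only: of_real_eq_iff)
qed

text \<open>Membership in the range of \<open>D\<close> as a domination property, by the Riesz representation
  through \<open>D\<close>.\<close>

lemma in_range_D_iff: "v \<in> range D \<longleftrightarrow> (\<exists>c. \<forall>x. cmod (cinner x v) \<le> c * norm (D x))"
proof
  assume "v \<in> range D"
  then obtain y where y: "v = D y" by blast
  have "cmod (cinner x v) \<le> norm y * norm (D x)" for x
    using cinner_Cauchy_Schwarz[of "D x" y] by (simp add: y D_adjoint mult.commute)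
  then show "\<exists>c. \<forall>x. cmod (cinner x v) \<le> c * norm (D x)" by blast
next
  assume "\<exists>c. \<forall>x. cmod (cinner x v) \<le> c * norm (D x)"
  then obtain c where c: "\<And>x. cmod (cinner x v) \<le> c * norm (D x)" by blast
  have "clinear_on UNIV (\<lambda>x. cinner x v)" by (simp add: clinear_on_def cinner_simps scaleC_complex_def)
  then obtain y where y: "\<And>x. x \<in> UNIV \<Longrightarrow> cinner x v = cinner (D x) y"
    using c by (rule Riesz_through_map[OF csubspace_UNIV D_clinear]) auto
  have "v = D y" by (rule eqI_cinner_right) (simp add: y D_adjoint)
  then show "v \<in> range D" by blast
qed

subsection \<open>The criterion for uniqueness\<close>

definition trivial_intersection :: bool
  where "trivial_intersection \<longleftrightarrow> range D \<inter> CN = {0}"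

lemma zero_in_intersection: "0 \<in> range D \<inter> CN"
proof -
  have "D 0 = 0" by (rule clinear_on_0[OF D_clinear csubspace_UNIV])
  then show ?thesis using csubspace_0[OF CN] rangeI[of D 0] by simp
qed

lemma trivial_intersection_iff: "trivial_intersection \<longleftrightarrow> (\<forall>y. D y \<in> CN \<longrightarrow> D y = 0)"
  unfolding trivial_intersection_def using zero_in_intersection by blast

text \<open>The vector \<open>D y\<close> lies in \<open>C N\<close> if and only if \<open>y\<close> is orthogonal to \<open>D (C M)\<close>. So the intersection
  is trivial if and only if \<open>D (C M)\<close> is dense in the range of \<open>D\<close>, and this has to be tested on
  \<open>C N\<close> only, because \<open>C M\<close> and \<open>C N\<close> span the space.\<close>

lemma trivial_intersection_iff_density:
  "trivial_intersection \<longleftrightarrow> (\<forall>\<phi>\<in>N. D (C \<phi>) \<in> closure (D ` CM))"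
proof
  assume triv: "trivial_intersection"
  show "\<forall>\<phi>\<in>N. D (C \<phi>) \<in> closure (D ` CM)"
  proof
    fix \<phi> assume "\<phi> \<in> N"
    obtain q where q: "q \<in> closure (D ` CM)" "\<And>s. s \<in> D ` CM \<Longrightarrow> cinner s (D (C \<phi>) - q) = 0"
      using orthogonal_projection[OF csubspace_image[OF D_clinear CM]] by blast
    define r where "r = D (C \<phi>) - q"
    have "D r \<in> CN"
    proof (rule in_CN)
      fix k assume "k \<in> M"
      then have "cinner (D (C k)) r = 0" using q(2) by (simp add: r_def)
      then show "cinner (D r) (C k) = 0"
        using cinner_eq_zero_commute[of "D (C k)" r] by (simp add: D_adjoint)
    qed
    then have "D r = 0" using triv by (simp add: trivial_intersection_iff)
    then have "cinner (D (C \<phi>)) r = 0" by (simp add: D_adjoint)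
    moreover have "cinner q r = 0"
      unfolding r_def by (rule cinner_closure_eq_zero[OF q(2) q(1)])
    ultimately have "cinner r r = 0" by (subst (1) r_def) (simp add: cinner_simps)
    then show "D (C \<phi>) \<in> closure (D ` CM)" using q(1) by (simp add: r_def)
  qed
next
  assume dense: "\<forall>\<phi>\<in>N. D (C \<phi>) \<in> closure (D ` CM)"
  show "trivial_intersection"
    unfolding trivial_intersection_iff
  proof (intro allI impI)
    fix y assume y: "D y \<in> CN"
    have CM_zero: "cinner s y = 0" if "s \<in> D ` CM" for s
      using that cinner_CM_CN[OF _ y] by (auto simp: D_adjoint)
    have "cinner x (D y) = 0" for x
    proof -
      have x: "x = C (P (C x)) + C (C x - P (C x))"
        by (simp add: conjugation_diff[OF C] conjugation_involutive[OF C])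
      have "cinner (D (C (P (C x)))) y = 0" by (rule CM_zero) (use P_in in blast)
      moreover have "cinner (D (C (C x - P (C x)))) y = 0"
        by (rule cinner_closure_eq_zero[of "D ` CM"]) (use CM_zero dense P_compl in blast)+
      ultimately show ?thesis by (subst x) (simp add: cinner_add_left D_adjoint)
    qed
    then show "D y = 0" by (rule eq_zero_if_cinner_zero)
  qed
qed

text \<open>A finite bound says that \<open>C \<phi>\<close> is dominated by \<open>D\<close>, hence that it lies in the range of \<open>D\<close>.\<close>

lemma trivial_intersection_iff_unbounded:
  "trivial_intersection \<longleftrightarrow>
    (\<forall>\<phi>\<in>N - {0}. \<nexists>c. \<forall>f. (cmod (cinner (C f) \<phi>))\<^sup>2 \<le> c * (norm (D f))\<^sup>2)"
proof -
  have *: "(\<exists>c. \<forall>f. (cmod (cinner (C f) \<phi>))\<^sup>2 \<le> c * (norm (D f))\<^sup>2) \<longleftrightarrow> C \<phi> \<in> range D" for \<phi>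
  proof -
    have eq: "cmod (cinner (C f) \<phi>) = cmod (cinner f (C \<phi>))" for f
      unfolding cinner_conjugation_left[OF C, of f] by (rule cmod_cinner_commute)
    show ?thesis
      unfolding in_range_D_iff eq
    proof
      assume "\<exists>c. \<forall>f. (cmod (cinner f (C \<phi>)))\<^sup>2 \<le> c * (norm (D f))\<^sup>2"
      then obtain c where c: "\<And>f. (cmod (cinner f (C \<phi>)))\<^sup>2 \<le> c * (norm (D f))\<^sup>2" by blast
      have "cmod (cinner f (C \<phi>)) \<le> sqrt \<bar>c\<bar> * norm (D f)" for f
      proof (rule power2_le_imp_le)
        have "c * (norm (D f))\<^sup>2 \<le> \<bar>c\<bar> * (norm (D f))\<^sup>2" by (intro mult_right_mono) auto
        then show "(cmod (cinner f (C \<phi>)))\<^sup>2 \<le> (sqrt \<bar>c\<bar> * norm (D f))\<^sup>2"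
          using c[of f] by (simp add: power_mult_distrib)
      qed simp
      then show "\<exists>c. \<forall>f. cmod (cinner f (C \<phi>)) \<le> c * norm (D f)" by blast
    next
      assume "\<exists>c. \<forall>f. cmod (cinner f (C \<phi>)) \<le> c * norm (D f)"
      then obtain c where c: "\<And>f. cmod (cinner f (C \<phi>)) \<le> c * norm (D f)" by blast
      have "(cmod (cinner f (C \<phi>)))\<^sup>2 \<le> c\<^sup>2 * (norm (D f))\<^sup>2" for f
        using power_mono[OF c norm_ge_zero, of f 2] by (simp add: power_mult_distrib)
      then show "\<exists>c. \<forall>f. (cmod (cinner f (C \<phi>)))\<^sup>2 \<le> c * (norm (D f))\<^sup>2" by blast
    qed
  qed
  have "trivial_intersection \<longleftrightarrow> (\<forall>\<phi>\<in>N - {0}. C \<phi> \<notin> range D)"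
  proof
    assume "trivial_intersection"
    then show "\<forall>\<phi>\<in>N - {0}. C \<phi> \<notin> range D"
      unfolding trivial_intersection_def using conjugation_eq_0_iff[OF C] by blast
  next
    assume "\<forall>\<phi>\<in>N - {0}. C \<phi> \<notin> range D"
    then have *: "\<phi> = 0" if "\<phi> \<in> N" "C \<phi> \<in> range D" for \<phi> using that by blast
    then have "v = 0" if v: "v \<in> range D" "v \<in> CN" for v
    proof -
      obtain \<phi> where \<phi>: "\<phi> \<in> N" "v = C \<phi>" using v(2) by blast
      with *[of \<phi>] v(1) have "\<phi> = 0" by simp
      with \<phi> show ?thesis by (simp add: conjugation_0[OF C])
    qed
    then show "trivial_intersection"
      unfolding trivial_intersection_def using zero_in_intersection by blast
  qed
  then show ?thesis unfolding * .
qed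

subsection \<open>Completions\<close>

text \<open>Here \<open>C W' C\<close> is the transpose of \<open>W\<close> for the bilinear form \<open>cinner x (C y)\<close>. As a block matrix
  for that form, \<open>W\<close> has its first column and its first row prescribed; the entry from \<open>N\<close> to
  \<open>C N\<close> is free.\<close>
definition completion :: "('a \<Rightarrow> 'a) \<Rightarrow> ('a \<Rightarrow> 'a) \<Rightarrow> bool"
  where "completion W W' \<longleftrightarrow> contraction_pair W W' \<and>
    (\<forall>h\<in>M. W h = V h) \<and> (\<forall>h\<in>M. C (W' (C h)) = V h)"

text \<open>The defect of \<open>W'\<close> is nonnegative, so the part of \<open>W' x\<close> outside \<open>M\<close> is dominated by
  \<open>D x\<close>.\<close>

lemma extension_adjoint:
  assumes W: "contraction_pair W W'" and ext: "\<And>h. h \<in> M \<Longrightarrow> W h = V h"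
  shows "W' x - U x \<in> N" and "norm (W' x - U x) \<le> norm (D x)"
proof -
  have "cinner h (W' x - U x) = 0" if "h \<in> M" for h
    unfolding cinner_diff_right
      contraction_pair_adjoint[OF W, symmetric] contraction_pair_adjoint[OF VU, symmetric]
    by (simp add: ext[OF that])
  then show N: "W' x - U x \<in> N" using cinner_eq_zero_commute[of "W' x - U x"] by (simp add: ortho_compl_def)
  have "(norm (W' x))\<^sup>2 = (norm (U x))\<^sup>2 + (norm (W' x - U x))\<^sup>2"
    using norm_M_N[OF U_in[of x] N] by simp
  moreover have "(norm (W' x))\<^sup>2 \<le> (norm x)\<^sup>2"
    using contraction_pair_norm[OF contraction_pair_swap[OF W]] by (simp add: power_mono)
  ultimately have "(norm (W' x - U x))\<^sup>2 \<le> (norm (D x))\<^sup>2" by (simp add: norm_D)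
  then show "norm (W' x - U x) \<le> norm (D x)" by (rule power2_le_imp_le) simp
qed

text \<open>On \<open>N\<close> the difference of two completions maps into \<open>C N\<close>, because both have the same
  transpose on \<open>M\<close>, and into the range of \<open>D\<close>, because both adjoints are dominated by \<open>D\<close>.\<close>

lemma completion_unique:
  assumes triv: "trivial_intersection"
    and W1: "completion W1 W1'" and W2: "completion W2 W2'"
  shows "W1 = W2"
proof -
  have pairs: "contraction_pair W1 W1'" "contraction_pair W2 W2'"
    using W1 W2 by (simp_all add: completion_def)
  have on_N: "W1 \<phi> = W2 \<phi>" if \<phi>: "\<phi> \<in> N" for \<phi>
  proof -
    define v where "v = W1 \<phi> - W2 \<phi>"
    have "v \<in> CN"
    proof (rule in_CN)
      fix k assume "k \<in> M"
      then have "C (W1' (C k)) = C (W2' (C k))" using W1 W2 by (simp add: completion_def)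
      then have "C (C (W1' (C k))) = C (C (W2' (C k)))" by simp
      then have "W1' (C k) = W2' (C k)" by (simp only: conjugation_involutive[OF C])
      then show "cinner v (C k) = 0"
        by (simp add: v_def cinner_diff_left contraction_pair_adjoint[OF pairs(1)]
          contraction_pair_adjoint[OF pairs(2)])
    qed
    moreover have "v \<in> range D"
      unfolding in_range_D_iff
    proof (intro exI allI)
      fix x
      have *: "cmod (cinner x (W \<phi>)) \<le> norm \<phi> * norm (D x)" if W: "completion W W'" for W W'
      proof -
        have pair: "contraction_pair W W'" and ext: "\<And>h. h \<in> M \<Longrightarrow> W h = V h"
          using W by (simp_all add: completion_def)
        have "cinner x (W \<phi>) = cinner (W' x) \<phi>"
          by (rule contraction_pair_adjoint[OF contraction_pair_swap[OF pair], symmetric])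
        also have "\<dots> = cinner (W' x - U x) \<phi>"
          by (simp add: cinner_diff_left cinner_M_N[OF U_in \<phi>])
        also have "cmod \<dots> \<le> norm (W' x - U x) * norm \<phi>" by (rule cinner_Cauchy_Schwarz)
        also have "\<dots> \<le> norm (D x) * norm \<phi>"
          by (intro mult_right_mono extension_adjoint[OF pair ext] norm_ge_zero)
        finally show ?thesis by (simp add: mult.commute)
      qed
      have "cmod (cinner x v) \<le> cmod (cinner x (W1 \<phi>)) + cmod (cinner x (W2 \<phi>))"
        unfolding v_def cinner_diff_right by (rule norm_triangle_ineq4)
      also have "\<dots> \<le> norm \<phi> * norm (D x) + norm \<phi> * norm (D x)" using *[OF W1] *[OF W2] by (rule add_mono)
      finally show "cmod (cinner x v) \<le> (2 * norm \<phi>) * norm (D x)" by simp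
    qed
    ultimately have "v = 0" using triv unfolding trivial_intersection_def by blast
    then show ?thesis by (simp add: v_def)
  qed
  show ?thesis
  proof
    fix x
    have "W1 (P x) = W2 (P x)" using W1 W2 P_in by (simp add: completion_def)
    moreover have "W1 (x - P x) = W2 (x - P x)" by (rule on_N[OF P_compl])
    ultimately have "W1 (P x + (x - P x)) = W2 (P x + (x - P x))"
      by (simp only: pairs[THEN contraction_pair_add])
    then show "W1 x = W2 x" by simp
  qed
qed

text \<open>A completion has the form \<open>V + D K\<close> where \<open>K\<close> annihilates \<open>M\<close>. The transpose condition
  prescribes the products of \<open>K x\<close> with \<open>D (C M)\<close>; choosing \<open>K x\<close> in the closure of
  \<open>D (C M)\<close> gives the smallest solution. It is a contraction since
  \<open>\<parallel>C V C s - U s\<parallel>\<^sup>2 = \<parallel>V C s\<parallel>\<^sup>2 - \<parallel>U s\<parallel>\<^sup>2 \<le> \<parallel>D s\<parallel>\<^sup>2\<close> for \<open>s\<close> in \<open>C M\<close>. Its adjoint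
  \<open>K'\<close> vanishes on everything orthogonal to \<open>D (C M)\<close>, which is the room exploited when the
  completion is not unique.\<close>

lemma minimal_completion:
  obtains W W' K K' where "completion W W'" and "contraction_pair K K'"
    and "\<And>x. W' x = U x + K' (D x)" and "\<And>y. K' y \<in> N"
    and "\<And>y. (\<And>s. s \<in> CM \<Longrightarrow> cinner (D s) y = 0) \<Longrightarrow> K' y = 0"
proof -
  define G where "G s = C (V (C s)) - U s" for s
  have CVC: "contraction_pair (\<lambda>x. C (V (C x))) (\<lambda>x. C (U (C x)))"
    by (rule contraction_pair_conjugate[OF C VU])
  note UV = contraction_pair_swap[OF VU]
  have G_clinear: "clinear_on UNIV G"
    unfolding clinear_on_def G_def
    by (simp add: contraction_pair_add[OF CVC] contraction_pair_add[OF UV]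
      contraction_pair_scaleC[OF CVC] contraction_pair_scaleC[OF UV] scaleC_diff_right)
  have G_N: "G s \<in> N" and G_norm: "norm (G s) \<le> norm (D s)" if s: "s \<in> CM" for s
  proof -
    have Cs: "C s \<in> M" using s conjugation_involutive[OF C] by auto
    have "cinner h (G s) = 0" if "h \<in> M" for h
      using symm[OF that Cs] conjugation_involutive[OF C, of s]
      by (simp add: G_def cinner_diff_right contraction_pair_adjoint[OF VU])
    then show G_N: "G s \<in> N" using cinner_eq_zero_commute[of "G s"] by (simp add: ortho_compl_def)
    have "(norm (C (V (C s))))\<^sup>2 = (norm (U s))\<^sup>2 + (norm (G s))\<^sup>2"
      using norm_M_N[OF U_in[of s] G_N] by (simp add: G_def)
    moreover have "(norm (C (V (C s))))\<^sup>2 \<le> (norm s)\<^sup>2"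
      using contraction_pair_norm[OF CVC] by (simp add: power_mono)
    ultimately have "(norm (G s))\<^sup>2 \<le> (norm (D s))\<^sup>2" by (simp add: norm_D)
    then show "norm (G s) \<le> norm (D s)" by (rule power2_le_imp_le) simp
  qed
  have G_bound: "cmod (cinner (G s) x) \<le> norm (x - P x) * norm (D s)" if s: "s \<in> CM" for s x
  proof -
    have "cinner (G s) x = cinner (G s) (x - P x)"
      by (simp add: cinner_diff_right cinner_N_M[OF P_in G_N[OF s]])
    also have "cmod \<dots> \<le> norm (G s) * norm (x - P x)" by (rule cinner_Cauchy_Schwarz)
    also have "\<dots> \<le> norm (D s) * norm (x - P x)" by (intro mult_right_mono G_norm s norm_ge_zero)
    finally show ?thesis by (simp add: mult.commute)
  qed
  have "\<exists>k. k \<in> closure (D ` CM) \<and> (\<forall>s\<in>CM. cinner (G s) x = cinner (D s) k)" for x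
  proof -
    have "clinear_on CM (\<lambda>s. cinner (G s) x)"
      using G_clinear by (simp add: clinear_on_def cinner_simps scaleC_complex_def)
    then obtain k where "k \<in> closure (D ` CM)" "\<And>s. s \<in> CM \<Longrightarrow> cinner (G s) x = cinner (D s) k"
      using G_bound by (rule Riesz_through_map[OF CM D_clinear]) auto
    then show ?thesis by blast
  qed
  then have "\<exists>K. \<forall>x. K x \<in> closure (D ` CM) \<and> (\<forall>s\<in>CM. cinner (G s) x = cinner (D s) (K x))"
    by (intro choice allI)
  then obtain K where *: "\<forall>x. K x \<in> closure (D ` CM) \<and> (\<forall>s\<in>CM. cinner (G s) x = cinner (D s) (K x))"
    by (rule exE)
  have K_in: "K x \<in> closure (D ` CM)" for x using * by blast
  have K: "cinner (D s) (K x) = cinner (G s) x" if "s \<in> CM" for x s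
    by (rule sym) (use * that in blast)
  have K_norm: "norm (K x) \<le> norm (x - P x)" for x
    by (rule Riesz_norm_le[OF K_in]) (simp_all add: K G_bound)
  have K_M: "K m = 0" if "m \<in> M" for m using K_norm[of m] P_id[OF that] by simp
  have K_clinear: "clinear_on UNIV K"
  proof -
    have "csubspace (closure (D ` CM))" by (rule csubspace_closure[OF csubspace_image[OF D_clinear CM]])
    note closure = csubspace_add[OF this K_in K_in] csubspace_scaleC[OF this K_in]
    show ?thesis
      unfolding clinear_on_def
      by (intro conjI ballI allI; rule Riesz_unique[OF CM D_clinear K_in])
         (simp_all add: closure K cinner_simps)
  qed
  have K_contr: "norm (K x) \<le> norm x" for x
  proof -
    have "norm (x - P x) \<le> norm x" by (rule power2_le_imp_le) (simp_all add: norm_P[of x])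
    then show ?thesis using K_norm[of x] by simp
  qed
  obtain K' where KK': "contraction_pair K K'"
    using contraction_pair_exists[OF K_clinear K_contr] by blast
  define W where "W x = V x + D (K x)" for x
  define W' where "W' x = U x + K' (D x)" for x
  have pair: "contraction_pair W W'"
    unfolding contraction_pair_def
  proof (intro conjI allI)
    show adjoint: "cinner (W x) y = cinner x (W' y)" for x y
      by (simp add: W_def W'_def cinner_simps D_adjoint contraction_pair_adjoint[OF VU]
        contraction_pair_adjoint[OF KK'])
    fix x
    \<comment> \<open>Cauchy-Schwarz in the plane with the vectors \<open>(\<parallel>P x\<parallel>, \<parallel>x - P x\<parallel>)\<close> and
      \<open>(\<parallel>U y\<parallel>, \<parallel>D y\<parallel>)\<close>, whose lengths are \<open>\<parallel>x\<parallel>\<close> and \<open>\<parallel>y\<parallel>\<close>.\<close>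
    have "cmod (cinner (W x) y) \<le> norm x * norm y" for y
    proof -
      have "cinner (W x) y = cinner (P x) (U y) + cinner (K x) (D y)"
        using cinner_N_M[OF U_in[of y] P_compl[of x]]
        by (simp add: W_def cinner_simps D_adjoint contraction_pair_adjoint[OF VU])
      then have "cmod (cinner (W x) y) \<le> cmod (cinner (P x) (U y)) + cmod (cinner (K x) (D y))"
        by (simp add: norm_triangle_ineq)
      also have "\<dots> \<le> norm (P x) * norm (U y) + norm (K x) * norm (D y)"
        by (intro add_mono cinner_Cauchy_Schwarz)
      also have "\<dots> \<le> norm (P x) * norm (U y) + norm (x - P x) * norm (D y)"
        by (intro add_left_mono mult_right_mono K_norm norm_ge_zero)
      also have "\<dots> \<le> norm (norm (P x), norm (x - P x)) * norm (norm (U y), norm (D y))"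
        using norm_cauchy_schwarz[of "(norm (P x), norm (x - P x))" "(norm (U y), norm (D y))"] by simp
      also have "\<dots> = norm x * norm y"
        by (simp add: norm_Pair norm_D norm_P[of x, symmetric])
      finally show ?thesis .
    qed
    from this[of "W x"] show "norm (W x) \<le> norm x" by (rule norm_le_if_cinner_le) simp
  qed
  have K'_N: "K' y \<in> N" for y
  proof -
    have "cinner m (K' y) = 0" if "m \<in> M" for m
      using contraction_pair_adjoint[OF KK', of m y] K_M[OF that] by simp
    then show ?thesis using cinner_eq_zero_commute[of "K' y"] by (simp add: ortho_compl_def)
  qed
  have K'D: "K' (D s) = G s" if s: "s \<in> CM" for s
  proof (rule eqI_cinner_right)
    fix x
    have "cinner x (K' (D s)) = cinner (K x) (D s)" by (simp add: contraction_pair_adjoint[OF KK'])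
    also have "\<dots> = cnj (cinner (G s) x)" by (simp add: cinner_commute[of "K x"] K[OF s])
    also have "\<dots> = cinner x (G s)" by (rule cinner_commute[symmetric])
    finally show "cinner x (K' (D s)) = cinner x (G s)" .
  qed
  show ?thesis
  proof (rule that)
    show "completion W W'"
      unfolding completion_def
    proof (intro conjI ballI pair)
      fix h assume h: "h \<in> M"
      show "W h = V h" using clinear_on_0[OF D_clinear csubspace_UNIV] by (simp add: W_def K_M[OF h])
      have "W' (C h) = C (V h)"
        using h by (simp add: W'_def K'D G_def conjugation_involutive[OF C])
      then show "C (W' (C h)) = V h" by (simp add: conjugation_involutive[OF C])
    qed
    show "K' y = 0" if "\<And>s. s \<in> CM \<Longrightarrow> cinner (D s) y = 0" for y
    proof (rule eq_zero_if_cinner_zero)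
      fix x
      have "cinner (K x) y = 0" by (rule cinner_closure_eq_zero[OF _ K_in]) (use that in auto)
      then show "cinner x (K' y) = 0" by (simp add: contraction_pair_adjoint[OF KK'])
    qed
  qed (use KK' K'_N in \<open>auto simp: W'_def\<close>)
qed

text \<open>Averaging a completion with its transpose makes it symmetric, and the defect of the adjoint
  shrinks at most by half.\<close>

lemma symmetrised_completion:
  assumes W: "completion W W'"
  obtains S S' where "completion S S'" and "\<And>x. C (S' (C x)) = S x"
    and "\<And>x. (norm x)\<^sup>2 - (norm (W' x))\<^sup>2 \<le> 2 * ((norm x)\<^sup>2 - (norm (S' x))\<^sup>2)"
proof -
  have pair: "contraction_pair W W'" using W by (simp add: completion_def)
  note pair' = contraction_pair_swap[OF pair]
  have tp: "contraction_pair (\<lambda>x. C (W' (C x))) (\<lambda>x. C (W (C x)))"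
    by (rule contraction_pair_conjugate[OF C pair'])
  define S where "S x = (1/2) *\<^sub>R (W x + C (W' (C x)))" for x
  define S' where "S' x = (1/2) *\<^sub>R (W' x + C (W (C x)))" for x
  have norm_half: "(norm ((1/2) *\<^sub>R (a + b)))\<^sup>2 \<le> ((norm a)\<^sup>2 + (norm b)\<^sup>2) / 2" for a b :: 'a
  proof -
    have "(norm ((1/2) *\<^sub>R (a + b)))\<^sup>2 = (norm (a + b))\<^sup>2 / 4"
      unfolding norm_scaleR by (simp add: power_mult_distrib power2_eq_square)
    moreover have "0 \<le> (norm (a - b))\<^sup>2" by simp
    ultimately show ?thesis unfolding norm_add_squared norm_diff_squared by argo
  qed
  have half_C: "C ((1/2) *\<^sub>R x) = (1/2) *\<^sub>R C x" for x
    unfolding scaleR_scaleC conjugation_scaleC[OF C] by simp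
  have S_pair: "contraction_pair S S'"
    unfolding contraction_pair_def
  proof (intro conjI allI)
    show "cinner (S x) y = cinner x (S' y)" for x y
      by (simp add: S_def S'_def cinner_simps contraction_pair_adjoint[OF pair]
        contraction_pair_adjoint[OF tp])
    fix x
    have "(norm (S x))\<^sup>2 \<le> ((norm (W x))\<^sup>2 + (norm (C (W' (C x))))\<^sup>2) / 2"
      unfolding S_def by (rule norm_half)
    also have "\<dots> \<le> ((norm x)\<^sup>2 + (norm x)\<^sup>2) / 2"
      by (intro divide_right_mono add_mono power_mono contraction_pair_norm[OF pair]
        contraction_pair_norm[OF tp] norm_ge_zero) simp
    finally have "(norm (S x))\<^sup>2 \<le> (norm x)\<^sup>2" by simp
    then show "norm (S x) \<le> norm x" by (rule power2_le_imp_le) simp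
  qed
  have symmetric: "C (S' (C x)) = S x" for x
    by (simp add: S_def S'_def half_C conjugation_add[OF C] conjugation_involutive[OF C] add.commute)
  show ?thesis
  proof (rule that)
    have "S h = V h" if "h \<in> M" for h
      using W that scaleR_half_double[of "V h"] by (simp only: S_def completion_def)
    then show "completion S S'" using S_pair symmetric by (simp add: completion_def)
    show "C (S' (C x)) = S x" for x by (rule symmetric)
    fix x
    have "(norm (S' x))\<^sup>2 \<le> ((norm (W' x))\<^sup>2 + (norm (C (W (C x))))\<^sup>2) / 2"
      unfolding S'_def by (rule norm_half)
    also have "\<dots> \<le> ((norm (W' x))\<^sup>2 + (norm x)\<^sup>2) / 2"
      by (intro divide_right_mono add_mono power_mono order_refl norm_ge_zero
        contraction_pair_norm[OF contraction_pair_swap[OF tp]]) simp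
    finally show "(norm x)\<^sup>2 - (norm (W' x))\<^sup>2 \<le> 2 * ((norm x)\<^sup>2 - (norm (S' x))\<^sup>2)" by simp
  qed
qed

lemma symmetric_completion_exists:
  obtains S S' where "completion S S'" and "\<And>x. C (S' (C x)) = S x"
proof -
  obtain W W' K K' where "completion W W'" by (rule minimal_completion)
  then show ?thesis by (rule symmetrised_completion) (rule that)
qed

text \<open>If \<open>C \<phi> = D y\<close> with \<open>\<phi>\<close> in \<open>N\<close>, then \<open>y\<close> is orthogonal to \<open>D (C M)\<close>, so the operator
  \<open>K'\<close> of the minimal completion ignores the component of \<open>D x\<close> along \<open>y\<close>. The defect of
  \<open>W'\<close> therefore dominates \<open>(D x, y) = (x, C \<phi>)\<close>, and a rank-one perturbation along
  \<open>C \<phi>\<close>, invisible on \<open>M\<close>, produces a second symmetric completion.\<close>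

lemma two_symmetric_completions:
  assumes "\<not> trivial_intersection"
  obtains S1 S1' S2 S2' where "completion S1 S1'" "\<And>x. C (S1' (C x)) = S1 x"
    and "completion S2 S2'" "\<And>x. C (S2' (C x)) = S2 x" and "S1 \<noteq> S2"
proof -
  obtain y where y: "D y \<in> CN" "D y \<noteq> 0" using assms trivial_intersection_iff by blast
  define e where "e = D y"
  have Ce: "C e \<in> N" using y(1) conjugation_involutive[OF C] by (auto simp: e_def)
  obtain W W' K K' where W: "completion W W'" and K: "contraction_pair K K'"
    and W': "\<And>x. W' x = U x + K' (D x)" and K'_N: "\<And>x. K' x \<in> N"
    and K'_zero: "\<And>x. (\<And>s. s \<in> CM \<Longrightarrow> cinner (D s) x = 0) \<Longrightarrow> K' x = 0"
    using minimal_completion by blast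
  note K' = contraction_pair_swap[OF K]
  have K'y: "K' y = 0" by (rule K'_zero) (simp add: D_adjoint cinner_CM_CN[OF _ y(1)])
  have "y \<noteq> 0" using y(2) clinear_on_0[OF D_clinear csubspace_UNIV] by auto
  have dominated: "(cmod (cinner x e))\<^sup>2 \<le> (norm y)\<^sup>2 * ((norm x)\<^sup>2 - (norm (W' x))\<^sup>2)" for x
  proof -
    define a where "a = cinner (D x) y / of_real ((norm y)\<^sup>2)"
    define r where "r = D x - a *\<^sub>C y"
    have orth: "cinner (a *\<^sub>C y) r = 0"
    proof -
      have "cinner r y = 0" using \<open>y \<noteq> 0\<close> by (simp add: r_def a_def cinner_simps cinner_self)
      then show ?thesis using cinner_eq_zero_commute[of r y] by simp
    qed
    have Dx: "D x = a *\<^sub>C y + r" by (simp add: r_def)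
    have "K' (D x) = K' r"
      unfolding Dx by (simp add: contraction_pair_add[OF K'] contraction_pair_scaleC[OF K'] K'y)
    then have "(norm (K' (D x)))\<^sup>2 \<le> (norm r)\<^sup>2"
      using contraction_pair_norm[OF K'] by (simp add: power_mono)
    moreover have "(norm (D x))\<^sup>2 = (norm (a *\<^sub>C y))\<^sup>2 + (norm r)\<^sup>2"
      by (subst Dx) (rule norm_add_squared_orthogonal[OF orth])
    moreover have "(norm (W' x))\<^sup>2 = (norm (U x))\<^sup>2 + (norm (K' (D x)))\<^sup>2"
      unfolding W' by (rule norm_M_N[OF U_in K'_N])
    ultimately have "(norm (a *\<^sub>C y))\<^sup>2 \<le> (norm x)\<^sup>2 - (norm (W' x))\<^sup>2"
      using norm_D[of x] by linarith
    then have "(norm y)\<^sup>2 * (norm (a *\<^sub>C y))\<^sup>2 \<le> (norm y)\<^sup>2 * ((norm x)\<^sup>2 - (norm (W' x))\<^sup>2)"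
      by (intro mult_left_mono) auto
    moreover have "(cmod (cinner x e))\<^sup>2 = (norm y)\<^sup>2 * (norm (a *\<^sub>C y))\<^sup>2"
    proof -
      have "cinner x e = a * of_real ((norm y)\<^sup>2)"
        using \<open>y \<noteq> 0\<close> by (simp add: a_def e_def D_adjoint)
      then show ?thesis by (simp add: norm_mult power_mult_distrib norm_power)
    qed
    ultimately show ?thesis by simp
  qed
  obtain S S' where S: "completion S S'" and symmetric: "\<And>x. C (S' (C x)) = S x"
    and defect: "\<And>x. (norm x)\<^sup>2 - (norm (W' x))\<^sup>2 \<le> 2 * ((norm x)\<^sup>2 - (norm (S' x))\<^sup>2)"
    using symmetrised_completion[OF W] by blast
  have pair: "contraction_pair S S'" using S by (simp add: completion_def)
  have dominated_S: "(cmod (cinner x e))\<^sup>2 \<le> 2 * (norm y)\<^sup>2 * ((norm x)\<^sup>2 - (norm (S' x))\<^sup>2)" for x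
  proof -
    note dominated[of x]
    also have "(norm y)\<^sup>2 * ((norm x)\<^sup>2 - (norm (W' x))\<^sup>2)
        \<le> (norm y)\<^sup>2 * (2 * ((norm x)\<^sup>2 - (norm (S' x))\<^sup>2))"
      by (intro mult_left_mono defect) simp
    finally show ?thesis by (simp only: mult.assoc mult.left_commute)
  qed
  define R where "R t x = S x + (of_real t * cinner x (C e)) *\<^sub>C e" for t :: real and x
  define R' where "R' t x = S' x + (of_real t * cinner x e) *\<^sub>C C e" for t :: real and x
  have "0 \<le> 2 * (norm y)\<^sup>2" by simp
  from rank_one_perturbation[OF C pair symmetric dominated_S this]
  obtain t :: real where t: "0 < t" and R_pair: "contraction_pair (R t) (R' t)"
    unfolding R_def[abs_def] R'_def[abs_def] by blast
  have R_symmetric: "C (R' t (C x)) = R t x" for x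
    using cinner_conjugation_left[OF C, of x e] cinner_commute[of "C e" x]
    by (simp add: R_def R'_def conjugation_add[OF C] conjugation_scaleC[OF C]
      conjugation_involutive[OF C] symmetric)
  have R_M: "R t h = V h" if "h \<in> M" for h
    using S that cinner_M_N[OF that Ce] by (simp add: R_def completion_def)
  have R: "completion (R t) (R' t)"
    using R_pair R_M R_symmetric by (simp add: completion_def)
  have "S \<noteq> R t"
  proof
    assume "S = R t"
    then have "S (C e) = R t (C e)" by simp
    then have "norm ((of_real t * cinner (C e) (C e)) *\<^sub>C e) = 0" by (simp add: R_def)
    then show False
      using t y(2) by (simp add: cinner_self e_def conjugation_eq_0_iff[OF C])
  qed
  with S symmetric R R_symmetric show ?thesis by (rule that)
qed

end

section \<open>Operators through their graphs\<close>

lemma operator_eqI: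
  assumes "\<And>f g. A f = Some g \<longleftrightarrow> B f = Some g"
  shows "A = (B :: 'a operator)"
proof
  fix f
  show "A f = B f"
  proof (cases "A f")
    case None
    then show ?thesis using assms[of f "app B f"] by (cases "B f") simp_all
  next
    case (Some g)
    then show ?thesis using assms[of f g] by simp
  qed
qed

lemma Some_The_eq_iff:
  assumes unique: "\<And>g g'. R g \<Longrightarrow> R g' \<Longrightarrow> g = g'"
  shows "(if \<exists>g. R g then Some (THE g. R g) else None) = Some g \<longleftrightarrow> R g"
proof (cases "\<exists>g. R g")
  case True
  then obtain k where k: "R k" by blast
  have "(THE g. R g) = k" by (rule the_equality[of R k, OF k]) (rule unique[OF _ k])
  moreover have "R g \<longleftrightarrow> k = g" using k by (auto intro: unique[OF k])
  ultimately show ?thesis using True by simp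
qed auto

lemma operator_le_iff: "A \<subseteq>\<^sub>m B \<longleftrightarrow> (\<forall>f g. A f = Some g \<longrightarrow> B f = Some g)"
proof
  show "\<forall>f g. A f = Some g \<longrightarrow> B f = Some g" if "A \<subseteq>\<^sub>m B"
    using that by (metis domI map_le_def)
  show "A \<subseteq>\<^sub>m B" if "\<forall>f g. A f = Some g \<longrightarrow> B f = Some g"
    using that by (metis domD map_le_def)
qed

lemma linear_op_iff:
  "linear_op A \<longleftrightarrow> A 0 = Some 0 \<and>
    (\<forall>f g f' g'. A f = Some g \<longrightarrow> A f' = Some g' \<longrightarrow> A (f + f') = Some (g + g')) \<and>
    (\<forall>c f g. A f = Some g \<longrightarrow> A (c *\<^sub>C f) = Some (c *\<^sub>C g))"
proof
  assume A: "linear_op A"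
  have zero: "0 \<in> dom A" using A by (simp add: linear_op_def csubspace_def)
  have add: "f + f' \<in> dom A" "app A (f + f') = app A f + app A f'"
    if "f \<in> dom A" "f' \<in> dom A" for f f'
    using A that by (simp_all add: linear_op_def csubspace_def)
  have scale: "c *\<^sub>C f \<in> dom A" "app A (c *\<^sub>C f) = c *\<^sub>C app A f" if "f \<in> dom A" for c f
    using A that by (simp_all add: linear_op_def csubspace_def)
  have Some_app: "A f = Some (app A f)" if "f \<in> dom A" for f using domD[OF that] by force
  have zero': "A 0 = Some 0" using Some_app[OF zero] scale(2)[OF zero, of 0] by simp
  have add': "A (f + f') = Some (g + g')" if "A f = Some g" "A f' = Some g'" for f g f' g'
    using Some_app[OF add(1)[OF domI domI, OF that]] add(2)[OF domI domI, OF that] by (simp add: that)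
  have scale': "A (c *\<^sub>C f) = Some (c *\<^sub>C g)" if "A f = Some g" for c f g
    using Some_app[OF scale(1)[OF domI, OF that, of c]] scale(2)[OF domI, OF that, of c] by (simp add: that)
  show "A 0 = Some 0 \<and>
    (\<forall>f g f' g'. A f = Some g \<longrightarrow> A f' = Some g' \<longrightarrow> A (f + f') = Some (g + g')) \<and>
    (\<forall>c f g. A f = Some g \<longrightarrow> A (c *\<^sub>C f) = Some (c *\<^sub>C g))"
    using zero' add' scale' by simp
next
  assume A: "A 0 = Some 0 \<and>
    (\<forall>f g f' g'. A f = Some g \<longrightarrow> A f' = Some g' \<longrightarrow> A (f + f') = Some (g + g')) \<and>
    (\<forall>c f g. A f = Some g \<longrightarrow> A (c *\<^sub>C f) = Some (c *\<^sub>C g))"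
  show "linear_op A"
    unfolding linear_op_def csubspace_def
  proof (intro conjI ballI allI)
    show "0 \<in> dom A" using conjunct1[OF A] by (rule domI)
    fix f f' assume "f \<in> dom A" "f' \<in> dom A"
    then obtain g g' where g: "A f = Some g" "A f' = Some g'" by blast
    then have "A (f + f') = Some (g + g')" by (rule conjunct1[OF conjunct2[OF A], rule_format])
    then show "f + f' \<in> dom A" "app A (f + f') = app A f + app A f'" using g by auto
  next
    fix c f assume "f \<in> dom A"
    then obtain g where g: "A f = Some g" by blast
    then have "A (c *\<^sub>C f) = Some (c *\<^sub>C g)" by (rule conjunct2[OF conjunct2[OF A], rule_format])
    then show "c *\<^sub>C f \<in> dom A" "app A (c *\<^sub>C f) = c *\<^sub>C app A f" using g by auto
  qed
qed

lemma
  assumes "linear_op A"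
  shows linear_op_0: "A 0 = Some 0"
    and linear_op_add: "A f = Some g \<Longrightarrow> A f' = Some g' \<Longrightarrow> A (f + f') = Some (g + g')"
    and linear_op_scaleC: "A f = Some g \<Longrightarrow> A (c *\<^sub>C f) = Some (c *\<^sub>C g)"
proof -
  note A = assms[unfolded linear_op_iff]
  show "A 0 = Some 0" using A by (rule conjunct1)
  show "A f = Some g \<Longrightarrow> A f' = Some g' \<Longrightarrow> A (f + f') = Some (g + g')"
    by (rule conjunct1[OF conjunct2[OF A], rule_format])
  show "A f = Some g \<Longrightarrow> A (c *\<^sub>C f) = Some (c *\<^sub>C g)"
    by (rule conjunct2[OF conjunct2[OF A], rule_format])
qed

lemma linear_op_diff:
  assumes A: "linear_op A" and "A f = Some g" and "A f' = Some g'"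
  shows "A (f - f') = Some (g - g')"
  using linear_op_add[OF A assms(2) linear_op_scaleC[OF A assms(3), of "-1"]] by (simp add: scaleC_one)

lemma dissipative_iff:
  "dissipative A \<longleftrightarrow> linear_op A \<and> (\<forall>f g. A f = Some g \<longrightarrow> 0 \<le> Im (cinner g f))"
  by (auto simp: dissipative_def dom_def)

lemma shift_op_eq_Some: "shift_op A z f = Some k \<longleftrightarrow> (\<exists>g. A f = Some g \<and> k = g - z *\<^sub>C f)"
  by (auto simp: shift_op_def)

lemma neg_op_eq_Some: "neg_op A f = Some g \<longleftrightarrow> A f = Some (- g)"
  by (auto simp: neg_op_def)

lemma conj_op_eq_Some:
  assumes "conjugation C"
  shows "conj_op C A f = Some g \<longleftrightarrow> A (C f) = Some (C g)"
  using conjugation_involutive[OF assms] by (auto simp: conj_op_def)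

lemma conj_op_le_iff:
  assumes C: "conjugation C"
  shows "conj_op C A \<subseteq>\<^sub>m B \<longleftrightarrow> A \<subseteq>\<^sub>m conj_op C B"
  unfolding operator_le_iff conj_op_eq_Some[OF C]
proof (intro iffI allI impI)
  fix f g assume "\<forall>f g. A (C f) = Some (C g) \<longrightarrow> B f = Some g" and "A f = Some g"
  then show "B (C f) = Some (C g)" using conjugation_involutive[OF C] by simp
next
  fix f g assume "\<forall>f g. A f = Some g \<longrightarrow> B (C f) = Some (C g)" and "A (C f) = Some (C g)"
  then have "B (C (C f)) = Some (C (C g))" by blast
  then show "B f = Some g" by (simp only: conjugation_involutive[OF C])
qed

lemma inv_op_eq_Some:
  assumes "\<And>f f' h. A f = Some h \<Longrightarrow> A f' = Some h \<Longrightarrow> f = f'"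
  shows "inv_op A h = Some f \<longleftrightarrow> A f = Some h"
proof -
  have "h \<in> ran A \<longleftrightarrow> (\<exists>f. A f = Some h)" by (simp add: ran_def)
  then show ?thesis unfolding inv_op_def by (simp only: Some_The_eq_iff[of "\<lambda>f. A f = Some h", OF assms])
qed

lemma eq_zero_if_orthogonal_to_dense:
  assumes "closure S = UNIV" and "\<And>s. s \<in> S \<Longrightarrow> cinner s y = 0"
  shows "y = (0::'a::complex_inner)"
  using cinner_closure_eq_zero[of S y y] assms by simp

lemma dense_if_orthogonal_trivial:
  fixes S :: "'a::complex_hilbert_space set"
  assumes S: "csubspace S" and "\<And>y. (\<And>s. s \<in> S \<Longrightarrow> cinner s y = 0) \<Longrightarrow> y = 0"
  shows "closure S = UNIV"
proof -
  have "p \<in> closure S" for p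
  proof -
    obtain q where q: "q \<in> closure S" "\<And>s. s \<in> S \<Longrightarrow> cinner s (p - q) = 0"
      using orthogonal_projection[OF S] by blast
    have "p - q = 0" by (rule assms(2)) (rule q(2))
    then show ?thesis using q(1) by simp
  qed
  then show ?thesis by blast
qed

lemma adjoint_from_eq_Some:
  assumes K: "csubspace K" and dense: "K \<subseteq> closure (dom A)"
  shows "adjoint_from K A y = Some h \<longleftrightarrow>
    h \<in> K \<and> (\<forall>f g. A f = Some g \<longrightarrow> cinner g y = cinner f h)"
proof -
  define Q where "Q k \<longleftrightarrow> k \<in> K \<and> (\<forall>f\<in>dom A. cinner (app A f) y = cinner f k)" for k
  have eq: "adjoint_from K A y = (if \<exists>k. Q k then Some (THE k. Q k) else None)"
    unfolding adjoint_from_def Q_def Bex_def by simp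
  have unique: "k = k'" if "Q k" "Q k'" for k k'
  proof -
    have "k - k' \<in> closure (dom A)" using that dense csubspace_diff[OF K] by (auto simp: Q_def)
    moreover have "cinner f (k - k') = 0" if "f \<in> dom A" for f
      using \<open>Q k\<close> \<open>Q k'\<close> that by (simp add: Q_def cinner_diff_right)
    ultimately have "cinner (k - k') (k - k') = 0" by (rule cinner_closure_eq_zero[rotated])
    then show ?thesis by simp
  qed
  have "adjoint_from K A y = Some h \<longleftrightarrow> Q h" unfolding eq by (rule Some_The_eq_iff[OF unique])
  also have "Q h \<longleftrightarrow> h \<in> K \<and> (\<forall>f g. A f = Some g \<longrightarrow> cinner g y = cinner f h)"
    by (auto simp: Q_def dom_def)
  finally show ?thesis .
qed

lemma adj_eq_Some:
  assumes "densely_defined A"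
  shows "adj A y = Some h \<longleftrightarrow> (\<forall>f g. A f = Some g \<longrightarrow> cinner g y = cinner f h)"
  using adjoint_from_eq_Some[OF csubspace_UNIV, of A y h] assms by (simp add: densely_defined_def)


section \<open>Dissipative operators and contractions\<close>

lemma diff_cnj_eq: "z - cnj z = complex_of_real (2 * Im z) * \<i>"
  by (simp add: complex_eq_iff)

text \<open>Dissipativity of \<open>f \<mapsto> g\<close> is contractivity of \<open>g - cnj z f \<mapsto> g - z f\<close>.\<close>

lemma dissipation_identity:
  "(norm (g - cnj z *\<^sub>C f))\<^sup>2 - (norm (g - z *\<^sub>C f))\<^sup>2 = 4 * Im z * Im (cinner g f)"
  by (simp add: norm_diff_squared algebra_simps)

lemma dissipative_norm_le:
  assumes "dissipative A" and "0 < Im z" and "A f = Some g"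
  shows "norm (g - z *\<^sub>C f) \<le> norm (g - cnj z *\<^sub>C f)" and "Im z * norm f \<le> norm (g - cnj z *\<^sub>C f)"
proof -
  have "0 \<le> Im (cinner g f)" using assms by (simp add: dissipative_iff)
  then have "0 \<le> 4 * Im z * Im (cinner g f)" using assms(2) by simp
  then have "(norm (g - z *\<^sub>C f))\<^sup>2 \<le> (norm (g - cnj z *\<^sub>C f))\<^sup>2"
    using dissipation_identity[of g z f] by linarith
  then show le: "norm (g - z *\<^sub>C f) \<le> norm (g - cnj z *\<^sub>C f)" by (rule power2_le_imp_le) simp
  have "(g - cnj z *\<^sub>C f) - (g - z *\<^sub>C f) = (z - cnj z) *\<^sub>C f" by (simp add: scaleC_diff_left)
  then have "norm ((z - cnj z) *\<^sub>C f) \<le> norm (g - cnj z *\<^sub>C f) + norm (g - z *\<^sub>C f)"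
    using norm_triangle_ineq4[of "g - cnj z *\<^sub>C f" "g - z *\<^sub>C f"] by simp
  moreover have "norm ((z - cnj z) *\<^sub>C f) = 2 * (Im z * norm f)"
    using assms(2) by (simp add: diff_cnj_eq norm_mult)
  ultimately show "Im z * norm f \<le> norm (g - cnj z *\<^sub>C f)" using le by linarith
qed

lemma ran_space_iff: "h \<in> ran_space A z \<longleftrightarrow> (\<exists>f g. A f = Some g \<and> h = g - cnj z *\<^sub>C f)"
  by (auto simp: ran_space_def ran_def shift_op_eq_Some)

lemma csubspace_ran_space:
  assumes A: "linear_op A"
  shows "csubspace (ran_space A z)"
  unfolding csubspace_def
proof (intro conjI ballI allI)
  show "0 \<in> ran_space A z"
    unfolding ran_space_iff using linear_op_0[OF A] by (intro exI[of _ 0]) simp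
next
  fix x y assume "x \<in> ran_space A z" "y \<in> ran_space A z"
  then obtain f g f' g' where f: "A f = Some g" "x = g - cnj z *\<^sub>C f"
    and f': "A f' = Some g'" "y = g' - cnj z *\<^sub>C f'"
    unfolding ran_space_iff by blast
  have "x + y = (g + g') - cnj z *\<^sub>C (f + f')" by (simp add: f f' scaleC_simps)
  then show "x + y \<in> ran_space A z"
    unfolding ran_space_iff using linear_op_add[OF A f(1) f'(1)] by blast
next
  fix c x assume "x \<in> ran_space A z"
  then obtain f g where f: "A f = Some g" "x = g - cnj z *\<^sub>C f" unfolding ran_space_iff by blast
  have "c *\<^sub>C x = c *\<^sub>C g - cnj z *\<^sub>C (c *\<^sub>C f)" by (simp add: f scaleC_simps mult.commute)
  then show "c *\<^sub>C x \<in> ran_space A z"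
    unfolding ran_space_iff using linear_op_scaleC[OF A f(1)] by blast
qed

text \<open>By the lower bound for \<open>A - cnj z\<close>, convergence in the range forces convergence in the graph.\<close>

lemma closed_ran_space:
  fixes A :: "'a::complex_hilbert_space operator"
  assumes A: "dissipative A" "closed_op A" and z: "0 < Im z"
  shows "closed (ran_space A z)"
  unfolding closed_sequential_limits
proof (intro allI impI, elim conjE)
  fix h :: "nat \<Rightarrow> 'a" and l
  assume "\<forall>n. h n \<in> ran_space A z" and lim: "h \<longlonglongrightarrow> l"
  then have "\<forall>n. \<exists>p. A (fst p) = Some (snd p) \<and> h n = snd p - cnj z *\<^sub>C fst p"
    by (force simp: ran_space_iff)
  then have "\<exists>p. \<forall>n. A (fst (p n)) = Some (snd (p n)) \<and> h n = snd (p n) - cnj z *\<^sub>C fst (p n)"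
    by (rule choice)
  then obtain p where p: "\<And>n. A (fst (p n)) = Some (snd (p n))"
    and h: "\<And>n. h n = snd (p n) - cnj z *\<^sub>C fst (p n)" by blast
  have lin: "linear_op A" using A(1) by (simp add: dissipative_def)
  have bound: "Im z * norm (fst (p m) - fst (p n)) \<le> norm (h m - h n)" for m n
    using dissipative_norm_le(2)[OF A(1) z linear_op_diff[OF lin p p], of m n]
    by (simp add: h scaleC_diff_right algebra_simps)
  have "Cauchy (\<lambda>n. fst (p n))"
  proof (rule metric_CauchyI)
    fix e :: real assume e: "0 < e"
    have "Cauchy h" using lim by (intro convergent_Cauchy) (auto simp: convergent_def)
    then obtain N where N: "\<And>m n. m \<ge> N \<Longrightarrow> n \<ge> N \<Longrightarrow> dist (h m) (h n) < e * Im z"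
      using metric_CauchyD[of h "e * Im z"] e z by auto
    show "\<exists>N. \<forall>m\<ge>N. \<forall>n\<ge>N. dist (fst (p m)) (fst (p n)) < e"
    proof (intro exI allI impI)
      fix m n assume "N \<le> m" "N \<le> n"
      then have "norm (h m - h n) < e * Im z" using N by (simp add: dist_norm)
      then have "Im z * norm (fst (p m) - fst (p n)) < Im z * e"
        using bound[of m n] by (simp add: mult.commute)
      then show "dist (fst (p m)) (fst (p n)) < e" using z by (simp add: dist_norm)
    qed
  qed
  then obtain f where f: "(\<lambda>n. fst (p n)) \<longlonglongrightarrow> f" using Cauchy_convergent convergent_def by blast
  have "(\<lambda>n. cnj z *\<^sub>C fst (p n)) \<longlonglongrightarrow> cnj z *\<^sub>C f"
    by (rule bounded_linear.tendsto[OF bounded_linear_scaleC f])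
  then have "(\<lambda>n. h n + cnj z *\<^sub>C fst (p n)) \<longlonglongrightarrow> l + cnj z *\<^sub>C f" by (intro tendsto_add lim)
  then have g: "(\<lambda>n. snd (p n)) \<longlonglongrightarrow> l + cnj z *\<^sub>C f" by (simp add: h)
  have "(f, l + cnj z *\<^sub>C f) \<in> Map.graph A"
  proof (rule closed_sequentially)
    show "closed (Map.graph A)" using A(2) by (simp only: closed_op_def)
    show "(fst (p n), snd (p n)) \<in> Map.graph A" for n by (rule in_graphI) (rule p)
    show "(\<lambda>n. (fst (p n), snd (p n))) \<longlonglongrightarrow> (f, l + cnj z *\<^sub>C f)" by (rule tendsto_Pair[OF f g])
  qed
  then have "A f = Some (l + cnj z *\<^sub>C f)" by (rule in_graphD)
  then show "l \<in> ran_space A z" unfolding ran_space_iff by force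
qed

text \<open>The graph of the Cayley transform is the image of the graph of \<open>A\<close>. Dissipativity makes it a
  contraction, which is continued by \<open>0\<close> to the orthogonal complement of its domain.\<close>

lemma cayley_contraction:
  fixes A :: "'a::complex_hilbert_space operator"
  assumes A: "dissipative A" and z: "0 < Im z"
  obtains W W' where "contraction_pair W W'"
    and "\<And>f g. A f = Some g \<Longrightarrow> W (g - cnj z *\<^sub>C f) = g - z *\<^sub>C f"
    and "\<And>y. W' y \<in> closure (ran_space A z)"
proof -
  have lin: "linear_op A" using A by (simp add: dissipative_def)
  have inj: "f = f' \<and> g = g'" if "A f = Some g" "A f' = Some g'" "g - cnj z *\<^sub>C f = g' - cnj z *\<^sub>C f'"
    for f g f' g'
  proof -
    have "Im z * norm (f - f') \<le> norm (g - g' - cnj z *\<^sub>C (f - f'))"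
      by (rule dissipative_norm_le(2)[OF A z linear_op_diff[OF lin that(1,2)]])
    also have "g - g' - cnj z *\<^sub>C (f - f') = 0" using that(3) by (simp add: scaleC_diff_right algebra_simps)
    finally have "f = f'" using z by (simp add: mult_le_0_iff)
    then show ?thesis using that by simp
  qed
  define V where "V h = (THE k. \<exists>f g. A f = Some g \<and> h = g - cnj z *\<^sub>C f \<and> k = g - z *\<^sub>C f)" for h
  have V: "V (g - cnj z *\<^sub>C f) = g - z *\<^sub>C f" if "A f = Some g" for f g
    unfolding V_def using that inj by (intro the_equality) blast+
  have clin: "clinear_on (ran_space A z) V"
    unfolding clinear_on_def
  proof (intro conjI ballI allI)
    fix x y assume "x \<in> ran_space A z" "y \<in> ran_space A z"
    then obtain f g f' g' where f: "A f = Some g" "x = g - cnj z *\<^sub>C f"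
      and f': "A f' = Some g'" "y = g' - cnj z *\<^sub>C f'"
      unfolding ran_space_iff by blast
    have eq: "x + y = (g + g') - cnj z *\<^sub>C (f + f')" by (simp add: f f' scaleC_simps)
    have "V (x + y) = (g + g') - z *\<^sub>C (f + f')"
      unfolding eq by (rule V[OF linear_op_add[OF lin f(1) f'(1)]])
    also have "\<dots> = V x + V y" unfolding f(2) f'(2) V[OF f(1)] V[OF f'(1)] by (simp add: scaleC_simps)
    finally show "V (x + y) = V x + V y" .
  next
    fix c x assume "x \<in> ran_space A z"
    then obtain f g where f: "A f = Some g" "x = g - cnj z *\<^sub>C f" unfolding ran_space_iff by blast
    have eq: "c *\<^sub>C x = c *\<^sub>C g - cnj z *\<^sub>C (c *\<^sub>C f)" by (simp add: f scaleC_simps mult.commute)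
    have "V (c *\<^sub>C x) = c *\<^sub>C g - z *\<^sub>C (c *\<^sub>C f)"
      unfolding eq by (rule V[OF linear_op_scaleC[OF lin f(1)]])
    also have "\<dots> = c *\<^sub>C V x" unfolding f(2) V[OF f(1)] by (simp add: scaleC_simps mult.commute)
    finally show "V (c *\<^sub>C x) = c *\<^sub>C V x" .
  qed
  have norm: "norm (V h) \<le> norm h" if "h \<in> ran_space A z" for h
    using that dissipative_norm_le(1)[OF A z] V unfolding ran_space_iff by force
  show ?thesis
  proof (rule contraction_pair_extending[OF csubspace_ran_space[OF lin] clin norm])
    fix W W' assume W: "contraction_pair W W'" and ext: "\<And>h. h \<in> ran_space A z \<Longrightarrow> W h = V h"
      and W': "\<And>y. W' y \<in> closure (ran_space A z)"
    have "W (g - cnj z *\<^sub>C f) = g - z *\<^sub>C f" if "A f = Some g" for f g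
      using ext[of "g - cnj z *\<^sub>C f"] V[OF that] that unfolding ran_space_iff by auto
    with W show thesis using W' by (rule that)
  qed
qed

subsection \<open>The inverse Cayley transform\<close>

text \<open>Without fixed points \<open>I - W\<close> is injective, so that the inverse Cayley transform is an operator and
  not merely a relation.\<close>
definition regular_pair :: "('a::complex_inner \<Rightarrow> 'a) \<Rightarrow> ('a \<Rightarrow> 'a) \<Rightarrow> bool"
  where "regular_pair W W' \<longleftrightarrow> contraction_pair W W' \<and> (\<forall>x. W x = x \<longrightarrow> x = 0)"

text \<open>If \<open>W x = x\<close>, then \<open>\<parallel>W' x - x\<parallel>\<^sup>2 = \<parallel>W' x\<parallel>\<^sup>2 - \<parallel>x\<parallel>\<^sup>2 \<le> 0\<close>.\<close>

lemma contraction_pair_fixed_point: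
  assumes W: "contraction_pair W W'" and x: "W x = x"
  shows "W' x = x"
proof -
  have "(norm (W' x - x))\<^sup>2 = (norm (W' x))\<^sup>2 + (norm x)\<^sup>2 - 2 * Re (cinner (W' x) x)"
    by (rule norm_diff_squared)
  also have "cinner (W' x) x = cinner x x"
    using contraction_pair_adjoint[OF contraction_pair_swap[OF W], of x x] x by simp
  also have "(norm (W' x))\<^sup>2 \<le> (norm x)\<^sup>2"
    using contraction_pair_norm[OF contraction_pair_swap[OF W]] by (simp add: power_mono)
  finally have "(norm (W' x - x))\<^sup>2 \<le> 0" by (simp add: cinner_self)
  then show ?thesis by simp
qed

lemma regular_pair_swap: "regular_pair W W' \<Longrightarrow> regular_pair W' W"
  unfolding regular_pair_def
  using contraction_pair_swap contraction_pair_fixed_point by blast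

lemma regular_pair_conjugate:
  assumes C: "conjugation C" and W: "regular_pair W W'"
  shows "regular_pair (\<lambda>x. C (W (C x))) (\<lambda>x. C (W' (C x)))"
  unfolding regular_pair_def
proof (intro conjI allI impI)
  show "contraction_pair (\<lambda>x. C (W (C x))) (\<lambda>x. C (W' (C x)))"
    using W by (intro contraction_pair_conjugate[OF C]) (simp add: regular_pair_def)
  fix x assume "C (W (C x)) = x"
  then have "W (C x) = C x" using conjugation_involutive[OF C, of "W (C x)"] by simp
  then have "C x = 0" using W unfolding regular_pair_def by blast
  then show "x = 0" by (simp add: conjugation_eq_0_iff[OF C])
qed

text \<open>The operator with Cayley transform \<open>W\<close> at \<open>z\<close>: for \<open>f = h - W h\<close> and its value \<open>g\<close> the vectors
  \<open>g - cnj z f\<close> and \<open>g - z f\<close> are \<open>(z - cnj z) h\<close> and \<open>(z - cnj z) W h\<close>.\<close>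
definition inv_cayley :: "complex \<Rightarrow> ('a::complex_inner \<Rightarrow> 'a) \<Rightarrow> 'a operator"
  where "inv_cayley z W = (\<lambda>f. if \<exists>h. f = h - W h
    then Some (THE g. \<exists>h. f = h - W h \<and> g = z *\<^sub>C h - cnj z *\<^sub>C W h) else None)"

lemma inv_cayley_eq_Some:
  assumes W: "regular_pair W W'"
  shows "inv_cayley z W f = Some g \<longleftrightarrow> (\<exists>h. f = h - W h \<and> g = z *\<^sub>C h - cnj z *\<^sub>C W h)"
proof -
  have pair: "contraction_pair W W'" using W by (simp add: regular_pair_def)
  have inj: "h = h'" if "h - W h = h' - W h'" for h h'
  proof -
    have "W (h - h') = h - h'"
      using that unfolding contraction_pair_diff[OF pair]
      by (simp add: diff_eq_eq algebra_simps)
    then have "h - h' = 0" using W unfolding regular_pair_def by blast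
    then show ?thesis by simp
  qed
  have unique: "g = g'"
    if g: "\<exists>h. f = h - W h \<and> g = z *\<^sub>C h - cnj z *\<^sub>C W h"
      and g': "\<exists>h. f = h - W h \<and> g' = z *\<^sub>C h - cnj z *\<^sub>C W h" for g g'
  proof -
    obtain h where h: "f = h - W h" "g = z *\<^sub>C h - cnj z *\<^sub>C W h" using g by blast
    obtain h' where h': "f = h' - W h'" "g' = z *\<^sub>C h' - cnj z *\<^sub>C W h'" using g' by blast
    have "h = h'" by (rule inj) (simp only: h(1)[symmetric] h'(1)[symmetric])
    then show ?thesis by (simp only: h(2) h'(2))
  qed
  have "(\<exists>h. f = h - W h) \<longleftrightarrow> (\<exists>g h. f = h - W h \<and> g = z *\<^sub>C h - cnj z *\<^sub>C W h)" by blast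
  then show ?thesis
    unfolding inv_cayley_def
    by (simp only: Some_The_eq_iff[of "\<lambda>g. \<exists>h. f = h - W h \<and> g = z *\<^sub>C h - cnj z *\<^sub>C W h", OF unique])
qed

lemma inv_cayley_shift:
  assumes "f = h - w" and "g = z *\<^sub>C h - cnj z *\<^sub>C (w::'a::complex_inner)"
  shows "g - cnj z *\<^sub>C f = (z - cnj z) *\<^sub>C h" and "g - z *\<^sub>C f = (z - cnj z) *\<^sub>C w"
  by (simp_all add: assms scaleC_diff_left scaleC_diff_right)

lemma inv_cayley_linear:
  assumes W: "regular_pair W W'"
  shows "linear_op (inv_cayley z W)"
proof -
  have pair: "contraction_pair W W'" using W by (simp add: regular_pair_def)
  show ?thesis
    unfolding linear_op_iff inv_cayley_eq_Some[OF W]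
  proof (intro conjI allI impI)
    have "W 0 = 0" using contraction_pair_diff[OF pair, of 0 0] by simp
    then show "\<exists>h. 0 = h - W h \<and> 0 = z *\<^sub>C h - cnj z *\<^sub>C W h" by (intro exI[of _ 0]) simp
  next
    fix f g f' g'
    assume "\<exists>h. f = h - W h \<and> g = z *\<^sub>C h - cnj z *\<^sub>C W h"
      and "\<exists>h. f' = h - W h \<and> g' = z *\<^sub>C h - cnj z *\<^sub>C W h"
    then obtain h h' where h: "f = h - W h" "g = z *\<^sub>C h - cnj z *\<^sub>C W h"
      and h': "f' = h' - W h'" "g' = z *\<^sub>C h' - cnj z *\<^sub>C W h'" by blast
    show "\<exists>h. f + f' = h - W h \<and> g + g' = z *\<^sub>C h - cnj z *\<^sub>C W h"
      by (rule exI[of _ "h + h'"]) (simp add: h h' contraction_pair_add[OF pair] scaleC_simps)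
  next
    fix c f g
    assume "\<exists>h. f = h - W h \<and> g = z *\<^sub>C h - cnj z *\<^sub>C W h"
    then obtain h where h: "f = h - W h" "g = z *\<^sub>C h - cnj z *\<^sub>C W h" by blast
    show "\<exists>h. c *\<^sub>C f = h - W h \<and> c *\<^sub>C g = z *\<^sub>C h - cnj z *\<^sub>C W h"
      by (rule exI[of _ "c *\<^sub>C h"])
        (simp add: h contraction_pair_scaleC[OF pair] scaleC_simps mult.commute)
  qed
qed

lemma inv_cayley_dense:
  fixes W :: "'a::complex_hilbert_space \<Rightarrow> 'a"
  assumes W: "regular_pair W W'"
  shows "densely_defined (inv_cayley z W)"
  unfolding densely_defined_def
proof (rule dense_if_orthogonal_trivial)
  show "csubspace (dom (inv_cayley z W))" using inv_cayley_linear[OF W] by (simp add: linear_op_def)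
  fix y assume y: "\<And>s. s \<in> dom (inv_cayley z W) \<Longrightarrow> cinner s y = 0"
  have pair: "contraction_pair W W'" using W by (simp add: regular_pair_def)
  have "cinner h (W' y) = cinner h y" for h
  proof -
    have "h - W h \<in> dom (inv_cayley z W)" unfolding inv_cayley_def by (simp add: dom_def) blast
    from y[OF this] show ?thesis by (simp add: cinner_diff_left contraction_pair_adjoint[OF pair])
  qed
  then have "W' y = y" by (rule eqI_cinner_right)
  then show "y = 0" using regular_pair_swap[OF W] unfolding regular_pair_def by blast
qed

lemma diff_cnj_neq_0: "0 < Im z \<Longrightarrow> z - cnj z \<noteq> 0"
  by (simp add: complex_eq_iff)

text \<open>The range of \<open>inv_cayley z W - cnj z\<close> is already the whole space, and \<open>B - cnj z\<close> is injective for
  every dissipative extension \<open>B\<close>, so that no such extension is proper.\<close>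

lemma inv_cayley_max_dissipative:
  assumes W: "regular_pair W W'" and z: "0 < Im z"
  shows "max_dissipative (inv_cayley z W)"
proof -
  have pair: "contraction_pair W W'" using W by (simp add: regular_pair_def)
  note Z = diff_cnj_neq_0[OF z]
  show ?thesis
    unfolding max_dissipative_def
  proof (intro conjI allI impI)
    show "dissipative (inv_cayley z W)"
      unfolding dissipative_iff
    proof (intro conjI allI impI inv_cayley_linear[OF W])
      fix f g assume "inv_cayley z W f = Some g"
      then obtain h where h: "f = h - W h" "g = z *\<^sub>C h - cnj z *\<^sub>C W h"
        unfolding inv_cayley_eq_Some[OF W] by blast
      have "norm (g - z *\<^sub>C f) \<le> norm (g - cnj z *\<^sub>C f)"
        unfolding inv_cayley_shift[OF h] norm_scaleC
        by (intro mult_left_mono contraction_pair_norm[OF pair]) simp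
      then have "0 \<le> 4 * Im z * Im (cinner g f)"
        unfolding dissipation_identity[symmetric] by (simp add: power_mono)
      then show "0 \<le> Im (cinner g f)" using z by (simp add: zero_le_mult_iff)
    qed
    fix B assume "dissipative B \<and> inv_cayley z W \<subseteq>\<^sub>m B"
    then have B: "dissipative B" and ext: "\<And>f g. inv_cayley z W f = Some g \<Longrightarrow> B f = Some g"
      by (auto simp: operator_le_iff)
    have lin: "linear_op B" using B by (simp add: dissipative_def)
    have "inv_cayley z W f = Some g" if "B f = Some g" for f g
    proof -
      define h where "h = (1 / (z - cnj z)) *\<^sub>C (g - cnj z *\<^sub>C f)"
      define f' where "f' = h - W h"
      define g' where "g' = z *\<^sub>C h - cnj z *\<^sub>C W h"
      have inv: "inv_cayley z W f' = Some g'"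
        unfolding inv_cayley_eq_Some[OF W] f'_def g'_def by blast
      have "g' - cnj z *\<^sub>C f' = (z - cnj z) *\<^sub>C h" by (rule inv_cayley_shift(1)[OF f'_def g'_def])
      also have "\<dots> = g - cnj z *\<^sub>C f" using Z by (simp add: h_def scaleC_scaleC scaleC_one)
      finally have eq: "(g - g') - cnj z *\<^sub>C (f - f') = 0" by (simp add: scaleC_diff_right algebra_simps)
      have "Im z * norm (f - f') \<le> norm ((g - g') - cnj z *\<^sub>C (f - f'))"
        by (rule dissipative_norm_le(2)[OF B z linear_op_diff[OF lin that ext[OF inv]]])
      then have "f = f'" using z by (simp add: eq mult_le_0_iff)
      then show ?thesis using inv ext[OF inv] that by simp
    qed
    then show "B = inv_cayley z W" using ext by (intro operator_eqI) blast
  qed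
qed

lemma le_inv_cayley_iff:
  assumes W: "regular_pair W W'" and z: "0 < Im z"
  shows "A \<subseteq>\<^sub>m inv_cayley z W \<longleftrightarrow> (\<forall>f g. A f = Some g \<longrightarrow> W (g - cnj z *\<^sub>C f) = g - z *\<^sub>C f)"
proof -
  have pair: "contraction_pair W W'" using W by (simp add: regular_pair_def)
  note Z = diff_cnj_neq_0[OF z]
  have "inv_cayley z W f = Some g \<longleftrightarrow> W (g - cnj z *\<^sub>C f) = g - z *\<^sub>C f" for f g
  proof
    assume "inv_cayley z W f = Some g"
    then obtain h where h: "f = h - W h" "g = z *\<^sub>C h - cnj z *\<^sub>C W h"
      unfolding inv_cayley_eq_Some[OF W] by blast
    show "W (g - cnj z *\<^sub>C f) = g - z *\<^sub>C f"
      unfolding inv_cayley_shift[OF h] by (rule contraction_pair_scaleC[OF pair])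
  next
    assume eq: "W (g - cnj z *\<^sub>C f) = g - z *\<^sub>C f"
    define h where "h = (1 / (z - cnj z)) *\<^sub>C (g - cnj z *\<^sub>C f)"
    have Wh: "W h = (1 / (z - cnj z)) *\<^sub>C (g - z *\<^sub>C f)"
      unfolding h_def contraction_pair_scaleC[OF pair] eq ..
    have "h - W h = (1 / (z - cnj z)) *\<^sub>C ((z - cnj z) *\<^sub>C f)"
      unfolding Wh unfolding h_def by (simp add: scaleC_diff_left flip: scaleC_diff_right)
    moreover have "z *\<^sub>C h - cnj z *\<^sub>C W h = (1 / (z - cnj z)) *\<^sub>C ((z - cnj z) *\<^sub>C g)"
      unfolding Wh unfolding h_def scaleC_diff_left scaleC_diff_right
      by (simp add: scaleC_scaleC mult.commute mult.left_commute)
    ultimately show "inv_cayley z W f = Some g"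
      unfolding inv_cayley_eq_Some[OF W] using Z
      by (intro exI[of _ h]) (simp add: scaleC_scaleC scaleC_one)
  qed
  then show ?thesis by (simp add: operator_le_iff)
qed

lemma inv_cayley_inject:
  assumes W: "regular_pair W W'" and W2: "regular_pair W2 W2'" and z: "0 < Im z"
    and eq: "inv_cayley z W = inv_cayley z W2"
  shows "W = W2"
proof
  fix h
  have pair: "contraction_pair W2 W2'" using W2 by (simp add: regular_pair_def)
  define f where "f = h - W h"
  define g where "g = z *\<^sub>C h - cnj z *\<^sub>C W h"
  have "inv_cayley z W2 f = Some g"
    unfolding eq[symmetric] inv_cayley_eq_Some[OF W] f_def g_def by blast
  moreover have "inv_cayley z W2 \<subseteq>\<^sub>m inv_cayley z W2" by simp
  ultimately have "W2 (g - cnj z *\<^sub>C f) = g - z *\<^sub>C f"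
    unfolding le_inv_cayley_iff[OF W2 z] by blast
  then have "(z - cnj z) *\<^sub>C W2 h = (z - cnj z) *\<^sub>C W h"
    unfolding inv_cayley_shift[OF f_def g_def] contraction_pair_scaleC[OF pair] .
  then have "(1 / (z - cnj z)) *\<^sub>C (z - cnj z) *\<^sub>C W2 h = (1 / (z - cnj z)) *\<^sub>C (z - cnj z) *\<^sub>C W h"
    by simp
  then show "W h = W2 h" using diff_cnj_neq_0[OF z] by (simp add: scaleC_scaleC scaleC_one)
qed

text \<open>A fixed point of a contraction is fixed by the adjoint, hence orthogonal to the range of \<open>I - W\<close>,
  which contains the domain of \<open>A\<close>.\<close>

lemma regular_pair_if_extends_dense:
  assumes W: "contraction_pair W W'" and z: "0 < Im z" and A: "densely_defined A"
    and ext: "\<And>f g. A f = Some g \<Longrightarrow> W (g - cnj z *\<^sub>C f) = g - z *\<^sub>C f"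
  shows "regular_pair W W'"
  unfolding regular_pair_def
proof (intro conjI allI impI W)
  fix x assume x: "W x = x"
  show "x = 0"
  proof (rule eq_zero_if_orthogonal_to_dense)
    show "closure (dom A) = UNIV" using A by (simp add: densely_defined_def)
    fix f assume "f \<in> dom A"
    then obtain g where g: "A f = Some g" by blast
    define h where "h = g - cnj z *\<^sub>C f"
    have "W' x = x" by (rule contraction_pair_fixed_point[OF W x])
    then have "cinner (h - W h) x = 0" by (simp add: cinner_diff_left contraction_pair_adjoint[OF W])
    moreover have "h - W h = (z - cnj z) *\<^sub>C f"
      unfolding h_def ext[OF g] by (simp add: scaleC_diff_left)
    ultimately show "cinner f x = 0" using diff_cnj_neq_0[OF z] by simp
  qed
qed

text \<open>The Cayley transform of \<open>B\<close>, continued by \<open>0\<close>, is the Cayley transform of a dissipative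
  extension of \<open>B\<close>, and maximality makes this extension equal to \<open>B\<close>.\<close>

lemma max_dissipative_inv_cayley:
  fixes B :: "'a::complex_hilbert_space operator"
  assumes B: "max_dissipative B" "densely_defined B" and z: "0 < Im z"
  obtains W W' where "regular_pair W W'" and "B = inv_cayley z W"
proof (rule cayley_contraction[OF _ z])
  show diss: "dissipative B" using B(1) by (simp add: max_dissipative_def)
  fix W W' assume W: "contraction_pair W W'"
    and ext: "\<And>f g. B f = Some g \<Longrightarrow> W (g - cnj z *\<^sub>C f) = g - z *\<^sub>C f"
  have regular: "regular_pair W W'" by (rule regular_pair_if_extends_dense[OF W z B(2) ext])
  then have "B \<subseteq>\<^sub>m inv_cayley z W" using ext by (simp add: le_inv_cayley_iff[OF _ z])
  moreover have "dissipative (inv_cayley z W)"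
    using inv_cayley_max_dissipative[OF regular z] by (simp add: max_dissipative_def)
  ultimately have "B = inv_cayley z W" using B(1) unfolding max_dissipative_def by blast
  with regular show thesis by (rule that)
qed

text \<open>The adjoint relation for \<open>inv_cayley z W\<close> amounts to \<open>W' (h - z g) = h - cnj z g\<close>, so \<open>h - z g\<close> is a
  multiple of the parameter \<open>u\<close> of the adjoint.\<close>

lemma adj_inv_cayley:
  fixes W :: "'a::complex_hilbert_space \<Rightarrow> 'a"
  assumes W: "regular_pair W W'" and z: "0 < Im z"
  shows "adj (inv_cayley z W) = inv_cayley (cnj z) W'"
proof (rule operator_eqI)
  fix g h
  have pair: "contraction_pair W W'" using W by (simp add: regular_pair_def)
  note pair' = contraction_pair_swap[OF pair]
  note Z = diff_cnj_neq_0[OF z]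
  have "adj (inv_cayley z W) g = Some h \<longleftrightarrow>
      (\<forall>k. cinner (z *\<^sub>C k - cnj z *\<^sub>C W k) g = cinner (k - W k) h)"
    unfolding adj_eq_Some[OF inv_cayley_dense[OF W]] inv_cayley_eq_Some[OF W] by blast
  also have "\<dots> \<longleftrightarrow> (\<forall>k. cinner k (cnj z *\<^sub>C g - z *\<^sub>C W' g) = cinner k (h - W' h))"
    by (simp add: cinner_diff_left cinner_diff_right contraction_pair_adjoint[OF pair])
  also have "\<dots> \<longleftrightarrow> cnj z *\<^sub>C g - z *\<^sub>C W' g = h - W' h"
    using eqI_cinner_right[of "cnj z *\<^sub>C g - z *\<^sub>C W' g" "h - W' h"] by auto
  also have "\<dots> \<longleftrightarrow> (\<exists>u. g = u - W' u \<and> h = cnj z *\<^sub>C u - z *\<^sub>C W' u)"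
  proof
    assume "cnj z *\<^sub>C g - z *\<^sub>C W' g = h - W' h"
    then have eq: "W' (h - z *\<^sub>C g) = h - cnj z *\<^sub>C g"
      by (simp add: contraction_pair_diff[OF pair'] contraction_pair_scaleC[OF pair'] algebra_simps)
    \<comment> \<open>The factor is forced by \<open>g = u - W' u\<close>, since \<open>(h - z g) - W' (h - z g) = (cnj z - z) g\<close>.\<close>
    define c where "c = - 1 / (z - cnj z)"
    have c: "c * (cnj z - z) = 1" using Z by (simp add: c_def field_simps)
    define u where "u = c *\<^sub>C (h - z *\<^sub>C g)"
    have W'u: "W' u = c *\<^sub>C (h - cnj z *\<^sub>C g)"
      unfolding u_def contraction_pair_scaleC[OF pair'] eq ..
    have "u - W' u = c *\<^sub>C ((cnj z - z) *\<^sub>C g)"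
      unfolding W'u unfolding u_def by (simp add: scaleC_diff_left flip: scaleC_diff_right)
    moreover have "cnj z *\<^sub>C u - z *\<^sub>C W' u = c *\<^sub>C ((cnj z - z) *\<^sub>C h)"
      unfolding W'u unfolding u_def scaleC_diff_left scaleC_diff_right
      by (simp add: scaleC_scaleC mult.commute mult.left_commute)
    ultimately show "\<exists>u. g = u - W' u \<and> h = cnj z *\<^sub>C u - z *\<^sub>C W' u"
      by (intro exI[of _ u]) (simp add: scaleC_scaleC c scaleC_one)
  next
    assume "\<exists>u. g = u - W' u \<and> h = cnj z *\<^sub>C u - z *\<^sub>C W' u"
    then obtain u where u: "g = u - W' u" "h = cnj z *\<^sub>C u - z *\<^sub>C W' u" by blast
    show "cnj z *\<^sub>C g - z *\<^sub>C W' g = h - W' h"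
      by (simp add: u contraction_pair_diff[OF pair'] contraction_pair_scaleC[OF pair']
        scaleC_diff_right algebra_simps)
  qed
  also have "\<dots> \<longleftrightarrow> inv_cayley (cnj z) W' g = Some h"
    unfolding inv_cayley_eq_Some[OF regular_pair_swap[OF W]] by simp
  finally show "adj (inv_cayley z W) g = Some h \<longleftrightarrow> inv_cayley (cnj z) W' g = Some h" .
qed

lemma neg_inv_cayley:
  assumes W: "regular_pair W W'"
  shows "neg_op (inv_cayley z W) = inv_cayley (- z) W"
proof (rule operator_eqI)
  fix f g
  have "- g = z *\<^sub>C h - cnj z *\<^sub>C W h \<longleftrightarrow> g = (- z) *\<^sub>C h - cnj (- z) *\<^sub>C W h" for h
    by (auto simp: algebra_simps minus_equation_iff)
  then show "neg_op (inv_cayley z W) f = Some g \<longleftrightarrow> inv_cayley (- z) W f = Some g"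
    unfolding neg_op_eq_Some inv_cayley_eq_Some[OF W] by simp
qed

lemma conj_inv_cayley:
  assumes C: "conjugation C" and W: "regular_pair W W'"
  shows "conj_op C (inv_cayley z W) = inv_cayley (cnj z) (\<lambda>x. C (W (C x)))"
proof (rule operator_eqI)
  fix f g
  note invol = conjugation_involutive[OF C]
  have flip: "C x = y \<longleftrightarrow> x = C y" for x y using invol[of x] invol[of y] by auto
  have "(\<exists>h. C f = h - W h \<and> C g = z *\<^sub>C h - cnj z *\<^sub>C W h) \<longleftrightarrow>
      (\<exists>h. f = h - C (W (C h)) \<and> g = cnj z *\<^sub>C h - z *\<^sub>C C (W (C h)))" (is "?L \<longleftrightarrow> ?R")
  proof
    assume ?L
    then obtain h where h: "C f = h - W h" "C g = z *\<^sub>C h - cnj z *\<^sub>C W h" by blast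
    then show ?R
      unfolding flip by (intro exI[of _ "C h"]) (simp add: conjugation_diff[OF C] conjugation_scaleC[OF C] invol)
  next
    assume ?R
    then obtain h where h: "f = h - C (W (C h))" "g = cnj z *\<^sub>C h - z *\<^sub>C C (W (C h))" by blast
    then show ?L
      by (intro exI[of _ "C h"]) (simp add: conjugation_diff[OF C] conjugation_scaleC[OF C] invol)
  qed
  then show "conj_op C (inv_cayley z W) f = Some g \<longleftrightarrow> inv_cayley (cnj z) (\<lambda>x. C (W (C x))) f = Some g"
    unfolding conj_op_eq_Some[OF C] inv_cayley_eq_Some[OF W]
      inv_cayley_eq_Some[OF regular_pair_conjugate[OF C W]] by simp
qed

section \<open>Suprema and infima of quotients and distances\<close>

lemma INF_norm_diff_squared_eq_0_iff:
  fixes L :: "'b \<Rightarrow> 'a::real_normed_vector"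
  assumes S: "S \<noteq> {}" and c: "0 < c"
  shows "(INF s\<in>S. c * (norm (a - L s))\<^sup>2) = 0 \<longleftrightarrow> a \<in> closure (L ` S)"
proof -
  have bdd: "bdd_below ((\<lambda>s. c * (norm (a - L s))\<^sup>2) ` S)"
    using c by (intro bdd_belowI2[of _ 0]) simp
  have nonneg: "0 \<le> (INF s\<in>S. c * (norm (a - L s))\<^sup>2)"
    using c by (intro cINF_greatest S) simp
  show ?thesis
    unfolding closure_approachable
  proof
    assume zero: "(INF s\<in>S. c * (norm (a - L s))\<^sup>2) = 0"
    show "\<forall>e>0. \<exists>y\<in>L ` S. dist y a < e"
    proof (intro allI impI)
      fix e :: real assume "0 < e"
      then have "(INF s\<in>S. c * (norm (a - L s))\<^sup>2) < c * e\<^sup>2" using c zero by simp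
      then obtain s where s: "s \<in> S" "c * (norm (a - L s))\<^sup>2 < c * e\<^sup>2"
        unfolding cINF_less_iff[OF S bdd] by blast
      then have "(norm (a - L s))\<^sup>2 < e\<^sup>2" using c by simp
      then have "norm (a - L s) < e" using \<open>0 < e\<close> by (simp add: power2_less_imp_less)
      then show "\<exists>y\<in>L ` S. dist y a < e" using s(1) by (auto simp: dist_norm norm_minus_commute)
    qed
  next
    assume approx: "\<forall>e>0. \<exists>y\<in>L ` S. dist y a < e"
    have "(INF s\<in>S. c * (norm (a - L s))\<^sup>2) \<le> 0"
    proof (rule field_le_epsilon)
      fix e :: real assume e: "0 < e"
      then have "0 < sqrt (e / c)" using c by simp
      then obtain s where s: "s \<in> S" "dist (L s) a < sqrt (e / c)" using approx by blast
      have "(norm (a - L s))\<^sup>2 \<le> (sqrt (e / c))\<^sup>2"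
        using s(2) by (intro power_mono) (simp_all add: dist_norm norm_minus_commute)
      then have "c * (norm (a - L s))\<^sup>2 \<le> e" using e c by (simp add: field_simps)
      then show "(INF s\<in>S. c * (norm (a - L s))\<^sup>2) \<le> 0 + e"
        using cINF_lower[OF bdd s(1)] by simp
    qed
    with nonneg show "(INF s\<in>S. c * (norm (a - L s))\<^sup>2) = 0" by simp
  qed
qed

text \<open>With \<open>0 / 0 = 0\<close> and \<open>a / 0 = \<infinity>\<close>, a real number \<open>c \<ge> 0\<close> bounds the quotient \<open>p / q\<close> if and only if
  \<open>p \<le> c q\<close>, also for \<open>q = 0\<close>.\<close>

lemma SUP_ennreal_quotient_eq_top_iff:
  fixes p q :: "'b \<Rightarrow> real"
  assumes p: "\<And>i. i \<in> I \<Longrightarrow> 0 \<le> p i" and q: "\<And>i. i \<in> I \<Longrightarrow> 0 \<le> q i"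
  shows "(SUP i\<in>I. ennreal (p i) / ennreal (q i)) = \<infinity> \<longleftrightarrow> (\<nexists>c. \<forall>i\<in>I. p i \<le> c * q i)"
proof -
  have le_iff: "ennreal (p i) / ennreal (q i) \<le> ennreal c \<longleftrightarrow> p i \<le> c * q i"
    if i: "i \<in> I" and c: "0 \<le> c" for i c
  proof (cases "q i = 0")
    case True
    then show ?thesis
      using p[OF i] by (cases "p i = 0") (simp_all add: ennreal_divide_zero top_unique)
  next
    case False
    then have "0 < q i" using q[OF i] by simp
    then show ?thesis using p[OF i] c by (simp add: divide_ennreal pos_divide_le_eq)
  qed
  have "(SUP i\<in>I. ennreal (p i) / ennreal (q i)) < \<infinity> \<longleftrightarrow> (\<exists>c. \<forall>i\<in>I. p i \<le> c * q i)"
  proof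
    assume "(SUP i\<in>I. ennreal (p i) / ennreal (q i)) < \<infinity>"
    then obtain c where c: "0 \<le> c" "(SUP i\<in>I. ennreal (p i) / ennreal (q i)) = ennreal c"
      by (cases "(SUP i\<in>I. ennreal (p i) / ennreal (q i))") auto
    have "p i \<le> c * q i" if i: "i \<in> I" for i
      using SUP_upper[OF i, of "\<lambda>i. ennreal (p i) / ennreal (q i)"] unfolding c(2) le_iff[OF i c(1)] .
    then show "\<exists>c. \<forall>i\<in>I. p i \<le> c * q i" by blast
  next
    assume "\<exists>c. \<forall>i\<in>I. p i \<le> c * q i"
    then obtain c where c: "\<And>i. i \<in> I \<Longrightarrow> p i \<le> c * q i" by blast
    have "(SUP i\<in>I. ennreal (p i) / ennreal (q i)) \<le> ennreal \<bar>c\<bar>"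
    proof (rule SUP_least)
      fix i assume i: "i \<in> I"
      have "p i \<le> \<bar>c\<bar> * q i"
        using c[OF i] mult_right_mono[OF abs_ge_self q[OF i], of c] by simp
      then show "ennreal (p i) / ennreal (q i) \<le> ennreal \<bar>c\<bar>" by (simp add: le_iff[OF i])
    qed
    also have "\<dots> < \<infinity>" by simp
    finally show "(SUP i\<in>I. ennreal (p i) / ennreal (q i)) < \<infinity>" .
  qed
  then show ?thesis by (metis infinity_ennreal_def less_top)
qed


section \<open>The conditions at a point\<close>

text \<open>The abstract completion problem for the Cayley transform \<open>V\<close> of \<open>T\<close>, continued by \<open>0\<close>, and its
  adjoint \<open>U\<close>. Here the defect operator of the Cayley transform is the abstract \<open>D\<close>.\<close>
locale cayley_setting = symmetric_partial_contraction C "ran_space T z" V U "defect_op T z"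
  for C :: "'a::complex_hilbert_space \<Rightarrow> 'a" and T z V U +
  assumes T_linear: "linear_op T" and T_dense: "densely_defined T" and z: "0 < Im z"
    and V_cayley: "\<And>f g. T f = Some g \<Longrightarrow> V (g - cnj z *\<^sub>C f) = g - z *\<^sub>C f"
begin

abbreviation M :: "'a set" where "M \<equiv> ran_space T z"

lemma N_eq: "N = defect_space T z"
  by (simp add: defect_space_def)

lemma le_inv_cayley_iff_extends:
  assumes "regular_pair W W'"
  shows "T \<subseteq>\<^sub>m inv_cayley z W \<longleftrightarrow> (\<forall>h\<in>M. W h = V h)"
  unfolding le_inv_cayley_iff[OF assms z]
proof (intro iffI allI impI ballI)
  fix h assume "\<forall>f g. T f = Some g \<longrightarrow> W (g - cnj z *\<^sub>C f) = g - z *\<^sub>C f" and "h \<in> M"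
  then show "W h = V h" using V_cayley by (auto simp: ran_space_iff)
next
  fix f g assume ext: "\<forall>h\<in>M. W h = V h" and T: "T f = Some g"
  have "g - cnj z *\<^sub>C f \<in> M" unfolding ran_space_iff using T by blast
  then show "W (g - cnj z *\<^sub>C f) = g - z *\<^sub>C f" using ext V_cayley[OF T] by simp
qed

lemma extension_regular:
  assumes "contraction_pair W W'" and "\<And>h. h \<in> M \<Longrightarrow> W h = V h"
  shows "regular_pair W W'"
proof (rule regular_pair_if_extends_dense[OF assms(1) z T_dense])
  fix f g assume "T f = Some g"
  then show "W (g - cnj z *\<^sub>C f) = g - z *\<^sub>C f"
    using assms(2)[of "g - cnj z *\<^sub>C f"] V_cayley by (auto simp: ran_space_iff)
qed

lemma regular: "regular_pair V U"
  by (rule extension_regular[OF VU]) simp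

subsection \<open>Extensions of the operator and completions of its Cayley transform\<close>

lemma max_dissipative_extension_iff:
  "max_dissipative B \<and> T \<subseteq>\<^sub>m B \<longleftrightarrow>
    (\<exists>W W'. regular_pair W W' \<and> (\<forall>h\<in>M. W h = V h) \<and> B = inv_cayley z W)"
proof
  assume B: "max_dissipative B \<and> T \<subseteq>\<^sub>m B"
  have "dom T \<subseteq> dom B" using B by (auto dest: map_le_implies_dom_le)
  then have "densely_defined B"
    using T_dense closure_mono unfolding densely_defined_def by blast
  with B obtain W W' where W: "regular_pair W W'" "B = inv_cayley z W"
    using max_dissipative_inv_cayley[OF _ _ z] by blast
  then show "\<exists>W W'. regular_pair W W' \<and> (\<forall>h\<in>M. W h = V h) \<and> B = inv_cayley z W"
    using B le_inv_cayley_iff_extends[OF W(1)] by blast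
next
  assume "\<exists>W W'. regular_pair W W' \<and> (\<forall>h\<in>M. W h = V h) \<and> B = inv_cayley z W"
  then show "max_dissipative B \<and> T \<subseteq>\<^sub>m B"
    using le_inv_cayley_iff_extends inv_cayley_max_dissipative[OF _ z] by blast
qed

lemma conj_adj_inv_cayley:
  assumes W: "regular_pair W W'"
  shows "conj_op C (adj (inv_cayley z W)) = inv_cayley z (\<lambda>x. C (W' (C x)))"
  unfolding adj_inv_cayley[OF W z] conj_inv_cayley[OF C regular_pair_swap[OF W]] by simp

lemma C_selfadjoint_inv_cayley_iff:
  assumes W: "regular_pair W W'"
  shows "C_selfadjoint C (inv_cayley z W) \<longleftrightarrow> (\<forall>x. C (W' (C x)) = W x)"
proof -
  note tp = regular_pair_conjugate[OF C regular_pair_swap[OF W]]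
  have "C_selfadjoint C (inv_cayley z W) \<longleftrightarrow> inv_cayley z W = inv_cayley z (\<lambda>x. C (W' (C x)))"
    unfolding C_selfadjoint_def conj_adj_inv_cayley[OF W]
    using inv_cayley_linear[OF W] inv_cayley_dense[OF W] by blast
  also have "\<dots> \<longleftrightarrow> W = (\<lambda>x. C (W' (C x)))"
    using inv_cayley_inject[OF W tp z] by auto
  finally show ?thesis by (auto simp: fun_eq_iff)
qed

lemma conj_le_adj_inv_cayley_iff:
  assumes W: "regular_pair W W'"
  shows "conj_op C T \<subseteq>\<^sub>m adj (inv_cayley z W) \<longleftrightarrow> (\<forall>h\<in>M. C (W' (C h)) = V h)"
  unfolding conj_op_le_iff[OF C] conj_adj_inv_cayley[OF W]
  by (rule le_inv_cayley_iff_extends[OF regular_pair_conjugate[OF C regular_pair_swap[OF W]]])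

lemma max_antidissipative_adj_inv_cayley:
  fixes W :: "'a \<Rightarrow> 'a"
  assumes W: "regular_pair W W'"
  shows "max_antidissipative (adj (inv_cayley z W))"
  unfolding max_antidissipative_def adj_inv_cayley[OF W z] neg_inv_cayley[OF regular_pair_swap[OF W]]
  by (rule inv_cayley_max_dissipative[OF regular_pair_swap[OF W]]) (simp add: z)

lemma C_selfadjoint_extension_iff:
  "C_selfadjoint C B \<and> max_dissipative B \<and> T \<subseteq>\<^sub>m B \<longleftrightarrow>
    (\<exists>W W'. completion W W' \<and> (\<forall>x. C (W' (C x)) = W x) \<and> B = inv_cayley z W)"
proof
  assume B: "C_selfadjoint C B \<and> max_dissipative B \<and> T \<subseteq>\<^sub>m B"
  then obtain W W' where W: "regular_pair W W'" "\<forall>h\<in>M. W h = V h" "B = inv_cayley z W"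
    using max_dissipative_extension_iff[of B] by blast
  have "\<forall>x. C (W' (C x)) = W x" using B C_selfadjoint_inv_cayley_iff[OF W(1)] W(3) by simp
  moreover from this have "completion W W'"
    using W by (simp add: completion_def regular_pair_def)
  ultimately show "\<exists>W W'. completion W W' \<and> (\<forall>x. C (W' (C x)) = W x) \<and> B = inv_cayley z W"
    using W(3) by blast
next
  assume "\<exists>W W'. completion W W' \<and> (\<forall>x. C (W' (C x)) = W x) \<and> B = inv_cayley z W"
  then obtain W W' where W: "completion W W'" "\<forall>x. C (W' (C x)) = W x" "B = inv_cayley z W" by blast
  have ext: "\<forall>h\<in>M. W h = V h" and pair: "contraction_pair W W'"
    using W(1) by (simp_all add: completion_def)
  have reg: "regular_pair W W'" by (rule extension_regular[OF pair]) (use ext in blast)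
  have "max_dissipative B \<and> T \<subseteq>\<^sub>m B" using max_dissipative_extension_iff[of B] reg ext W(3) by blast
  moreover have "C_selfadjoint C B" using C_selfadjoint_inv_cayley_iff[OF reg] W(2,3) by simp
  ultimately show "C_selfadjoint C B \<and> max_dissipative B \<and> T \<subseteq>\<^sub>m B" by simp
qed

lemma doubly_extending_iff:
  "max_dissipative B \<and> T \<subseteq>\<^sub>m B \<and> max_antidissipative (adj B) \<and> conj_op C T \<subseteq>\<^sub>m adj B \<longleftrightarrow>
    (\<exists>W W'. completion W W' \<and> B = inv_cayley z W)"
proof
  assume B: "max_dissipative B \<and> T \<subseteq>\<^sub>m B \<and> max_antidissipative (adj B) \<and> conj_op C T \<subseteq>\<^sub>m adj B"
  then obtain W W' where W: "regular_pair W W'" "\<forall>h\<in>M. W h = V h" "B = inv_cayley z W"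
    using max_dissipative_extension_iff[of B] by blast
  have "\<forall>h\<in>M. C (W' (C h)) = V h" using B conj_le_adj_inv_cayley_iff[OF W(1)] W(3) by simp
  then have "completion W W'" using W by (simp add: completion_def regular_pair_def)
  then show "\<exists>W W'. completion W W' \<and> B = inv_cayley z W" using W(3) by blast
next
  assume "\<exists>W W'. completion W W' \<and> B = inv_cayley z W"
  then obtain W W' where W: "completion W W'" "B = inv_cayley z W" by blast
  have ext: "\<forall>h\<in>M. W h = V h" and tp: "\<forall>h\<in>M. C (W' (C h)) = V h" and pair: "contraction_pair W W'"
    using W(1) by (simp_all add: completion_def)
  have reg: "regular_pair W W'" by (rule extension_regular[OF pair]) (use ext in blast)
  have "max_dissipative B \<and> T \<subseteq>\<^sub>m B" using max_dissipative_extension_iff[of B] reg ext W(2) by blast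
  moreover have "max_antidissipative (adj B)" unfolding W(2) by (rule max_antidissipative_adj_inv_cayley[OF reg])
  moreover have "conj_op C T \<subseteq>\<^sub>m adj B" unfolding W(2) conj_le_adj_inv_cayley_iff[OF reg] by (rule tp)
  ultimately show "max_dissipative B \<and> T \<subseteq>\<^sub>m B \<and> max_antidissipative (adj B) \<and> conj_op C T \<subseteq>\<^sub>m adj B"
    by simp
qed

lemma inv_cayley_completion_eq:
  assumes "trivial_intersection" and "completion W1 W1'" and "completion W2 W2'"
  shows "inv_cayley z W1 = inv_cayley z W2"
  by (simp only: completion_unique[OF assms])

lemma two_extensions:
  assumes "\<not> trivial_intersection"
  obtains S1 S1' S2 S2' where "completion S1 S1'" "\<forall>x. C (S1' (C x)) = S1 x"
    and "completion S2 S2'" "\<forall>x. C (S2' (C x)) = S2 x" and "inv_cayley z S1 \<noteq> inv_cayley z S2"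
proof (rule two_symmetric_completions[OF assms])
  fix S1 S1' S2 S2'
  assume S1: "completion S1 S1'" "\<And>x. C (S1' (C x)) = S1 x"
    and S2: "completion S2 S2'" "\<And>x. C (S2' (C x)) = S2 x" and neq: "S1 \<noteq> S2"
  have "regular_pair S W" if "completion S W" for S W
    using that by (intro extension_regular) (auto simp: completion_def)
  then have "inv_cayley z S1 \<noteq> inv_cayley z S2"
    using inv_cayley_inject[of S1 S1' S2 S2' z] S1(1) S2(1) neq z by blast
  with S1 S2 show thesis by (intro that[of S1 S1' S2 S2']) auto
qed

text \<open>Uniqueness of the completion passes to the operators since the Cayley transform is injective on
  them; if the intersection is not trivial, already the symmetric completions are not unique.\<close>

lemma condition_i_iff:
  "(\<exists>!B. C_selfadjoint C B \<and> max_dissipative B \<and> T \<subseteq>\<^sub>m B) \<longleftrightarrow> trivial_intersection"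
  unfolding C_selfadjoint_extension_iff
proof
  assume unique: "\<exists>!B. \<exists>W W'. completion W W' \<and> (\<forall>x. C (W' (C x)) = W x) \<and> B = inv_cayley z W"
  show "trivial_intersection"
  proof (rule ccontr)
    assume "\<not> trivial_intersection"
    then show False by (rule two_extensions) (use unique in blast)
  qed
next
  assume triv: "trivial_intersection"
  obtain S S' where S: "completion S S'" "\<And>x. C (S' (C x)) = S x"
    using symmetric_completion_exists by blast
  show "\<exists>!B. \<exists>W W'. completion W W' \<and> (\<forall>x. C (W' (C x)) = W x) \<and> B = inv_cayley z W"
  proof (rule ex1I)
    show "\<exists>W W'. completion W W' \<and> (\<forall>x. C (W' (C x)) = W x) \<and> inv_cayley z S = inv_cayley z W"
      using S by blast
    fix B assume "\<exists>W W'. completion W W' \<and> (\<forall>x. C (W' (C x)) = W x) \<and> B = inv_cayley z W"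
    then show "B = inv_cayley z S" using inv_cayley_completion_eq[OF triv _ S(1)] by blast
  qed
qed

lemma condition_ii_iff:
  "(\<exists>!B. max_dissipative B \<and> T \<subseteq>\<^sub>m B \<and> max_antidissipative (adj B) \<and> conj_op C T \<subseteq>\<^sub>m adj B)
    \<longleftrightarrow> trivial_intersection"
  unfolding doubly_extending_iff
proof
  assume unique: "\<exists>!B. \<exists>W W'. completion W W' \<and> B = inv_cayley z W"
  show "trivial_intersection"
  proof (rule ccontr)
    assume "\<not> trivial_intersection"
    then show False by (rule two_extensions) (use unique in blast)
  qed
next
  assume triv: "trivial_intersection"
  obtain S S' where S: "completion S S'" "\<And>x. C (S' (C x)) = S x"
    using symmetric_completion_exists by blast
  show "\<exists>!B. \<exists>W W'. completion W W' \<and> B = inv_cayley z W"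
  proof (rule ex1I)
    show "\<exists>W W'. completion W W' \<and> inv_cayley z S = inv_cayley z W" using S(1) by blast
    fix B assume "\<exists>W W'. completion W W' \<and> B = inv_cayley z W"
    then show "B = inv_cayley z S" using inv_cayley_completion_eq[OF triv _ S(1)] by blast
  qed
qed

subsection \<open>The metric conditions\<close>

lemma cond_iii_iff: "cond_iii C T z \<longleftrightarrow> trivial_intersection"
  by (simp add: cond_iii_def trivial_intersection_def N_eq)

lemma M_nonempty: "M \<noteq> {}"
  using csubspace_0[OF M(1)] by blast

lemma cond_iv_iff: "cond_iv C T z \<longleftrightarrow> trivial_intersection"
proof -
  have INF: "(INF h\<in>M. (norm (defect_op T z (C \<phi>) - defect_op T z (C h)))\<^sup>2) = 0 \<longleftrightarrow>
      defect_op T z (C \<phi>) \<in> closure (defect_op T z ` CM)" for \<phi>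
    using INF_norm_diff_squared_eq_0_iff[OF M_nonempty, of 1 "defect_op T z (C \<phi>)" "\<lambda>h. defect_op T z (C h)"]
    by (simp add: image_image)
  have zero: "defect_op T z (C 0) \<in> closure (defect_op T z ` CM)"
    by (intro subsetD[OF closure_subset] imageI csubspace_0[OF M(1)])
  show ?thesis
    unfolding cond_iv_def trivial_intersection_iff_density N_eq[symmetric] INF
  proof (intro iffI ballI)
    fix \<phi>
    assume *: "\<forall>\<phi>\<in>N - {0}. defect_op T z (C \<phi>) \<in> closure (defect_op T z ` CM)" and "\<phi> \<in> N"
    then show "defect_op T z (C \<phi>) \<in> closure (defect_op T z ` CM)"
      using zero by (cases "\<phi> = 0") simp_all
  qed simp
qed

lemma cond_v_iff: "cond_v C T z \<longleftrightarrow> trivial_intersection"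
proof -
  have "(SUP f. ennreal ((cmod (cinner (C f) \<phi>))\<^sup>2) / ennreal ((norm (defect_op T z f))\<^sup>2)) = \<infinity> \<longleftrightarrow>
      (\<nexists>c. \<forall>f. (cmod (cinner (C f) \<phi>))\<^sup>2 \<le> c * (norm (defect_op T z f))\<^sup>2)" for \<phi>
    by (subst SUP_ennreal_quotient_eq_top_iff) auto
  then show ?thesis
    unfolding cond_v_def trivial_intersection_iff_unbounded N_eq by simp
qed

subsection \<open>The conditions in terms of the extension by the defect space\<close>

text \<open>On \<open>N\<close> the operator \<open>V\<close> vanishes, so the vectors \<open>h - V h\<close> with \<open>h = (T - cnj z) f + (z - cnj z) \<phi>\<close>
  are the vectors \<open>(z - cnj z) (f + \<phi>)\<close>.\<close>

lemma T_tilde_eq: "T_tilde T z = inv_cayley z V"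
proof (rule operator_eqI)
  fix f g
  define R where "R g \<longleftrightarrow> (\<exists>f\<^sub>T\<in>dom T. \<exists>\<phi>\<in>defect_space T z. f = f\<^sub>T + \<phi> \<and> g = app T f\<^sub>T + z *\<^sub>C \<phi>)" for g
  note Z = diff_cnj_neq_0[OF z]
  have V_N: "V \<phi> = 0" if "\<phi> \<in> N" for \<phi>
  proof (rule eqI_cinner_left)
    show "cinner (V \<phi>) y = cinner 0 y" for y
      using cinner_N_M[OF U_in that] by (simp add: contraction_pair_adjoint[OF VU])
  qed
  have R_iff: "R g \<longleftrightarrow> inv_cayley z V f = Some g" for g
  proof
    assume "R g"
    then obtain f\<^sub>T \<phi> where dom: "f\<^sub>T \<in> dom T" and \<phi>: "\<phi> \<in> N"
      and f: "f = f\<^sub>T + \<phi>" and g: "g = app T f\<^sub>T + z *\<^sub>C \<phi>"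
      unfolding R_def N_eq by blast
    define g\<^sub>T where "g\<^sub>T = app T f\<^sub>T"
    have T: "T f\<^sub>T = Some g\<^sub>T" using dom by (auto simp: g\<^sub>T_def)
    define k where "k = (1 / (z - cnj z)) *\<^sub>C (g\<^sub>T - cnj z *\<^sub>C f\<^sub>T)"
    define w where "w = (1 / (z - cnj z)) *\<^sub>C (g\<^sub>T - z *\<^sub>C f\<^sub>T)"
    have V: "V (k + \<phi>) = w"
      unfolding contraction_pair_add[OF VU] V_N[OF \<phi>]
      by (simp add: k_def w_def contraction_pair_scaleC[OF VU] V_cayley[OF T])
    have "k - w = (1 / (z - cnj z)) *\<^sub>C ((z - cnj z) *\<^sub>C f\<^sub>T)"
      unfolding k_def w_def by (simp add: scaleC_diff_left flip: scaleC_diff_right)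
    then have "f = (k + \<phi>) - w" using Z by (simp add: f scaleC_scaleC scaleC_one algebra_simps)
    moreover have "z *\<^sub>C k - cnj z *\<^sub>C w = (1 / (z - cnj z)) *\<^sub>C ((z - cnj z) *\<^sub>C g\<^sub>T)"
      unfolding k_def w_def scaleC_diff_left scaleC_diff_right
      by (simp add: scaleC_scaleC mult.commute mult.left_commute)
    then have "g = z *\<^sub>C (k + \<phi>) - cnj z *\<^sub>C w"
      using Z by (simp add: g g\<^sub>T_def[symmetric] scaleC_scaleC scaleC_one scaleC_add_right algebra_simps)
    ultimately show "inv_cayley z V f = Some g"
      unfolding inv_cayley_eq_Some[OF regular] by (intro exI[of _ "k + \<phi>"]) (simp add: V)
  next
    assume "inv_cayley z V f = Some g"
    then obtain h where h: "f = h - V h" "g = z *\<^sub>C h - cnj z *\<^sub>C V h"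
      unfolding inv_cayley_eq_Some[OF regular] by blast
    define \<phi> where "\<phi> = h - P h"
    have \<phi>: "\<phi> \<in> N" unfolding \<phi>_def by (rule P_compl)
    obtain f0 g0 where T0: "T f0 = Some g0" "P h = g0 - cnj z *\<^sub>C f0"
      using P_in[of h] unfolding ran_space_iff by blast
    define f\<^sub>T where "f\<^sub>T = (z - cnj z) *\<^sub>C f0"
    define g\<^sub>T where "g\<^sub>T = (z - cnj z) *\<^sub>C g0"
    have T: "T f\<^sub>T = Some g\<^sub>T" unfolding f\<^sub>T_def g\<^sub>T_def by (rule linear_op_scaleC[OF T_linear T0(1)])
    have hd: "h = (g0 - cnj z *\<^sub>C f0) + \<phi>" by (simp add: \<phi>_def T0(2)[symmetric])
    have Vh: "V h = g0 - z *\<^sub>C f0"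
      unfolding hd contraction_pair_add[OF VU] V_N[OF \<phi>] V_cayley[OF T0(1)] by simp
    have "f = f\<^sub>T + \<phi>"
      unfolding h(1) Vh f\<^sub>T_def by (subst hd) (simp add: scaleC_diff_left)
    moreover have "g = app T f\<^sub>T + z *\<^sub>C \<phi>"
      unfolding h(2) Vh T g\<^sub>T_def
      by (subst hd) (simp add: scaleC_simps g\<^sub>T_def mult.commute)
    ultimately show "R g" unfolding R_def N_eq[symmetric] using T \<phi> by blast
  qed
  have "T_tilde T z f = (if \<exists>g. R g then Some (THE g. R g) else None)"
    unfolding T_tilde_def R_def by (auto intro!: if_cong)
  then show "T_tilde T z f = Some g \<longleftrightarrow> inv_cayley z V f = Some g"
    using Some_The_eq_iff[of R g] unfolding R_iff by auto
qed

abbreviation A :: "'a operator" where "A \<equiv> adj (T_tilde T z)"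

lemma A_eq_Some: "A f = Some g \<longleftrightarrow> (\<exists>u. f = u - U u \<and> g = cnj z *\<^sub>C u - z *\<^sub>C U u)"
  unfolding T_tilde_eq adj_inv_cayley[OF regular z] inv_cayley_eq_Some[OF regular_pair_swap[OF regular]]
  by simp

lemma app_A: "app A (u - U u) = cnj z *\<^sub>C u - z *\<^sub>C U u"
  using A_eq_Some[of "u - U u" "cnj z *\<^sub>C u - z *\<^sub>C U u"] by (metis option.sel)

lemma dom_A: "dom A = (\<lambda>u. u - U u) ` UNIV"
  using A_eq_Some by (auto simp: dom_def)

lemma shift_A_eq_Some:
  "shift_op A z g = Some h \<longleftrightarrow> (\<exists>u. g = u - U u \<and> h = (cnj z - z) *\<^sub>C u)"
  unfolding shift_op_eq_Some A_eq_Some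
  by (auto simp: scaleC_diff_left scaleC_diff_right)

lemma app_shift_A: "app (shift_op A z) (u - U u) = (cnj z - z) *\<^sub>C u"
  using shift_A_eq_Some[of "u - U u" "(cnj z - z) *\<^sub>C u"] by (metis option.sel)

text \<open>For \<open>g = u - U u\<close> the vectors \<open>A g - z g\<close> and \<open>A g - cnj z g\<close> are the same multiple of \<open>u\<close>
  and \<open>U u\<close>, so the dissipation identity expresses the dissipation by
  \<open>\<parallel>u\<parallel>\<^sup>2 - \<parallel>U u\<parallel>\<^sup>2 = \<parallel>D u\<parallel>\<^sup>2\<close>.\<close>

lemma dissipation_A: "- Im (cinner (app A (u - U u)) (u - U u)) = Im z * (norm (defect_op T z u))\<^sup>2"
proof -
  define f where "f = u - U u"
  define g where "g = cnj z *\<^sub>C u - z *\<^sub>C U u"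
  have "g - z *\<^sub>C f = (cnj z - z) *\<^sub>C u" "g - cnj z *\<^sub>C f = (cnj z - z) *\<^sub>C U u"
    using inv_cayley_shift[of f u "U u" g "cnj z"] by (simp_all add: f_def g_def)
  moreover have "cmod (cnj z - z) = 2 * Im z"
    using z by (simp add: diff_cnj_eq norm_mult norm_minus_commute[of "cnj z" z])
  ultimately have "(2 * Im z)\<^sup>2 * (norm (U u))\<^sup>2 - (2 * Im z)\<^sup>2 * (norm u)\<^sup>2 = 4 * Im z * Im (cinner g f)"
    using dissipation_identity[of g z f] by (simp add: power_mult_distrib)
  then have "4 * Im z * (Im z * ((norm (U u))\<^sup>2 - (norm u)\<^sup>2)) = 4 * Im z * Im (cinner g f)"
    by (simp add: power2_eq_square algebra_simps)
  then have "Im z * ((norm (U u))\<^sup>2 - (norm u)\<^sup>2) = Im (cinner g f)" using z by simp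
  then show ?thesis
    unfolding app_A norm_D by (simp add: f_def[symmetric] g_def[symmetric] algebra_simps)
qed

lemma G_space_eq: "G_space C T z = (\<lambda>u. u - U u) ` CM"
proof -
  have nz: "cnj z - z \<noteq> 0" using diff_cnj_neq_0[OF z] by auto
  have inj: "f = f'" if eqs: "shift_op A z f = Some h" "shift_op A z f' = Some h" for f f' h
  proof -
    obtain u where u: "f = u - U u" "h = (cnj z - z) *\<^sub>C u"
      using eqs(1) unfolding shift_A_eq_Some by blast
    obtain u' where u': "f' = u' - U u'" "h = (cnj z - z) *\<^sub>C u'"
      using eqs(2) unfolding shift_A_eq_Some by blast
    have "(cnj z - z) *\<^sub>C (u - u') = 0" using u(2) u'(2) by (simp add: scaleC_diff_right)
    then have "norm ((cnj z - z) *\<^sub>C (u - u')) = 0" by simp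
    then have "u = u'" using nz by simp
    then show ?thesis using u u' by simp
  qed
  have "g \<in> G_space C T z \<longleftrightarrow> (\<exists>u. g = u - U u \<and> (cnj z - z) *\<^sub>C u \<in> CM)" for g
  proof -
    have "inv_op (shift_op A z) h = Some g \<longleftrightarrow> (\<exists>u. g = u - U u \<and> h = (cnj z - z) *\<^sub>C u)" for h
      unfolding shift_A_eq_Some[symmetric] by (rule inv_op_eq_Some) (rule inj)
    then have "g \<in> G_space C T z \<longleftrightarrow> (\<exists>h\<in>CM. \<exists>u. g = u - U u \<and> h = (cnj z - z) *\<^sub>C u)"
      by (simp only: G_space_def mem_Collect_eq)
    moreover have "(\<exists>h\<in>X. \<exists>u. g = u - U u \<and> h = (cnj z - z) *\<^sub>C u) \<longleftrightarrow>
        (\<exists>u. g = u - U u \<and> (cnj z - z) *\<^sub>C u \<in> X)" for X by blast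
    ultimately show ?thesis by simp
  qed
  moreover have "(cnj z - z) *\<^sub>C u \<in> CM \<longleftrightarrow> u \<in> CM" for u
  proof
    assume "(cnj z - z) *\<^sub>C u \<in> CM"
    then have "(1 / (cnj z - z)) *\<^sub>C (cnj z - z) *\<^sub>C u \<in> CM" by (rule csubspace_scaleC[OF CM])
    then show "u \<in> CM" using nz by (simp add: scaleC_scaleC scaleC_one)
  qed (rule csubspace_scaleC[OF CM])
  ultimately show ?thesis by blast
qed

text \<open>For \<open>f = v - U v\<close> and \<open>\<psi> = u - U u\<close> with \<open>u\<close> in \<open>C M\<close> the expression under the infimum is
  \<open>Im z \<parallel>D v - D u\<parallel>\<^sup>2\<close>, so the condition is density of \<open>D (C M)\<close> in the whole range of \<open>D\<close>.\<close>

lemma cond_vi_iff: "cond_vi C T z \<longleftrightarrow> trivial_intersection"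
proof -
  have INF: "(INF \<psi>\<in>G_space C T z. Im (cinner (- app A (v - U v - \<psi>)) (v - U v - \<psi>))) = 0 \<longleftrightarrow>
      defect_op T z v \<in> closure (defect_op T z ` CM)" for v
  proof -
    have "Im (cinner (- app A (v - U v - (u - U u))) (v - U v - (u - U u)))
        = Im z * (norm (defect_op T z v - defect_op T z u))\<^sup>2" for u
    proof -
      have eq: "v - U v - (u - U u) = (v - u) - U (v - u)"
        unfolding contraction_pair_diff[OF contraction_pair_swap[OF VU]] by simp
      have "defect_op T z (v - u) = defect_op T z v - defect_op T z u"
        by (rule clinear_on_diff[OF D_clinear csubspace_UNIV UNIV_I UNIV_I])
      then show ?thesis unfolding eq using dissipation_A[of "v - u"] by simp
    qed
    moreover have "CM \<noteq> {}" using M_nonempty by simp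
    ultimately show ?thesis
      using INF_norm_diff_squared_eq_0_iff[OF _ z, of CM "defect_op T z v" "defect_op T z"]
      unfolding G_space_eq image_image by simp
  qed
  have closure: "csubspace (closure (defect_op T z ` CM))"
    by (rule csubspace_closure[OF csubspace_image[OF D_clinear CM]])
  have "cond_vi C T z \<longleftrightarrow> (\<forall>v. v - U v \<noteq> 0 \<longrightarrow> defect_op T z v \<in> closure (defect_op T z ` CM))"
    unfolding cond_vi_def Let_def dom_A INF[symmetric] by blast
  also have "\<dots> \<longleftrightarrow> (\<forall>v. defect_op T z v \<in> closure (defect_op T z ` CM))"
  proof -
    have "defect_op T z v \<in> closure (defect_op T z ` CM)" if "v - U v = 0" for v
    proof -
      have "U v = v" using that by simp
      then have "v = 0" using regular_pair_swap[OF regular] unfolding regular_pair_def by blast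
      then show ?thesis
        using csubspace_0[OF closure] clinear_on_0[OF D_clinear csubspace_UNIV] by simp
    qed
    then show ?thesis by blast
  qed
  also have "\<dots> \<longleftrightarrow> (\<forall>\<phi>\<in>N. defect_op T z (C \<phi>) \<in> closure (defect_op T z ` CM))"
  proof (intro iffI allI)
    fix v assume dense: "\<forall>\<phi>\<in>N. defect_op T z (C \<phi>) \<in> closure (defect_op T z ` CM)"
    have v: "v = C (P (C v)) + C (C v - P (C v))"
      by (simp add: conjugation_diff[OF C] conjugation_involutive[OF C])
    have "defect_op T z (C (P (C v))) + defect_op T z (C (C v - P (C v))) \<in> closure (defect_op T z ` CM)"
    proof (rule csubspace_add[OF closure])
      show "defect_op T z (C (P (C v))) \<in> closure (defect_op T z ` CM)"
        by (intro subsetD[OF closure_subset] imageI P_in)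
      show "defect_op T z (C (C v - P (C v))) \<in> closure (defect_op T z ` CM)"
        by (rule dense[rule_format, OF P_compl])
    qed
    also have "defect_op T z (C (P (C v))) + defect_op T z (C (C v - P (C v))) = defect_op T z v"
      by (subst (3) v) (rule clinear_on_add[OF D_clinear UNIV_I UNIV_I, symmetric])
    finally show "defect_op T z v \<in> closure (defect_op T z ` CM)" .
  qed blast
  finally show ?thesis unfolding trivial_intersection_iff_density .
qed

text \<open>For \<open>g = u - U u\<close> the quotient is \<open>4 Im z\<close> times the quotient with \<open>C u\<close> and \<open>D u\<close> that tests
  membership of \<open>C \<phi>\<close> in the range of \<open>D\<close>.\<close>

lemma cond_vii_iff: "cond_vii C T z \<longleftrightarrow> trivial_intersection"
proof -
  have sup_iff: "(SUP g\<in>dom A. ennreal ((cmod (cinner (C (app (shift_op A z) g)) \<phi>))\<^sup>2)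
        / ennreal (- Im (cinner (app A g) g))) = \<infinity> \<longleftrightarrow>
      (\<nexists>c. \<forall>f. (cmod (cinner (C f) \<phi>))\<^sup>2 \<le> c * (norm (defect_op T z f))\<^sup>2)" for \<phi>
  proof -
    have "cmod (cnj z - z) = 2 * Im z"
      using z by (simp add: diff_cnj_eq norm_mult norm_minus_commute[of "cnj z" z])
    then have num: "(cmod (cinner (C ((cnj z - z) *\<^sub>C u)) \<phi>))\<^sup>2 = 4 * (Im z)\<^sup>2 * (cmod (cinner (C u) \<phi>))\<^sup>2" for u
      unfolding conjugation_scaleC[OF C] cinner_scaleC_left norm_mult complex_mod_cnj
      by (simp add: power_mult_distrib)
    have "(SUP g\<in>dom A. ennreal ((cmod (cinner (C (app (shift_op A z) g)) \<phi>))\<^sup>2)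
        / ennreal (- Im (cinner (app A g) g))) =
      (SUP u. ennreal (4 * (Im z)\<^sup>2 * (cmod (cinner (C u) \<phi>))\<^sup>2)
        / ennreal (Im z * (norm (defect_op T z u))\<^sup>2))"
      unfolding dom_A image_image app_shift_A dissipation_A num ..
    also have "\<dots> = \<infinity> \<longleftrightarrow> (\<nexists>c. \<forall>u. 4 * (Im z)\<^sup>2 * (cmod (cinner (C u) \<phi>))\<^sup>2
        \<le> c * (Im z * (norm (defect_op T z u))\<^sup>2))"
      using z by (subst SUP_ennreal_quotient_eq_top_iff) auto
    also have "(\<exists>c. \<forall>u. 4 * (Im z)\<^sup>2 * (cmod (cinner (C u) \<phi>))\<^sup>2 \<le> c * (Im z * (norm (defect_op T z u))\<^sup>2))
        \<longleftrightarrow> (\<exists>c. \<forall>f. (cmod (cinner (C f) \<phi>))\<^sup>2 \<le> c * (norm (defect_op T z f))\<^sup>2)"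
    proof
      assume "\<exists>c. \<forall>u. 4 * (Im z)\<^sup>2 * (cmod (cinner (C u) \<phi>))\<^sup>2 \<le> c * (Im z * (norm (defect_op T z u))\<^sup>2)"
      then obtain c where c: "\<And>u. 4 * (Im z)\<^sup>2 * (cmod (cinner (C u) \<phi>))\<^sup>2
          \<le> c * (Im z * (norm (defect_op T z u))\<^sup>2)" by blast
      have "(cmod (cinner (C f) \<phi>))\<^sup>2 \<le> (c / (4 * Im z)) * (norm (defect_op T z f))\<^sup>2" for f
        using c[of f] z by (simp add: field_simps power2_eq_square)
      then show "\<exists>c. \<forall>f. (cmod (cinner (C f) \<phi>))\<^sup>2 \<le> c * (norm (defect_op T z f))\<^sup>2" by blast
    next
      assume "\<exists>c. \<forall>f. (cmod (cinner (C f) \<phi>))\<^sup>2 \<le> c * (norm (defect_op T z f))\<^sup>2"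
      then obtain c where c: "\<And>f. (cmod (cinner (C f) \<phi>))\<^sup>2 \<le> c * (norm (defect_op T z f))\<^sup>2" by blast
      have "4 * (Im z)\<^sup>2 * (cmod (cinner (C u) \<phi>))\<^sup>2 \<le> (4 * Im z * c) * (Im z * (norm (defect_op T z u))\<^sup>2)" for u
        using mult_left_mono[OF c[of u], of "4 * (Im z)\<^sup>2"] by (simp add: power2_eq_square ac_simps)
      then show "\<exists>c. \<forall>u. 4 * (Im z)\<^sup>2 * (cmod (cinner (C u) \<phi>))\<^sup>2 \<le> c * (Im z * (norm (defect_op T z u))\<^sup>2)"
        by blast
    qed
    finally show ?thesis .
  qed
  show ?thesis
    unfolding cond_vii_def Let_def sup_iff trivial_intersection_iff_unbounded N_eq ..
qed

end

lemma cayley_eq_Some: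
  fixes T :: "'a::complex_hilbert_space operator"
  assumes T: "dissipative T" and z: "0 < Im z"
  shows "cayley T z h = Some k \<longleftrightarrow> (\<exists>f g. T f = Some g \<and> h = g - cnj z *\<^sub>C f \<and> k = g - z *\<^sub>C f)"
proof -
  have lin: "linear_op T" using T by (simp add: dissipative_def)
  have inj: "f = f'" if eqs: "shift_op T (cnj z) f = Some h" "shift_op T (cnj z) f' = Some h" for f f' h
  proof -
    obtain g where g: "T f = Some g" "h = g - cnj z *\<^sub>C f"
      using eqs(1) unfolding shift_op_eq_Some by blast
    obtain g' where g': "T f' = Some g'" "h = g' - cnj z *\<^sub>C f'"
      using eqs(2) unfolding shift_op_eq_Some by blast
    have "Im z * norm (f - f') \<le> norm (g - g' - cnj z *\<^sub>C (f - f'))"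
      by (rule dissipative_norm_le(2)[OF T z linear_op_diff[OF lin g(1) g'(1)]])
    also have "g - g' - cnj z *\<^sub>C (f - f') = (g - cnj z *\<^sub>C f) - (g' - cnj z *\<^sub>C f')"
      by (simp add: scaleC_diff_right algebra_simps)
    also have "\<dots> = 0" by (simp only: g(2)[symmetric] g'(2)[symmetric] diff_self)
    finally show "f = f'" using z by (simp add: mult_le_0_iff)
  qed
  have "cayley T z h = Some k \<longleftrightarrow> (\<exists>f. inv_op (shift_op T (cnj z)) h = Some f \<and> shift_op T z f = Some k)"
    unfolding cayley_def map_comp_def by (auto split: option.splits)
  also have "\<dots> \<longleftrightarrow> (\<exists>f g. T f = Some g \<and> h = g - cnj z *\<^sub>C f \<and> k = g - z *\<^sub>C f)"
  proof -
    have "inv_op (shift_op T (cnj z)) h = Some f \<longleftrightarrow> shift_op T (cnj z) f = Some h" for f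
      by (rule inv_op_eq_Some) (rule inj)
    moreover have "shift_op T (cnj z) f = Some h \<and> shift_op T z f = Some k \<longleftrightarrow>
        (\<exists>g. T f = Some g \<and> h = g - cnj z *\<^sub>C f \<and> k = g - z *\<^sub>C f)" for f
      by (cases "T f") (auto simp: shift_op_def)
    ultimately show ?thesis by simp
  qed
  finally show ?thesis .
qed

text \<open>Symmetry of \<open>V\<close> is symmetry of \<open>T\<close> for \<open>cinner x (C y)\<close>, because the cross terms with \<open>z\<close> and
  \<open>cnj z\<close> agree; closedness of \<open>T\<close> makes \<open>M\<close> closed, so that \<open>U\<close> takes its values in \<open>M\<close>.\<close>

lemma cayley_setting_exists:
  fixes C :: "'a::complex_hilbert_space \<Rightarrow> 'a"
  assumes C: "conjugation C" and lin: "linear_op T" and dense: "densely_defined T" and cl: "closed_op T"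
    and symm: "C_symmetric C T" and diss: "dissipative T" and z: "0 < Im z"
  obtains V U where "cayley_setting C T z V U"
proof (rule cayley_contraction[OF diss z])
  fix V U assume VU: "contraction_pair V U"
    and V: "\<And>f g. T f = Some g \<Longrightarrow> V (g - cnj z *\<^sub>C f) = g - z *\<^sub>C f"
    and "\<And>y. U y \<in> closure (ran_space T z)"
  then have U_in: "U y \<in> ran_space T z" for y using closed_ran_space[OF diss cl z] by simp
  have M: "csubspace (ran_space T z)" by (rule csubspace_ran_space[OF lin])
  have T_symm: "cinner g (C f') = cinner f (C g')" if "T f = Some g" "T f' = Some g'" for f g f' g'
  proof -
    have "conj_op C (adj T) f' = Some g'" using symm that(2) by (simp add: C_symmetric_def operator_le_iff)
    then show ?thesis using that(1) unfolding conj_op_eq_Some[OF C] adj_eq_Some[OF dense] by blast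
  qed
  have cayley: "cayley T z h = Some k \<longleftrightarrow> h \<in> ran_space T z \<and> k = V h" for h k
    unfolding cayley_eq_Some[OF diss z] ran_space_iff using V by auto
  have dom_cayley: "dom (cayley T z) = ran_space T z" by (auto simp: dom_def cayley)
  have cayley_adj: "cayley_adj T z y = Some (U y)" for y
    unfolding cayley_adj_def
    using dom_cayley closure_subset U_in
    by (subst adjoint_from_eq_Some[OF M]) (auto simp: cayley contraction_pair_adjoint[OF VU])
  have "cayley T z (U y) = Some (V (U y))" for y using U_in by (simp add: cayley)
  then have defect: "defect_op T z = sqrt_op (\<lambda>f. f - V (U f))"
    by (simp add: defect_op_def cayley_adj)
  have pc: "positive_contraction (\<lambda>f. V (U f))"
  proof
    note UV = contraction_pair_swap[OF VU]
    show norm: "norm (V (U x)) \<le> norm x" for x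
      using contraction_pair_norm[OF VU, of "U x"] contraction_pair_norm[OF UV, of x] by linarith
    show "bounded_positive (\<lambda>f. V (U f))"
      unfolding bounded_positive_def
    proof (intro conjI allI)
      show "bounded_linear (\<lambda>f. V (U f))"
        by (rule bounded_linear_intro[of _ 1])
          (simp_all add: contraction_pair_add[OF UV] contraction_pair_add[OF VU] scaleR_scaleC
            contraction_pair_scaleC[OF UV] contraction_pair_scaleC[OF VU] norm)
      show "V (U (c *\<^sub>C x)) = c *\<^sub>C V (U x)" for c x
        by (simp add: contraction_pair_scaleC[OF UV] contraction_pair_scaleC[OF VU])
      show "Im (cinner (V (U x)) x) = 0" "0 \<le> Re (cinner (V (U x)) x)" for x
        by (simp_all add: contraction_pair_adjoint[OF VU] cinner_self)
    qed
  qed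
  have "cayley_setting C T z V U"
  proof
    show "cinner (V h) (C k) = cinner h (C (V k))" if hk: "h \<in> ran_space T z" "k \<in> ran_space T z" for h k
    proof -
      obtain f g where f: "T f = Some g" "h = g - cnj z *\<^sub>C f"
        using hk(1) unfolding ran_space_iff by blast
      obtain f' g' where f': "T f' = Some g'" "k = g' - cnj z *\<^sub>C f'"
        using hk(2) unfolding ran_space_iff by blast
      show ?thesis
        unfolding f(2) f'(2) V[OF f(1)] V[OF f'(1)]
        using T_symm[OF f(1) f'(1)]
        by (simp add: conjugation_diff[OF C] conjugation_scaleC[OF C] cinner_diff_left
          cinner_diff_right algebra_simps)
    qed
    show "bounded_positive (defect_op T z)"
      unfolding defect positive_contraction.sqrt_op_eq[OF pc]
      by (rule positive_contraction.bounded_positive_sqrt_series[OF pc])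
    show "defect_op T z (defect_op T z x) = x - V (U x)" for x
      unfolding defect positive_contraction.sqrt_op_eq[OF pc]
      by (rule positive_contraction.sqrt_series_square[OF pc])
  qed (use C M closed_ran_space[OF diss cl z] VU U_in lin dense z V in auto)
  then show thesis by (rule that)
qed

lemma all_equivalent_const:
  assumes "\<And>p. p \<in> set ps \<Longrightarrow> p = q"
  shows "all_equivalent ps"
  unfolding all_equivalent_def using assms by blast

theorem theorem5p4:
  fixes C :: "'a::complex_hilbert_space \<Rightarrow> 'a"
    and T :: "'a operator"
  assumes "conjugation C"
    and "linear_op T" and "densely_defined T" and "closed_op T"
    and "C_symmetric C T" and "dissipative T"
  shows "all_equivalent
    [\<exists>!T'. C_selfadjoint C T' \<and> max_dissipative T' \<and> T \<subseteq>\<^sub>m T',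
     \<exists>!T\<^sub>0. max_dissipative T\<^sub>0 \<and> T \<subseteq>\<^sub>m T\<^sub>0 \<and>
       max_antidissipative (adj T\<^sub>0) \<and> conj_op C T \<subseteq>\<^sub>m adj T\<^sub>0,
     \<exists>z. Im z > 0 \<and> cond_iii C T z,
     \<forall>z. Im z > 0 \<longrightarrow> cond_iii C T z,
     \<exists>z. Im z > 0 \<and> cond_iv C T z,
     \<forall>z. Im z > 0 \<longrightarrow> cond_iv C T z,
     \<exists>z. Im z > 0 \<and> cond_v C T z,
     \<forall>z. Im z > 0 \<longrightarrow> cond_v C T z,
     \<exists>z. Im z > 0 \<and> cond_vi C T z,
     \<forall>z. Im z > 0 \<longrightarrow> cond_vi C T z,
     \<exists>z. Im z > 0 \<and> cond_vii C T z,
     \<forall>z. Im z > 0 \<longrightarrow> cond_vii C T z]"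
proof -
  define i where "i \<longleftrightarrow> (\<exists>!T'. C_selfadjoint C T' \<and> max_dissipative T' \<and> T \<subseteq>\<^sub>m T')"
  define ii where "ii \<longleftrightarrow> (\<exists>!T\<^sub>0. max_dissipative T\<^sub>0 \<and> T \<subseteq>\<^sub>m T\<^sub>0 \<and>
    max_antidissipative (adj T\<^sub>0) \<and> conj_op C T \<subseteq>\<^sub>m adj T\<^sub>0)"
  \<comment> \<open>Conditions (i) and (ii) do not mention the point, so a condition holds at one point if and only if
    it holds at all of them.\<close>
  have at_point: "(ii \<longleftrightarrow> i) \<and> (cond_iii C T z \<longleftrightarrow> i) \<and> (cond_iv C T z \<longleftrightarrow> i) \<and> (cond_v C T z \<longleftrightarrow> i) \<and>
      (cond_vi C T z \<longleftrightarrow> i) \<and> (cond_vii C T z \<longleftrightarrow> i)" if "0 < Im z" for z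
  proof (rule cayley_setting_exists[OF assms that])
    fix V U assume "cayley_setting C T z V U"
    then interpret cayley_setting C T z V U .
    show ?thesis
      unfolding i_def ii_def condition_i_iff condition_ii_iff cond_iii_iff cond_iv_iff cond_v_iff
        cond_vi_iff cond_vii_iff by simp
  qed
  have "0 < Im \<i>" by simp
  from at_point[OF this] have "ii \<longleftrightarrow> i" by blast
  moreover have "(\<exists>z. Im z > 0 \<and> Q z) \<longleftrightarrow> i" "(\<forall>z. Im z > 0 \<longrightarrow> Q z) \<longleftrightarrow> i"
    if "\<And>z. 0 < Im z \<Longrightarrow> Q z \<longleftrightarrow> i" for Q
    using that \<open>0 < Im \<i>\<close> by blast+
  ultimately show ?thesis
    unfolding i_def[symmetric] ii_def[symmetric] using at_point
    by (intro all_equivalent_const[where q = i]) auto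
qed

end
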